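(* Consider the problem $\min_{x\in\Omega} f(x)=\frac1n\sum_{i=1}^n f_i(x)$ with $f_i(x)=\mathbb{E}_{\xi_i}[F_i(x,\xi_i)]$, where the $f_i$ are convex but not necessarily smooth, and suppose that Assumptions (A1)--(A5) listed in the context hold. For a horizon $T\ge1$ let $\{x_{i,k}\}_{k>0}$, $i\in\mathcal V$, be generated by the algorithm Com-DSZO (described in the context) with $\mu=1/\sqrt T$, $\epsilon=\mu/(2\underline R)$, $\psi\in(0,r^{-1}]$, $\eta_k=1/\sqrt{k+c}$ with $c>0$, and $\gamma>0$ satisfying $\gamma<\min\{1,\delta\kappa_1^{-1},c_0\kappa_2^{-1}\}$. Then for any optimal point $x^*\in\Omega$, with $\bar x_k=\frac1n\sum_{i=1}^nx_{i,k}$, $$\sum_{k=1}^T\mathbb{E}[f(\bar x_k)-f(x^* )]\le\mathcal O\big(d^2\sqrt{T+c}\big)+\mathcal O\left(\frac{d^2}{(\psi r\omega)^2}\big(\sqrt{T+c}+\ln(T+c)\big)\right).$$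
   Context: Setting. There are $n$ agents $\mathcal V=\{1,\dots,n\}$; $\Omega\subseteq\mathbb{R}^d$; $\xi_i$ is a random sample from an unknown distribution $\mathcal P_i$; $F_i(\cdot,\xi_i)$ is real-valued and $f_i(x)=\mathbb{E}_{\xi_i}[F_i(x,\xi_i)]$. $\mathcal N_i$ is the set of agents with which $i$ interacts (including $i$ itself in the sums below), and $\mathbf W\in\mathbb{R}^{n\times n}$ is the weight matrix of the communication graph $\mathcal G$ ($\mathbf W_{i,j}=0$ for $j\notin\mathcal N_i$). Assumptions. (A1) $\mathcal G$ is undirected, connected and balanced, so $\mathbf W$ is doubly stochastic; $\mathbf W^{\mathsf T}=\mathbf W$; $\mathrm{null}(\mathbf I-\mathbf W)=\mathrm{span}(\mathbf 1)$; $\mathbf I+\mathbf W\succ0$. Write $\mathbf H=\frac1n\mathbf 1\mathbf 1^{\mathsf T}$; the spectral gap $\delta\in(0,1]$ is defined by $\|\mathbf W-\mathbf H\|_2=1-\delta$, and $\beta=\|\mathbf I-\mathbf W\|_2\in(0,2)$. (A2) $\Omega$ is closed and convex, and there are $\bar R,\underline R>0$ such that $\Omega$ contains the Euclidean ball of radius $\underline R$ centered at $0$ and is contained in the ball of radius $\bar R$ centered at $0$. (A3) For each $i$, $F_i(x,\xi_i)$ is convex and $L_f$-Lipschitz continuous in $x$ on $\Omega$, with $L_f>0$. (A4) There is $\hat\sigma>0$ with $\mathbb{E}_{\xi_i}[\|\nabla_xF_i(x,\xi_i)-\nabla f_i(x)\|^2]\le\hat\sigma^2$ for all $x\in\Omega$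 and all $i$. (A5) The (possibly random) compressor $\mathcal C:\mathbb{R}^d\to\mathbb{R}^d$ is such that, for a scaling factor $r\ge1$, $\mathcal C_r(x)=\frac1r\mathcal C(x)$ satisfies $\mathbb{E}_{\mathcal C}[\|\mathcal C_r(x)-x\|^2]\le(1-\omega)\|x\|^2$ for all $x\in\mathbb{R}^d$, where $\omega\in(0,1]$ and the expectation is over the internal randomness of $\mathcal C$. Algorithm Com-DSZO. Inputs $\eta_k,\mu,\epsilon,\psi,\gamma$; $\Omega_\epsilon=\{(1-\epsilon)x: x\in\Omega\}$; $\Pi_{\Omega_\epsilon}$ is Euclidean projection. Initialize $x_{i,0}\in\Omega$, $\hat x_{i,0}=b_{i,0}=\mathbf 0_d$, $q_{i,0}=\mathcal C(x_{i,0})$. For $k=0,1,\dots$ each agent $i$ draws a fresh $u_{i,k}$ uniformly from the unit sphere of $\mathbb{R}^d$ and a fresh sample $\xi_{i,k}\sim\mathcal P_i$, forms $\mathbf g_i^\mu(x_{i,k})=\frac d\mu\big(F_i(x_{i,k}+\mu u_{i,k},\xi_{i,k})-F_i(x_{i,k},\xi_{i,k})\big)u_{i,k}$, and sets $\hat x_{i,k+1}=\hat x_{i,k}+\psi q_{i,k}$; $b_{i,k+1}=b_{i,k}+\psi\big(q_{i,k}-\sum_{j\in\mathcal N_i}\mathbf W_{i,j}q_{j,k}\big)$; $x_{i,k+1}=\Pi_{\Omega_\epsilon}[x_{i,k}-\gamma b_{i,k+1}-\eta_k\mathbf g_i^\mu(x_{i,k})]$; $q_{i,k+1}=\mathcal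 C(x_{i,k+1}-\hat x_{i,k+1})$. Constants. $c_0=\frac{\psi r\omega}{2}$; $\kappa_1=\frac\delta4+2(1+c_0^{-1})^2\gamma\beta^2$; $\kappa_2=(1+c_0^{-1})^2\gamma\beta^2+(1+\frac2\delta)\beta^2$ (so the condition on $\gamma$ is implicit in $\gamma$). $\beta(k)=\mathcal O(\alpha(k))$ means $\limsup_{k\to\infty}\beta(k)/\alpha(k)<+\infty$ (here in the variable $T$).
   Formalization: Convexity and Lipschitz continuity of F_i (A3) are assumed on Ω enlarged by some arbitrarily small radius ρ>0, not only on Ω: queries x+μu can leave Ω when ε=μ/(2R̲), and the claim fails if F_i is arbitrary there. *)

theory Defs
  imports "HOL-Probability.Probability" "HOL-Library.Landau_Symbols"
begin

text \<open>
  Agents are the elements of a finite type \<open>'n\<close> (so n is \<open>CARD('n)\<close>), decision vectors live in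
  \<open>real ^ 'd\<close> (so d is \<open>CARD('d)\<close>), samples have type \<open>'s\<close>, and the internal randomness of the
  compressor has type \<open>'z\<close>.
\<close>

section \<open>Communication network\<close>

definition averaging_matrix :: "real ^ 'n ^ 'n" where
  "averaging_matrix = (\<chi> i j. 1 / real CARD('n))"

definition matrix_norm2 :: "real ^ 'n ^ 'n \<Rightarrow> real" where
  "matrix_norm2 A = onorm (\<lambda>v. A *v v)"

definition spectral_gap :: "real ^ 'n ^ 'n \<Rightarrow> real" where
  "spectral_gap W = 1 - matrix_norm2 (W - averaging_matrix)"

definition laplacian_norm :: "real ^ 'n ^ 'n \<Rightarrow> real" where
  "laplacian_norm W = matrix_norm2 (mat 1 - W)"

definition doubly_stochastic :: "real ^ 'n ^ 'n \<Rightarrow> bool" where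
  "doubly_stochastic W \<longleftrightarrow>
     (\<forall>i j. 0 \<le> W $ i $ j) \<and>
     (\<forall>i. (\<Sum>j\<in>UNIV. W $ i $ j) = 1) \<and>
     (\<forall>j. (\<Sum>i\<in>UNIV. W $ i $ j) = 1)"

text \<open>
  The graph is given by its neighbourhoods \<open>N i\<close>, each of which contains \<open>i\<close>.  Weight-balancedness
  (row sums equal to column sums) is part of double stochasticity.
\<close>

definition network :: "('n \<Rightarrow> 'n set) \<Rightarrow> real ^ 'n ^ 'n \<Rightarrow> bool" where
  "network N W \<longleftrightarrow>
     (\<forall>i. i \<in> N i) \<and>
     (\<forall>i j. j \<in> N i \<longleftrightarrow> i \<in> N j) \<and>
     (\<forall>i j. (i, j) \<in> {(i, j). j \<in> N i}\<^sup>*) \<and>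
     (\<forall>i j. j \<notin> N i \<longrightarrow> W $ i $ j = 0) \<and>
     doubly_stochastic W \<and>
     transpose W = W \<and>
     {v. (mat 1 - W) *v v = 0} = span {vec 1} \<and>
     (\<forall>v. v \<noteq> 0 \<longrightarrow> 0 < v \<bullet> ((mat 1 + W) *v v)) \<and>
     0 < spectral_gap W \<and> spectral_gap W \<le> 1 \<and>
     0 < laplacian_norm W \<and> laplacian_norm W < 2"

section \<open>Constraint set and objective\<close>

definition feasible_set :: "(real ^ 'd) set \<Rightarrow> real \<Rightarrow> real \<Rightarrow> bool" where
  "feasible_set \<Omega> Rin Rout \<longleftrightarrow>
     closed \<Omega> \<and> convex \<Omega> \<and> 0 < Rin \<and> 0 < Rout \<and> cball 0 Rin \<subseteq> \<Omega> \<and> \<Omega> \<subseteq> cball 0 Rout"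

definition local_objective ::
  "('n \<Rightarrow> 's measure) \<Rightarrow> ('n \<Rightarrow> real ^ 'd \<Rightarrow> 's \<Rightarrow> real) \<Rightarrow> 'n \<Rightarrow> real ^ 'd \<Rightarrow> real" where
  "local_objective P F i x = (\<integral>s. F i x s \<partial>(P i))"

definition objective ::
  "('n \<Rightarrow> 's measure) \<Rightarrow> ('n \<Rightarrow> real ^ 'd \<Rightarrow> 's \<Rightarrow> real) \<Rightarrow> real ^ 'd \<Rightarrow> real" where
  "objective P F x = (1 / real CARD('n)) * (\<Sum>i\<in>(UNIV :: 'n set). local_objective P F i x)"

definition optimal_point ::
  "('n \<Rightarrow> 's measure) \<Rightarrow> ('n \<Rightarrow> real ^ 'd \<Rightarrow> 's \<Rightarrow> real) \<Rightarrow> (real ^ 'd) set \<Rightarrow> real ^ 'd \<Rightarrow> bool" where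
  "optimal_point P F \<Omega> y \<longleftrightarrow> y \<in> \<Omega> \<and> (\<forall>x\<in>\<Omega>. objective P F y \<le> objective P F x)"

text \<open>The measurability and integrability that make the expectations meaningful.\<close>

definition sampling_model ::
  "('n \<Rightarrow> 's measure) \<Rightarrow> ('n \<Rightarrow> real ^ 'd \<Rightarrow> 's \<Rightarrow> real) \<Rightarrow> (real ^ 'd) set \<Rightarrow> bool" where
  "sampling_model P F \<Omega> \<longleftrightarrow>
     (\<forall>i. prob_space (P i) \<and>
          (\<lambda>(x, s). F i x s) \<in> borel_measurable (borel \<Otimes>\<^sub>M P i) \<and>
          (\<forall>x\<in>\<Omega>. integrable (P i) (F i x)))"

definition convex_lipschitz_samples ::
  "('n \<Rightarrow> 's measure) \<Rightarrow> ('n \<Rightarrow> real ^ 'd \<Rightarrow> 's \<Rightarrow> real) \<Rightarrow> (real ^ 'd) set \<Rightarrow> real \<Rightarrow> bool" where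
  "convex_lipschitz_samples P F D L \<longleftrightarrow>
     0 < L \<and>
     (\<forall>i. \<forall>s\<in>space (P i). convex_on D (\<lambda>x. F i x s) \<and> L-lipschitz_on D (\<lambda>x. F i x s))"

text \<open>
  Since the functions need not be differentiable, the gradients in the variance bound are
  subgradients relative to the constraint set; where a function is differentiable, its gradient is
  one of them.
\<close>

definition subgradient_on ::
  "(real ^ 'd) set \<Rightarrow> (real ^ 'd \<Rightarrow> real) \<Rightarrow> real ^ 'd \<Rightarrow> real ^ 'd \<Rightarrow> bool" where
  "subgradient_on D h x g \<longleftrightarrow> (\<forall>y\<in>D. h x + g \<bullet> (y - x) \<le> h y)"

definition bounded_gradient_variance ::
  "('n \<Rightarrow> 's measure) \<Rightarrow> ('n \<Rightarrow> real ^ 'd \<Rightarrow> 's \<Rightarrow> real) \<Rightarrow> (real ^ 'd) set \<Rightarrow>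
   ('n \<Rightarrow> real ^ 'd \<Rightarrow> 's \<Rightarrow> real ^ 'd) \<Rightarrow> ('n \<Rightarrow> real ^ 'd \<Rightarrow> real ^ 'd) \<Rightarrow> real \<Rightarrow> bool" where
  "bounded_gradient_variance P F \<Omega> dF df \<sigma> \<longleftrightarrow>
     0 < \<sigma> \<and>
     (\<forall>i. \<forall>x\<in>\<Omega>.
        (\<forall>s\<in>space (P i). subgradient_on \<Omega> (\<lambda>y. F i y s) x (dF i x s)) \<and>
        subgradient_on \<Omega> (local_objective P F i) x (df i x) \<and>
        dF i x \<in> borel_measurable (P i) \<and>
        integrable (P i) (\<lambda>s. (norm (dF i x s - df i x))\<^sup>2) \<and>
        (\<integral>s. (norm (dF i x s - df i x))\<^sup>2 \<partial>(P i)) \<le> \<sigma>\<^sup>2)"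

section \<open>Compressor\<close>

text \<open>
  \<open>C z\<close> is the compressor for the realisation \<open>z\<close> of its internal randomness, whose law is \<open>Q\<close>.
\<close>

definition compressor ::
  "'z measure \<Rightarrow> ('z \<Rightarrow> real ^ 'd \<Rightarrow> real ^ 'd) \<Rightarrow> real \<Rightarrow> real \<Rightarrow> bool" where
  "compressor Q C r \<omega> \<longleftrightarrow>
     prob_space Q \<and>
     (\<lambda>(z, x). C z x) \<in> borel_measurable (Q \<Otimes>\<^sub>M borel) \<and>
     1 \<le> r \<and> 0 < \<omega> \<and> \<omega> \<le> 1 \<and>
     (\<forall>x. integrable Q (\<lambda>z. (norm ((1 / r) *\<^sub>R C z x - x))\<^sup>2) \<and>
          (\<integral>z. (norm ((1 / r) *\<^sub>R C z x - x))\<^sup>2 \<partial>Q) \<le> (1 - \<omega>) * (norm x)\<^sup>2)"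

section \<open>Algorithm Com-DSZO\<close>

text \<open>
  Normalised surface measure on the unit sphere, obtained by projecting the uniform distribution on
  the unit ball radially (the image 0 of the centre is a null event).
\<close>

definition sphere_uniform :: "(real ^ 'd) measure" where
  "sphere_uniform = distr (uniform_measure lborel (ball 0 1)) borel (\<lambda>v. v /\<^sub>R norm v)"

text \<open>
  Directions, samples and compressor randomness are drawn afresh by every agent in every round.
  The triples are independent over all agents and rounds, and the product law of each triple makes
  its three components independent of each other.
\<close>

definition fresh_randomness ::
  "'w measure \<Rightarrow> ('n \<Rightarrow> 's measure) \<Rightarrow> 'z measure \<Rightarrow> ('n \<Rightarrow> nat \<Rightarrow> 'w \<Rightarrow> real ^ 'd) \<Rightarrow>
   ('n \<Rightarrow> nat \<Rightarrow> 'w \<Rightarrow> 's) \<Rightarrow> ('n \<Rightarrow> nat \<Rightarrow> 'w \<Rightarrow> 'z) \<Rightarrow> bool" where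
  "fresh_randomness M P Q u \<xi> \<zeta> \<longleftrightarrow>
     prob_space.indep_vars M (\<lambda>(i, k). sphere_uniform \<Otimes>\<^sub>M (P i \<Otimes>\<^sub>M Q))
       (\<lambda>(i, k) w. (u i k w, \<xi> i k w, \<zeta> i k w)) UNIV \<and>
     (\<forall>i k. distr M (sphere_uniform \<Otimes>\<^sub>M (P i \<Otimes>\<^sub>M Q)) (\<lambda>w. (u i k w, \<xi> i k w, \<zeta> i k w))
        = sphere_uniform \<Otimes>\<^sub>M (P i \<Otimes>\<^sub>M Q))"

definition zo_gradient ::
  "(real ^ 'd \<Rightarrow> 's \<Rightarrow> real) \<Rightarrow> real \<Rightarrow> real ^ 'd \<Rightarrow> real ^ 'd \<Rightarrow> 's \<Rightarrow> real ^ 'd" where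
  "zo_gradient F \<mu> x u s = (real CARD('d) / \<mu> * (F (x + \<mu> *\<^sub>R u) s - F x s)) *\<^sub>R u"

definition shrunk_set :: "real \<Rightarrow> (real ^ 'd) set \<Rightarrow> (real ^ 'd) set" where
  "shrunk_set \<epsilon> \<Omega> = (\<lambda>x. (1 - \<epsilon>) *\<^sub>R x) ` \<Omega>"

text \<open>
  One sample path of the algorithm: \<open>u\<close>, \<open>\<xi>\<close>, \<open>\<zeta>\<close> are realisations of the random inputs, and
  \<open>x\<close>, \<open>xh\<close>, \<open>b\<close>, \<open>q\<close> are the sequences it generates from the initial points \<open>x0\<close>.
\<close>

definition com_dszo ::
  "(real ^ 'd) set \<Rightarrow> ('n \<Rightarrow> 'n set) \<Rightarrow> real ^ 'n ^ 'n \<Rightarrow> ('n \<Rightarrow> real ^ 'd \<Rightarrow> 's \<Rightarrow> real) \<Rightarrow>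
   ('z \<Rightarrow> real ^ 'd \<Rightarrow> real ^ 'd) \<Rightarrow>
   (nat \<Rightarrow> real) \<Rightarrow> real \<Rightarrow> real \<Rightarrow> real \<Rightarrow> real \<Rightarrow>
   ('n \<Rightarrow> real ^ 'd) \<Rightarrow> ('n \<Rightarrow> nat \<Rightarrow> real ^ 'd) \<Rightarrow> ('n \<Rightarrow> nat \<Rightarrow> 's) \<Rightarrow> ('n \<Rightarrow> nat \<Rightarrow> 'z) \<Rightarrow>
   ('n \<Rightarrow> nat \<Rightarrow> real ^ 'd) \<Rightarrow> ('n \<Rightarrow> nat \<Rightarrow> real ^ 'd) \<Rightarrow>
   ('n \<Rightarrow> nat \<Rightarrow> real ^ 'd) \<Rightarrow> ('n \<Rightarrow> nat \<Rightarrow> real ^ 'd) \<Rightarrow> bool" where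
  "com_dszo \<Omega> N W F C \<eta> \<mu> \<epsilon> \<psi> \<gamma> x0 u \<xi> \<zeta> x xh b q \<longleftrightarrow>
     (\<forall>i. x i 0 = x0 i \<and> xh i 0 = 0 \<and> b i 0 = 0 \<and> q i 0 = C (\<zeta> i 0) (x0 i)) \<and>
     (\<forall>i k.
        xh i (Suc k) = xh i k + \<psi> *\<^sub>R q i k \<and>
        b i (Suc k) = b i k + \<psi> *\<^sub>R (q i k - (\<Sum>j\<in>N i. W $ i $ j *\<^sub>R q j k)) \<and>
        x i (Suc k) = closest_point (shrunk_set \<epsilon> \<Omega>)
          (x i k - \<gamma> *\<^sub>R b i (Suc k) - \<eta> k *\<^sub>R zo_gradient (F i) \<mu> (x i k) (u i k) (\<xi> i k)) \<and>
        q i (Suc k) = C (\<zeta> i (Suc k)) (x i (Suc k) - xh i (Suc k)))"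

definition agent_average :: "('n \<Rightarrow> real ^ 'd) \<Rightarrow> real ^ 'd" where
  "agent_average x = (1 / real CARD('n)) *\<^sub>R (\<Sum>i\<in>(UNIV :: 'n set). x i)"

section \<open>Constants in the step-size condition\<close>

definition c0_const :: "real \<Rightarrow> real \<Rightarrow> real \<Rightarrow> real" where
  "c0_const \<psi> r \<omega> = \<psi> * r * \<omega> / 2"

definition kappa1 :: "real \<Rightarrow> real \<Rightarrow> real \<Rightarrow> real \<Rightarrow> real" where
  "kappa1 \<delta> \<beta> c0 \<gamma> = \<delta> / 4 + 2 * (1 + 1 / c0)\<^sup>2 * \<gamma> * \<beta>\<^sup>2"

definition kappa2 :: "real \<Rightarrow> real \<Rightarrow> real \<Rightarrow> real \<Rightarrow> real" where
  "kappa2 \<delta> \<beta> c0 \<gamma> = (1 + 1 / c0)\<^sup>2 * \<gamma> * \<beta>\<^sup>2 + (1 + 2 / \<delta>) * \<beta>\<^sup>2"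

end

theory Submission
  imports Defs
begin

text \<open>
  All constants of the problem are fixed, so the claim is that the expected suboptimality, summed over
  the rounds, is of order \<open>sqrt (T + c)\<close>.

  Collect the iterates, the public estimates and the gradient estimates of round \<open>k\<close> as rows of matrices
  \<open>X\<close>, \<open>Xh\<close> and \<open>G\<close>, and let \<open>E\<close> be \<open>X\<close> minus the estimates after the transmission of that round.  The
  auxiliary variables are the Laplacian of the estimates (\<open>auxiliary_eq\<close>), so a round replaces \<open>X\<close> by
  the projection of \<open>mixing \<gamma> W ** X + \<gamma> (I - W) E - \<eta> G\<close>, where \<open>mixing \<gamma> W = I - \<gamma> (I - W)\<close>.

  The projection fixes the rows of \<open>mixing \<gamma> W ** X\<close>.  Hence the disagreement \<open>C\<close> and the
  tracking error \<open>D\<close> satisfy \<open>C' \<le> (1 - \<gamma> \<delta>) C + \<gamma> \<beta> e + \<eta> norm G\<close> and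
  \<open>D' \<le> (1 + \<gamma> \<beta>) e + \<gamma> \<beta> C + \<eta> norm G\<close>, with \<open>e = norm E\<close>, and compression gives \<open>e \<le> (1 - c0) D\<close> in
  root mean square.  The condition on \<open>\<gamma>\<close> implies \<open>2 \<gamma> \<beta>\<^sup>2 < c0 \<delta>\<close>; together with \<open>\<delta> \<le> \<beta>\<close> this makes
  the linear system a contraction in a weighted maximum norm (\<open>contraction_weights\<close>).  As the gradient
  estimates are bounded, both errors are of order \<open>\<eta> k\<close> in root mean square (\<open>error_recursion\<close>,
  \<open>damped_recursion\<close>).

  Let \<open>Y\<close> have all rows equal to \<open>y = (1 - \<epsilon>) x*\<close>.  Expanding the squared distance of the
  next iterate to \<open>Y\<close>, the transmission error meets \<open>mixing \<gamma> W ** X - Y\<close> through \<open>I - W\<close>, which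
  annihilates everything but the disagreement (\<open>distance_step\<close>).  So the inner product of \<open>X - Y\<close> and
  \<open>G\<close>, times \<open>2 \<eta>\<close>, is a telescoping difference plus terms of order \<open>\<eta>\<^sup>2\<close>.

  For a convex Lipschitz function the mean of the two-point estimate is a subgradient up to
  an error of order \<open>\<mu>\<close> (\<open>two_point_estimate_subgradient\<close>): pair each direction with its reflection in
  the hyperplane orthogonal to \<open>y - x\<close> and compare slopes along \<open>y - x\<close>.  The randomness of a round is
  independent of its state, so this applies conditionally on the past (\<open>expectation_fresh\<close>) and turns
  the inner products into suboptimality gaps, up to \<open>\<mu>\<close>, \<open>\<epsilon>\<close> and the disagreement.

  Dividing by \<open>\<eta> k\<close> and summing by parts (\<open>regret_bound\<close>) leaves \<open>1 / \<eta> T\<close>, the sum of the step sizes, and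
  \<open>T (\<mu> + \<epsilon>)\<close>, each of order \<open>sqrt (T + c)\<close>.
\<close>

section \<open>Orthogonal invariance of Lebesgue measure\<close>

lemma emeasure_unit_ball:
  "emeasure lborel (ball (0::'a::euclidean_space) 1) \<noteq> 0" "emeasure lborel (ball (0::'a) 1) \<noteq> \<infinity>"
  using emeasure_lborel_ball_finite[of "0::'a" 1] content_ball_pos[of 1 "0::'a"]
  by (auto simp: measure_def)

text \<open>
  A sigma-finite measure that is invariant under translations is determined up to a factor: integrating
  \<open>indicator A x * indicator B (x + y)\<close> in both orders exchanges the two measures.  The image of
  Lebesgue measure under a linear bijection is translation invariant, and for an orthogonal map the
  unit ball, which is mapped to itself, fixes the factor to 1.
\<close>

lemma lborel_distr_orthogonal:
  fixes f :: "'a::euclidean_space \<Rightarrow> 'a"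
  assumes f: "orthogonal_transformation f"
  shows "distr lborel borel f = lborel"
proof -
  define \<nu> where "\<nu> = distr lborel borel f"
  have lin: "linear f" and bij: "bij f"
    using f by (auto simp: orthogonal_transformation_linear orthogonal_transformation_bij)
  have [measurable]: "f \<in> borel_measurable borel"
    using lin by (intro borel_measurable_continuous_onI linear_continuous_on linear_conv_bounded_linear[THEN iffD1])
  have \<nu>_sets [simp, measurable_cong]: "sets \<nu> = sets borel" and \<nu>_space: "space \<nu> = UNIV"
    by (auto simp: \<nu>_def)
  have shift: "distr lborel borel ((+) a) = lborel" for a :: 'a
    by (rule lborel_distr_plus)
  have flip: "distr lborel borel (\<lambda>y. x - y) = lborel" for x :: 'a
    using lborel_affine[of "-1" x] by (simp add: density_1)
  have \<nu>_shift: "distr \<nu> borel (\<lambda>x. x + a) = \<nu>" for a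
  proof -
    obtain a' where a': "f a' = a"
      using bij by (metis bij_pointE)
    have "distr \<nu> borel (\<lambda>x. x + a) = distr lborel borel (\<lambda>x. f x + a)"
      by (simp add: \<nu>_def distr_distr o_def)
    also have "\<dots> = distr lborel borel (\<lambda>x. f (a' + x))"
      by (simp add: linear_add[OF lin] a' add.commute)
    also have "\<dots> = distr (distr lborel borel ((+) a')) borel f"
      by (simp add: distr_distr o_def)
    finally show ?thesis by (simp add: shift \<nu>_def)
  qed
  have ball_inv: "emeasure \<nu> (ball 0 1) = emeasure lborel (ball (0::'a) 1)"
  proof -
    have "f -` ball 0 1 = ball 0 1"
      using f by (auto simp: orthogonal_transformation_norm)
    then show ?thesis by (simp add: \<nu>_def emeasure_distr)
  qed
  have "sigma_finite_measure \<nu>"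
  proof (rule sigma_finite_measure.intro, rule exI[of _ "range (\<lambda>n::nat. ball 0 (real n))"], intro conjI ballI)
    show "\<Union> (range (\<lambda>n::nat. ball 0 (real n))) = space \<nu>"
      by (auto simp: \<nu>_space intro: reals_Archimedean2)
    fix A assume "A \<in> range (\<lambda>n::nat. ball (0::'a) (real n))"
    then obtain n :: nat where A: "A = ball 0 (real n)" by auto
    have "f -` A = A"
      using f by (auto simp: orthogonal_transformation_norm A)
    then show "emeasure \<nu> A \<noteq> \<infinity>"
      using emeasure_lborel_ball_finite[of 0 "real n"] by (simp add: \<nu>_def emeasure_distr A less_top)
  qed (auto)
  then interpret \<nu>: sigma_finite_measure \<nu> .
  interpret pair_sigma_finite \<nu> lborel ..
  \<comment> \<open>with \<open>B\<close> the unit ball this identifies the two measures on every Borel set \<open>A\<close>\<close>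
  have swap: "emeasure \<nu> A * emeasure lborel B = emeasure \<nu> B * emeasure lborel A"
    if [measurable]: "A \<in> sets borel" "B \<in> sets borel" for A B
  proof -
    have "emeasure \<nu> A * emeasure lborel B = (\<integral>\<^sup>+x. indicator A x * (\<integral>\<^sup>+y. indicator B y \<partial>lborel) \<partial>\<nu>)"
      by (simp add: nn_integral_multc)
    also have "\<dots> = (\<integral>\<^sup>+x. indicator A x * (\<integral>\<^sup>+y. indicator B (x + y) \<partial>lborel) \<partial>\<nu>)"
    proof -
      have "(\<integral>\<^sup>+y. indicator B y \<partial>lborel) = (\<integral>\<^sup>+y. indicator B (x + y) \<partial>lborel)" for x
        by (subst shift[of x, symmetric], subst nn_integral_distr) auto
      then show ?thesis by simp
    qed
    also have "\<dots> = (\<integral>\<^sup>+x. (\<integral>\<^sup>+y. indicator A x * indicator B (x + y) \<partial>lborel) \<partial>\<nu>)"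
      by (simp add: nn_integral_cmult)
    also have "\<dots> = (\<integral>\<^sup>+y. (\<integral>\<^sup>+x. indicator A x * indicator B (x + y) \<partial>\<nu>) \<partial>lborel)"
      by (rule Fubini'[symmetric]) measurable
    also have "\<dots> = (\<integral>\<^sup>+y. (\<integral>\<^sup>+x. indicator A (x - y) * indicator B x \<partial>\<nu>) \<partial>lborel)"
    proof -
      have "(\<integral>\<^sup>+x. indicator A (x - y) * indicator B x \<partial>\<nu>) = (\<integral>\<^sup>+x. indicator A x * indicator B (x + y) \<partial>\<nu>)" for y
        by (subst \<nu>_shift[of y, symmetric], subst nn_integral_distr) auto
      then show ?thesis by simp
    qed
    also have "\<dots> = (\<integral>\<^sup>+x. (\<integral>\<^sup>+y. indicator A (x - y) * indicator B x \<partial>lborel) \<partial>\<nu>)"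
      by (rule Fubini') measurable
    also have "\<dots> = (\<integral>\<^sup>+x. (\<integral>\<^sup>+y. indicator A (x - y) \<partial>lborel) * indicator B x \<partial>\<nu>)"
      by (simp add: nn_integral_multc)
    also have "\<dots> = (\<integral>\<^sup>+x. emeasure lborel A * indicator B x \<partial>\<nu>)"
    proof -
      have "(\<integral>\<^sup>+y. indicator A (x - y) \<partial>lborel) = (\<integral>\<^sup>+y. indicator A y \<partial>lborel)" for x
        by (subst (2) flip[of x, symmetric], subst nn_integral_distr) auto
      then show ?thesis by simp
    qed
    also have "\<dots> = emeasure \<nu> B * emeasure lborel A"
      by (simp add: nn_integral_cmult) (simp add: mult.commute)
    finally show ?thesis .
  qed
  have "emeasure \<nu> A = emeasure lborel A" if "A \<in> sets \<nu>" for A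
  proof -
    have "emeasure \<nu> A * emeasure lborel (ball (0::'a) 1) = emeasure lborel A * emeasure lborel (ball (0::'a) 1)"
      using swap[of A "ball 0 1"] that by (simp add: ball_inv mult.commute)
    then show ?thesis using emeasure_unit_ball[where 'a='a]
      by (metis ennreal_mult_cancel_left infinity_ennreal_def mult.commute)
  qed
  then show ?thesis unfolding \<nu>_def[symmetric] by (intro measure_eqI) auto
qed

definition reflection :: "'a::real_inner \<Rightarrow> 'a \<Rightarrow> 'a" where
  "reflection e u = u - (2 * (u \<bullet> e)) *\<^sub>R e"

lemma orthogonal_transformation_reflection:
  assumes "norm e = 1"
  shows "orthogonal_transformation (reflection e)"
proof -
  have "e \<bullet> e = 1" using assms by (simp add: dot_square_norm)
  then show ?thesis
    unfolding orthogonal_transformation_def reflection_def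
    by (auto intro!: linearI simp: algebra_simps inner_simps inner_commute)
qed

lemma borel_measurable_reflection [measurable]: "reflection (e::'a::euclidean_space) \<in> borel_measurable borel"
  unfolding reflection_def[abs_def] by measurable

section \<open>The uniform distribution on the sphere\<close>

lemma sets_sphere_uniform [simp, measurable_cong]: "sets sphere_uniform = sets borel"
  and space_sphere_uniform [simp]: "space sphere_uniform = UNIV"
  by (auto simp: sphere_uniform_def)

lemma prob_space_sphere_uniform: "prob_space (sphere_uniform :: (real^'d) measure)"
proof -
  interpret prob_space "uniform_measure lborel (ball (0::real^'d) 1)"
    by (rule prob_space_uniform_measure) (rule emeasure_unit_ball)+
  show ?thesis unfolding sphere_uniform_def
    by (rule prob_space_distr) (auto)
qed

lemma AE_sphere_uniform_norm: "AE u in (sphere_uniform :: (real^'d) measure). norm u = 1"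
proof -
  have "AE v in lborel. v \<noteq> (0::real^'d)"
    by (rule AE_lborel_singleton)
  then have "AE v in uniform_measure lborel (ball (0::real^'d) 1). norm (v /\<^sub>R norm v) = 1"
    by (subst AE_uniform_measure) (use emeasure_unit_ball in \<open>auto simp: top.not_eq_extremum\<close>)
  then show ?thesis unfolding sphere_uniform_def
    by (subst AE_distr_iff) auto
qed

lemma sphere_uniform_orthogonal:
  fixes f :: "real^'d \<Rightarrow> real^'d"
  assumes f: "orthogonal_transformation f"
  shows "distr sphere_uniform borel f = sphere_uniform"
proof -
  have lin: "linear f" using f by (simp add: orthogonal_transformation_linear)
  have [measurable]: "f \<in> borel_measurable borel"
    using lin by (intro borel_measurable_continuous_onI linear_continuous_on linear_conv_bounded_linear[THEN iffD1])
  have ball: "f -` ball 0 1 = ball 0 1"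
    using f by (auto simp: orthogonal_transformation_norm)
  have inv: "distr (uniform_measure lborel (ball 0 1)) borel f = uniform_measure lborel (ball 0 1)"
  proof (rule measure_eqI)
    fix A :: "(real^'d) set" assume "A \<in> sets (distr (uniform_measure lborel (ball 0 1)) borel f)"
    then have [measurable]: "A \<in> sets borel" by simp
    have 1: "f -` A \<in> sets borel"
      using measurable_sets[OF \<open>f \<in> borel_measurable borel\<close> \<open>A \<in> sets borel\<close>] by simp
    have "emeasure lborel (ball 0 1 \<inter> A) = emeasure (distr lborel borel f) (ball 0 1 \<inter> A)"
      by (simp add: lborel_distr_orthogonal[OF f])
    also have "\<dots> = emeasure lborel (ball 0 1 \<inter> f -` A)"
      by (subst emeasure_distr) (auto simp: ball)
    finally show "emeasure (distr (uniform_measure lborel (ball 0 1)) borel f) A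
       = emeasure (uniform_measure lborel (ball 0 1)) A"
      using 1 by (simp add: emeasure_distr)
  qed auto
  have comm: "f (v /\<^sub>R norm v) = f v /\<^sub>R norm (f v)" for v
    using f lin by (simp add: linear_scale orthogonal_transformation_norm)
  have "distr sphere_uniform borel f = distr (uniform_measure lborel (ball 0 1)) borel (\<lambda>v. f v /\<^sub>R norm (f v))"
    by (simp add: sphere_uniform_def distr_distr o_def comm)
  also have "\<dots> = distr (distr (uniform_measure lborel (ball 0 1)) borel f) borel (\<lambda>v. v /\<^sub>R norm v)"
    by (simp add: distr_distr o_def)
  finally show ?thesis by (simp add: inv sphere_uniform_def)
qed

lemma sphere_uniform_integrable_bounded:
  fixes g :: "real^'d \<Rightarrow> real"
  assumes "g \<in> borel_measurable borel" "\<And>u. norm u = 1 \<Longrightarrow> \<bar>g u\<bar> \<le> B"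
  shows "integrable sphere_uniform g"
proof -
  interpret prob_space "sphere_uniform :: (real^'d) measure" by (rule prob_space_sphere_uniform)
  show ?thesis
    by (rule integrable_const_bound[of _ B]) (use assms AE_sphere_uniform_norm in auto)
qed

lemma sphere_uniform_integral_reflection:
  fixes g :: "real^'d \<Rightarrow> real"
  assumes "norm e = 1" and [measurable]: "g \<in> borel_measurable borel"
  shows "(\<integral>u. g (reflection e u) \<partial>sphere_uniform) = (\<integral>u. g u \<partial>sphere_uniform)"
  using integral_distr[of "reflection e" sphere_uniform borel g]
  by (simp add: sphere_uniform_orthogonal[OF orthogonal_transformation_reflection[OF assms(1)]])

text \<open>
  By symmetry every direction carries the same share of \<open>(norm u)\<^sup>2 = 1\<close>; the symmetries used are the
  reflections that exchange two given unit vectors.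
\<close>

lemma sphere_uniform_second_moment:
  fixes e :: "real^'d"
  assumes e: "norm e = 1"
  shows "(\<integral>u. (u \<bullet> e)\<^sup>2 \<partial>sphere_uniform) = 1 / real CARD('d)"
proof -
  interpret prob_space "sphere_uniform :: (real^'d) measure" by (rule prob_space_sphere_uniform)
  have bound: "\<bar>(u \<bullet> e)\<^sup>2\<bar> \<le> 1" if "norm u = 1" "norm e = 1" for u e :: "real^'d"
    using Cauchy_Schwarz_ineq2[of u e] that by (simp add: abs_square_le_1)
  have int: "integrable sphere_uniform (\<lambda>u. (u \<bullet> e)\<^sup>2)" if "norm e = 1" for e :: "real^'d"
    by (rule sphere_uniform_integrable_bounded) (use bound that in auto)
  have same: "(\<integral>u. (u \<bullet> b)\<^sup>2 \<partial>sphere_uniform) = (\<integral>u. (u \<bullet> e)\<^sup>2 \<partial>sphere_uniform)"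
    if b: "norm b = 1" for b :: "real^'d"
  proof (cases "b = e")
    case False
    define a where "a = (b - e) /\<^sub>R norm (b - e)"
    \<comment> \<open>the reflection along \<open>b - e\<close> exchanges \<open>b\<close> and \<open>e\<close>\<close>
    have a: "norm a = 1" using False by (simp add: a_def)
    have be: "b \<bullet> b = 1" "e \<bullet> e = 1" using b e by (simp_all add: dot_square_norm)
    have n: "(norm (b - e))\<^sup>2 = 2 * (1 - b \<bullet> e)"
      by (simp add: power2_norm_eq_inner inner_diff_left inner_diff_right be inner_commute)
    have "1 - b \<bullet> e \<noteq> 0" using n False by auto
    have "(2 * (b \<bullet> a)) *\<^sub>R a = (2 * (b \<bullet> (b - e)) / (norm (b - e))\<^sup>2) *\<^sub>R (b - e)"
      by (simp add: a_def power2_eq_square divide_inverse)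
    also have "\<dots> = b - e"
      using \<open>1 - b \<bullet> e \<noteq> 0\<close> by (simp add: n inner_diff_right be)
    finally have rb: "reflection a b = e"
      by (simp add: reflection_def)
    have "reflection a u \<bullet> e = u \<bullet> b" for u
      using orthogonal_transformation_reflection[OF a] rb
      unfolding orthogonal_transformation_def by metis
    then show ?thesis
      using sphere_uniform_integral_reflection[OF a, of "\<lambda>u. (u \<bullet> e)\<^sup>2"] by simp
  qed simp
  have "1 = (\<integral>u. (norm u)\<^sup>2 \<partial>(sphere_uniform :: (real^'d) measure))"
  proof -
    have "(\<integral>u. (norm u)\<^sup>2 \<partial>(sphere_uniform :: (real^'d) measure)) = (\<integral>u. 1 \<partial>(sphere_uniform :: (real^'d) measure))"
      by (rule integral_cong_AE) (use AE_sphere_uniform_norm in auto)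
    then show ?thesis using prob_space by simp
  qed
  also have "\<dots> = (\<integral>u. (\<Sum>i\<in>UNIV. (u \<bullet> axis i 1)\<^sup>2) \<partial>(sphere_uniform :: (real^'d) measure))"
    unfolding norm_vec_def L2_set_def by (simp add: sum_nonneg inner_axis)
  also have "\<dots> = (\<Sum>i\<in>UNIV. (\<integral>u. (u \<bullet> axis i 1)\<^sup>2 \<partial>(sphere_uniform :: (real^'d) measure)))"
    by (rule Bochner_Integration.integral_sum) (auto intro!: int)
  also have "\<dots> = real CARD('d) * (\<integral>u. (u \<bullet> e)\<^sup>2 \<partial>sphere_uniform)"
    by (subst same) auto
  finally show ?thesis by (simp add: field_simps)
qed

section \<open>Two-point estimates are approximate subgradients\<close>

text \<open>
  The points \<open>x + \<mu> u\<close> and \<open>x + \<mu> u'\<close>, where \<open>u'\<close> is the reflection of \<open>u\<close>, lie on a line parallel to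
  \<open>y - x\<close>.  By convexity the slope of \<open>h\<close> between them is at most its slope from the point \<open>a\<close> that comes first in
  the direction of \<open>y - x\<close> to \<open>a + (y - x)\<close>, which is further away when \<open>norm (y - x) \<ge> 2 \<mu>\<close>; both ends of that longer segment
  are within \<open>\<mu>\<close> of \<open>x\<close> and \<open>y\<close>, so that slope is \<open>(h y - h x) / norm (y - x)\<close> up to \<open>2 L \<mu> / norm (y - x)\<close>.
\<close>

lemma reflected_difference_bound:
  fixes h :: "real^'d \<Rightarrow> real"
  assumes conv: "convex_on D h" and lip: "L-lipschitz_on D h"
    and sub: "cball x \<mu> \<subseteq> D" "cball y \<mu> \<subseteq> D" and \<mu>: "0 < \<mu>"
    and far: "2 * \<mu> \<le> norm (y - x)" and u: "norm u = 1"
  defines "e \<equiv> (y - x) /\<^sub>R norm (y - x)"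
  shows "(h (x + \<mu> *\<^sub>R u) - h (x + \<mu> *\<^sub>R reflection e u)) * (u \<bullet> e)
      \<le> 2 * \<mu> / norm (y - x) * (h y - h x + 2 * L * \<mu>) * (u \<bullet> e)\<^sup>2"
proof -
  define l where "l = norm (y - x)"
  have l: "0 < l" "2 * \<mu> \<le> l" using \<mu> far by (auto simp: l_def)
  have e: "norm e = 1" "l *\<^sub>R e = y - x" using l by (auto simp: e_def l_def)
  note orth = orthogonal_transformation_reflection[OF e(1)]
  have main: "(h (x + \<mu> *\<^sub>R v) - h (x + \<mu> *\<^sub>R reflection e v)) * (v \<bullet> e)
      \<le> 2 * \<mu> / l * (h y - h x + 2 * L * \<mu>) * (v \<bullet> e)\<^sup>2"
    if v: "norm v = 1" and s: "0 \<le> v \<bullet> e" for v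
  proof -
    define w where "w = reflection e v"
    define t where "t = 2 * \<mu> * (v \<bullet> e) / l"
    have w: "norm w = 1" using orth v by (simp add: w_def orthogonal_transformation_norm)
    have "v \<bullet> e \<le> 1" using norm_cauchy_schwarz[of v e] v e by simp
    then have t: "0 \<le> t" "t \<le> 1"
      using s l \<mu> mult_mono[of "2*\<mu>" l "v \<bullet> e" 1] by (auto simp: t_def field_simps)
    have in_D: "x + \<mu> *\<^sub>R w \<in> D" "y + \<mu> *\<^sub>R w \<in> D" "x \<in> D" "y \<in> D"
      using sub \<mu> w by (auto simp: subset_iff dist_norm)
    have "(1 - t) *\<^sub>R (x + \<mu> *\<^sub>R w) + t *\<^sub>R (y + \<mu> *\<^sub>R w) = x + \<mu> *\<^sub>R w + t *\<^sub>R (l *\<^sub>R e)"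
      by (simp add: e(2) algebra_simps)
    also have "\<dots> = x + \<mu> *\<^sub>R v"
      using l by (simp add: t_def w_def reflection_def algebra_simps)
    finally have comb: "(1 - t) *\<^sub>R (x + \<mu> *\<^sub>R w) + t *\<^sub>R (y + \<mu> *\<^sub>R w) = x + \<mu> *\<^sub>R v" .
    have "h (x + \<mu> *\<^sub>R v) \<le> (1 - t) * h (x + \<mu> *\<^sub>R w) + t * h (y + \<mu> *\<^sub>R w)"
      using convex_onD[OF conv t in_D(1,2)] comb by simp
    then have "h (x + \<mu> *\<^sub>R v) - h (x + \<mu> *\<^sub>R w) \<le> t * (h (y + \<mu> *\<^sub>R w) - h (x + \<mu> *\<^sub>R w))"
      by (simp add: algebra_simps)
    also have "\<dots> \<le> t * (h y - h x + 2 * L * \<mu>)"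
    proof (rule mult_left_mono[OF _ t(1)])
      show "h (y + \<mu> *\<^sub>R w) - h (x + \<mu> *\<^sub>R w) \<le> h y - h x + 2 * L * \<mu>"
        using lipschitz_onD[OF lip in_D(2,4)] lipschitz_onD[OF lip in_D(1,3)] \<mu> w
        by (auto simp: dist_norm)
    qed
    finally have "(h (x + \<mu> *\<^sub>R v) - h (x + \<mu> *\<^sub>R w)) * (v \<bullet> e) \<le> t * (h y - h x + 2 * L * \<mu>) * (v \<bullet> e)"
      using s by (rule mult_right_mono)
    then show ?thesis by (simp add: t_def w_def power2_eq_square mult_ac)
  qed
  have "e \<bullet> e = 1" using e(1) by (simp add: dot_square_norm)
  then have flip: "reflection e u \<bullet> e = - (u \<bullet> e)" "reflection e (reflection e u) = u"
    by (auto simp: reflection_def inner_simps algebra_simps)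
  show ?thesis
  proof (cases "0 \<le> u \<bullet> e")
    case True
    then show ?thesis using main[OF u] by (simp add: l_def)
  next
    case False
    have "norm (reflection e u) = 1"
      using orth u by (simp add: orthogonal_transformation_norm)
    from main[OF this] False show ?thesis
      by (simp add: flip l_def algebra_simps)
  qed
qed

text \<open>
  In expectation over \<open>u\<close>, the two-point estimate at \<open>x\<close> behaves like a subgradient of \<open>h\<close> up to an error
  of order \<open>\<mu>\<close>.  Since \<open>u\<close> and its reflection have the same law, the
  expectation can be computed from the average over the two; the reflected differences are bounded
  pointwise by a multiple of \<open>(u \<bullet> e)\<^sup>2\<close>, whose mean is \<open>1 / d\<close> and cancels the factor \<open>d\<close>.  If \<open>y\<close> is
  closer to \<open>x\<close> than \<open>2 \<mu>\<close>, Lipschitz continuity makes both sides of order \<open>\<mu>\<close>.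
\<close>

lemma two_point_estimate_subgradient:
  fixes h :: "real^'d \<Rightarrow> real"
  assumes conv: "convex_on D h" and lip: "L-lipschitz_on D h"
    and sub: "cball x \<mu> \<subseteq> D" "cball y \<mu> \<subseteq> D" and \<mu>: "0 < \<mu>"
    and [measurable]: "h \<in> borel_measurable borel"
  shows "h x - h y - 2 * (real CARD('d) + 1) * L * \<mu>
    \<le> (\<integral>u. real CARD('d) / \<mu> * (h (x + \<mu> *\<^sub>R u) - h x) * (u \<bullet> (x - y)) \<partial>sphere_uniform)"
    (is "?l \<le> ?r")
proof -
  interpret prob_space "sphere_uniform :: (real^'d) measure" by (rule prob_space_sphere_uniform)
  let ?d = "real CARD('d)"
  have L: "0 \<le> L" using lip by (rule lipschitz_on_nonneg)
  have in_D: "x \<in> D" "y \<in> D" using sub \<mu> by auto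
  have query: "\<bar>h (x + \<mu> *\<^sub>R u) - h x\<bar> \<le> L * \<mu>" if "norm u = 1" for u
  proof -
    have "x + \<mu> *\<^sub>R u \<in> D" using sub(1) \<mu> that by (auto simp: subset_iff dist_norm)
    from lipschitz_onD[OF lip this in_D(1)] show ?thesis
      using that \<mu> by (simp add: dist_norm)
  qed
  have bnd: "\<bar>(h (x + \<mu> *\<^sub>R u) - h x) * (u \<bullet> a)\<bar> \<le> L * \<mu> * norm a" if "norm u = 1" for u a
    using mult_mono[OF query[OF that] Cauchy_Schwarz_ineq2[of u a]] that L \<mu> by (simp add: abs_mult)
  have int: "integrable sphere_uniform (\<lambda>u. (h (x + \<mu> *\<^sub>R u) - h x) * (u \<bullet> a))" for a
    by (rule sphere_uniform_integrable_bounded[OF _ bnd]) auto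
  have r_eq: "?r = ?d / \<mu> * (\<integral>u. (h (x + \<mu> *\<^sub>R u) - h x) * (u \<bullet> (x - y)) \<partial>sphere_uniform)"
    unfolding mult.assoc by simp
  show ?thesis
  proof (cases "2 * \<mu> \<le> norm (y - x)")
    case False
    have "\<bar>\<integral>u. (h (x + \<mu> *\<^sub>R u) - h x) * (u \<bullet> (x - y)) \<partial>sphere_uniform\<bar> \<le> L * \<mu> * norm (x - y)"
    proof -
      have "\<bar>\<integral>u. (h (x + \<mu> *\<^sub>R u) - h x) * (u \<bullet> (x - y)) \<partial>sphere_uniform\<bar>
          \<le> (\<integral>u. \<bar>(h (x + \<mu> *\<^sub>R u) - h x) * (u \<bullet> (x - y))\<bar> \<partial>sphere_uniform)"
        by (rule integral_abs_bound)
      also have "\<dots> \<le> (\<integral>u. L * \<mu> * norm (x - y) \<partial>(sphere_uniform :: (real^'d) measure))"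
        by (rule integral_mono_AE) (use int bnd AE_sphere_uniform_norm in auto)
      finally show ?thesis using prob_space by simp
    qed
    also have "\<dots> \<le> L * \<mu> * (2 * \<mu>)"
      using False L \<mu> by (intro mult_left_mono) (auto simp: norm_minus_commute)
    finally have "- (L * \<mu> * (2 * \<mu>)) \<le> (\<integral>u. (h (x + \<mu> *\<^sub>R u) - h x) * (u \<bullet> (x - y)) \<partial>sphere_uniform)"
      by linarith
    then have "?d / \<mu> * (- (L * \<mu> * (2 * \<mu>))) \<le> ?r"
      unfolding r_eq using \<mu> by (intro mult_left_mono) auto
    moreover have "?d / \<mu> * (- (L * \<mu> * (2 * \<mu>))) = - 2 * ?d * L * \<mu>"
      using \<mu> by (simp add: field_simps)
    moreover have "h x - h y \<le> 2 * L * \<mu>"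
    proof -
      have "h x - h y \<le> L * norm (x - y)"
        using lipschitz_onD[OF lip in_D] by (simp add: dist_norm)
      also have "\<dots> \<le> L * (2 * \<mu>)"
        using False L by (intro mult_left_mono) (auto simp: norm_minus_commute)
      finally show ?thesis by simp
    qed
    moreover have "2 * (?d + 1) * L * \<mu> = 2 * ?d * L * \<mu> + 2 * L * \<mu>"
      by (simp add: algebra_simps)
    ultimately show ?thesis by linarith
  next
    case True
    define l where "l = norm (y - x)"
    define e where "e = (y - x) /\<^sub>R norm (y - x)"
    define \<phi> where "\<phi> = (\<lambda>u. (h (x + \<mu> *\<^sub>R u) - h x) * (u \<bullet> e))"
    define K where "K = h y - h x + 2 * L * \<mu>"
    have l: "0 < l" using True \<mu> by (auto simp: l_def)
    have e: "norm e = 1" "x - y = (- l) *\<^sub>R e" using l by (auto simp: e_def l_def)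
    have [measurable]: "\<phi> \<in> borel_measurable borel" by (simp add: \<phi>_def)
    have int\<phi>: "integrable sphere_uniform \<phi>" unfolding \<phi>_def by (rule int)
    have norm_refl: "norm (reflection e u) = norm u" for u
      by (rule orthogonal_transformation_norm[OF orthogonal_transformation_reflection[OF e(1)]])
    have int\<phi>R: "integrable sphere_uniform (\<lambda>u. \<phi> (reflection e u))"
      by (rule sphere_uniform_integrable_bounded[of _ "L * \<mu> * norm e"])
         (measurable, simp only: \<phi>_def, rule bnd, simp add: norm_refl)
    have int2: "integrable sphere_uniform (\<lambda>u. (u \<bullet> e)\<^sup>2)"
    proof (rule sphere_uniform_integrable_bounded[of _ 1])
      fix u :: "real^'d" assume "norm u = 1"
      then show "\<bar>(u \<bullet> e)\<^sup>2\<bar> \<le> 1"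
        using Cauchy_Schwarz_ineq2[of u e] e by (simp add: abs_square_le_1)
    qed auto
    have "e \<bullet> e = 1" using e(1) by (simp add: dot_square_norm)
    then have flip: "reflection e u \<bullet> e = - (u \<bullet> e)" for u
      by (auto simp: reflection_def inner_simps)
    have "2 * (\<integral>u. \<phi> u \<partial>sphere_uniform)
        = (\<integral>u. \<phi> u \<partial>sphere_uniform) + (\<integral>u. \<phi> (reflection e u) \<partial>sphere_uniform)"
      by (simp add: sphere_uniform_integral_reflection[OF e(1)])
    also have "\<dots> = (\<integral>u. \<phi> u + \<phi> (reflection e u) \<partial>sphere_uniform)"
      by (simp add: Bochner_Integration.integral_add int\<phi> int\<phi>R)
    also have "\<dots> \<le> (\<integral>u. 2 * \<mu> / l * K * (u \<bullet> e)\<^sup>2 \<partial>sphere_uniform)"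
    proof (rule integral_mono_AE)
      have "\<phi> u + \<phi> (reflection e u) \<le> 2 * \<mu> / l * K * (u \<bullet> e)\<^sup>2" if "norm u = 1" for u
        using reflected_difference_bound[OF conv lip sub \<mu> True that, folded e_def, folded l_def, folded K_def]
        unfolding \<phi>_def flip by (simp add: left_diff_distrib)
      then show "AE u in sphere_uniform. \<phi> u + \<phi> (reflection e u) \<le> 2 * \<mu> / l * K * (u \<bullet> e)\<^sup>2"
        using AE_sphere_uniform_norm by auto
    qed (use int\<phi> int\<phi>R int2 in auto)
    also have "\<dots> = 2 * \<mu> / l * K * (1 / ?d)"
      by (simp add: sphere_uniform_second_moment[OF e(1)])
    finally have "(\<integral>u. \<phi> u \<partial>sphere_uniform) \<le> \<mu> / l * K * (1 / ?d)" by simp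
    then have "?d * l / \<mu> * (\<integral>u. \<phi> u \<partial>sphere_uniform) \<le> ?d * l / \<mu> * (\<mu> / l * K * (1 / ?d))"
      using \<mu> l by (intro mult_left_mono) auto
    also have "\<dots> = K" using \<mu> l by simp
    finally have "?d * l / \<mu> * (\<integral>u. \<phi> u \<partial>sphere_uniform) \<le> K" .
    moreover have "?r = - (?d * l / \<mu> * (\<integral>u. \<phi> u \<partial>sphere_uniform))"
      unfolding r_eq e(2) \<phi>_def by (simp add: mult.assoc mult.left_commute)
    moreover have "2 * (?d + 1) * L * \<mu> = 2 * (?d * (L * \<mu>)) + 2 * L * \<mu>"
      by (simp add: algebra_simps)
    moreover have "0 \<le> ?d * (L * \<mu>)" using L \<mu> by simp
    ultimately show ?thesis unfolding K_def by linarith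
  qed
qed

section \<open>Mixing over the network\<close>

lemma matrix_mult_linear:
  fixes A B :: "real^'n^'m" and X Y :: "real^'d^'n"
  shows matrix_mult_diff_left: "(A - B) ** X = A ** X - B ** X"
    and matrix_mult_diff_right: "A ** (X - Y) = A ** X - A ** Y"
    and matrix_mult_add_right: "A ** (X + Y) = A ** X + A ** Y"
    and matrix_mult_scaleR_left: "(c *\<^sub>R A) ** X = c *\<^sub>R (A ** X)"
    and matrix_mult_scaleR_right: "A ** (c *\<^sub>R X) = c *\<^sub>R (A ** X)"
  by (simp_all add: vec_eq_iff matrix_matrix_mult_def sum_subtractf sum.distrib sum_distrib_left
      left_diff_distrib right_diff_distrib distrib_left mult_ac)

lemma matrix_mult_row: "(A ** X) $ i = (\<Sum>j\<in>UNIV. A $ i $ j *\<^sub>R X $ j)"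
  for A :: "real^'n^'m" and X :: "real^'d^'n"
  by (simp add: vec_eq_iff matrix_matrix_mult_def sum_component)

lemma matrix_norm2_bound: "norm (A *v v) \<le> matrix_norm2 A * norm v"
  unfolding matrix_norm2_def
  by (rule onorm) (simp add: linear_conv_bounded_linear[THEN iffD1])

lemma matrix_norm2_nonneg: "0 \<le> matrix_norm2 A"
  unfolding matrix_norm2_def
  by (rule onorm_pos_le) (simp add: linear_conv_bounded_linear[THEN iffD1])

lemma norm_matrix_mult_le: "norm (A ** X) \<le> matrix_norm2 A * norm X"
  for A :: "real^'n^'n" and X :: "real^'d^'n"
proof -
  have cols: "(norm Z)\<^sup>2 = (\<Sum>j\<in>UNIV. (norm (column j Z))\<^sup>2)" for Z :: "real^'d^'n"
    unfolding power2_norm_eq_inner inner_vec_def column_def by simp (rule sum.swap)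
  have "column j (A ** X) = A *v column j X" for j
    by (simp add: vec_eq_iff column_def matrix_matrix_mult_def matrix_vector_mult_def)
  then have "(norm (A ** X))\<^sup>2 \<le> (\<Sum>j\<in>UNIV. (matrix_norm2 A * norm (column j X))\<^sup>2)"
    unfolding cols[of "A ** X"]
    by (intro sum_mono power_mono) (auto simp: matrix_norm2_bound)
  also have "\<dots> = (matrix_norm2 A * norm X)\<^sup>2"
    by (simp add: power_mult_distrib cols[of X] sum_distrib_left)
  finally show ?thesis
    by (rule power2_le_imp_le) (simp add: matrix_norm2_nonneg)
qed

lemma inner_symmetric_matrix_mult:
  fixes A :: "real^'n^'n" and X Y :: "real^'d^'n"
  assumes "transpose A = A"
  shows "(A ** X) \<bullet> Y = X \<bullet> (A ** Y)"
proof -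
  have sym: "A $ i $ j = A $ j $ i" for i j
    using assms by (simp add: vec_eq_iff transpose_def)
  have "(A ** X) \<bullet> Y = (\<Sum>i\<in>UNIV. \<Sum>j\<in>UNIV. A $ i $ j * (X $ j \<bullet> Y $ i))"
    by (simp add: inner_vec_def[of "A ** X"] matrix_mult_row inner_sum_left)
  also have "\<dots> = (\<Sum>j\<in>UNIV. \<Sum>i\<in>UNIV. A $ j $ i * (X $ j \<bullet> Y $ i))"
    by (subst sum.swap) (simp add: sym)
  also have "\<dots> = X \<bullet> (A ** Y)"
    by (simp add: inner_vec_def[of X] matrix_mult_row inner_sum_right)
  finally show ?thesis .
qed

text \<open>
  The transition matrix of a lazy gossip step: with probability \<open>1 - \<gamma>\<close> stay, otherwise move by \<open>W\<close>.
\<close>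

definition mixing :: "real \<Rightarrow> real^'n^'n \<Rightarrow> real^'n^'n" where
  "mixing \<gamma> W = mat 1 - \<gamma> *\<^sub>R (mat 1 - W)"

lemma averaging_row: "(averaging_matrix ** X) $ i = agent_average (\<lambda>j. X $ j)"
  by (simp add: matrix_mult_row averaging_matrix_def agent_average_def scaleR_sum_right)

locale gossip =
  fixes N :: "'n::finite \<Rightarrow> 'n set" and W :: "real^'n^'n"
  assumes network: "network N W"
begin

abbreviation "H \<equiv> averaging_matrix :: real^'n^'n"
abbreviation "\<delta> \<equiv> spectral_gap W"
abbreviation "\<beta> \<equiv> laplacian_norm W"

lemma gap: "0 < \<delta>" "\<delta> \<le> 1" and laplacian: "0 < \<beta>"
  using network by (auto simp: network_def)

lemma stochastic: "0 \<le> W $ i $ j" "(\<Sum>j\<in>UNIV. W $ i $ j) = 1" "(\<Sum>i\<in>UNIV. W $ i $ j) = 1"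
  using network by (auto simp: network_def doubly_stochastic_def)

lemma symmetric: "transpose W = W" "transpose H = H"
  using network by (auto simp: network_def averaging_matrix_def transpose_def)

lemma averaging_absorbs: "H ** W = H" "W ** H = H" "H ** H = H"
  using stochastic
  by (simp_all add: vec_eq_iff matrix_matrix_mult_def averaging_matrix_def sum_divide_distrib[symmetric])

lemma averaging_mult [simp]:
  fixes X :: "real^'d^'n"
  shows "H ** (W ** X) = H ** X" "W ** (H ** X) = H ** X" "H ** (H ** X) = H ** X"
  by (simp_all add: matrix_mul_assoc averaging_absorbs)

lemma averaging_const:
  fixes y :: "real^'d"
  shows "H ** (\<chi> i. y) = (\<chi> i. y)"
proof -
  have "(H ** (\<chi> i. y)) $ i = y" for i
    by (simp add: averaging_row agent_average_def sum_constant_scaleR del: sum_constant)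
  then show ?thesis by (simp add: vec_eq_iff[of "H ** _"])
qed

lemma mixing_mult: "mixing \<gamma> W ** X = X - \<gamma> *\<^sub>R ((mat 1 - W) ** X)" for X :: "real^'d^'n"
  by (simp add: mixing_def matrix_mult_linear)

text \<open>
  The average and the disagreement of a matrix are orthogonal, because \<open>H\<close> is an orthogonal
  projection.
\<close>

lemma averaging_pythagoras:
  fixes X :: "real^'d^'n"
  assumes "H ** Z = 0"
  shows "(norm (H ** X + Z))\<^sup>2 = (norm (H ** X))\<^sup>2 + (norm Z)\<^sup>2"
proof -
  have "(H ** X) \<bullet> Z = 0"
    by (simp add: inner_symmetric_matrix_mult symmetric assms)
  then show ?thesis by (simp add: dot_norm)
qed

lemma norm_disagreement_le: "norm (X - H ** X) \<le> norm X" for X :: "real^'d^'n"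
proof -
  have "(norm X)\<^sup>2 = (norm (H ** X))\<^sup>2 + (norm (X - H ** X))\<^sup>2"
    using averaging_pythagoras[of "X - H ** X" X] by (simp add: matrix_mult_linear)
  then show ?thesis by (auto intro: power2_le_imp_le[OF _ norm_ge_zero])
qed

lemma laplacian_bound: "norm ((mat 1 - W) ** X) \<le> \<beta> * norm X" for X :: "real^'d^'n"
  using norm_matrix_mult_le[of "mat 1 - W" X] by (simp add: laplacian_norm_def)

lemma laplacian_disagreement: "(mat 1 - W) ** (X - H ** X) = (mat 1 - W) ** X" for X :: "real^'d^'n"
  by (simp add: matrix_mult_linear)

lemma laplacian_bound_disagreement:
  "norm ((mat 1 - W) ** X) \<le> \<beta> * norm (X - H ** X)" for X :: "real^'d^'n"
  using laplacian_bound[of "X - H ** X"] by (simp add: laplacian_disagreement)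

text \<open>
  On disagreement vectors \<open>W\<close> acts like \<open>W - H\<close>, whose norm is \<open>1 - \<delta>\<close>; a gossip step averages it with
  the identity.
\<close>

lemma mixing_disagreement:
  fixes X :: "real^'d^'n"
  assumes "0 \<le> \<gamma>" "\<gamma> \<le> 1"
  shows "norm (mixing \<gamma> W ** X - H ** X) \<le> (1 - \<gamma> * \<delta>) * norm (X - H ** X)"
proof -
  define Z where "Z = X - H ** X"
  have "mixing \<gamma> W ** X - H ** X = (1 - \<gamma>) *\<^sub>R Z + \<gamma> *\<^sub>R ((W - H) ** Z)"
    by (simp add: Z_def mixing_mult matrix_mult_linear algebra_simps)
  also have "norm \<dots> \<le> (1 - \<gamma>) * norm Z + \<gamma> * norm ((W - H) ** Z)"
    using assms by (intro norm_triangle_le) simp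
  also have "\<dots> \<le> (1 - \<gamma>) * norm Z + \<gamma> * ((1 - \<delta>) * norm Z)"
    using norm_matrix_mult_le[of "W - H" Z] assms
    by (intro add_left_mono mult_left_mono) (auto simp: spectral_gap_def)
  finally show ?thesis by (simp add: Z_def algebra_simps)
qed

lemma mixing_nonexpansive:
  fixes X :: "real^'d^'n"
  assumes "0 \<le> \<gamma>" "\<gamma> \<le> 1"
  shows "norm (mixing \<gamma> W ** X) \<le> norm X"
proof (rule power2_le_imp_le)
  have "0 \<le> \<gamma> * \<delta>" using assms gap by simp
  then have "norm (mixing \<gamma> W ** X - H ** X) \<le> norm (X - H ** X)"
    using mixing_disagreement[OF assms, of X] mult_right_mono[of "1 - \<gamma> * \<delta>" 1 "norm (X - H ** X)"]
    by simp
  then have "(norm (H ** X))\<^sup>2 + (norm (mixing \<gamma> W ** X - H ** X))\<^sup>2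
      \<le> (norm (H ** X))\<^sup>2 + (norm (X - H ** X))\<^sup>2"
    by (intro add_left_mono power_mono) auto
  moreover have "(norm X)\<^sup>2 = (norm (H ** X))\<^sup>2 + (norm (X - H ** X))\<^sup>2"
    using averaging_pythagoras[of "X - H ** X" X] by (simp add: matrix_mult_linear)
  moreover have "(norm (mixing \<gamma> W ** X))\<^sup>2
      = (norm (H ** X))\<^sup>2 + (norm (mixing \<gamma> W ** X - H ** X))\<^sup>2"
    using averaging_pythagoras[of "mixing \<gamma> W ** X - H ** X" X]
    by (simp add: mixing_mult matrix_mult_linear)
  ultimately show "(norm (mixing \<gamma> W ** X))\<^sup>2 \<le> (norm X)\<^sup>2" by simp
qed simp

lemma mixing_row_mem:
  fixes X :: "real^'d^'n"
  assumes "0 \<le> \<gamma>" "\<gamma> \<le> 1" "convex S" "\<And>j. X $ j \<in> S"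
  shows "(mixing \<gamma> W ** X) $ i \<in> S"
proof -
  have "(\<Sum>j\<in>UNIV. W $ i $ j *\<^sub>R X $ j) \<in> S"
    by (rule convex_sum) (use assms stochastic in auto)
  moreover have "(mixing \<gamma> W ** X) $ i = (1 - \<gamma>) *\<^sub>R X $ i + \<gamma> *\<^sub>R (\<Sum>j\<in>UNIV. W $ i $ j *\<^sub>R X $ j)"
    by (simp add: mixing_mult matrix_mult_linear matrix_mult_row[symmetric] algebra_simps)
  ultimately show ?thesis
    using assms by (auto intro!: convexD[OF assms(3)])
qed

text \<open>
  On a nonzero disagreement vector \<open>z\<close>, \<open>(I - W) z = z - (W - H) z\<close> has norm at least \<open>\<delta> * norm z\<close>.  Such a
  vector exists since \<open>I - W\<close> is nonzero and annihilates constants.  The inequality lets the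
  smallness condition on \<open>\<gamma>\<close>, which involves \<open>\<beta>\<close> quadratically, control linear terms in \<open>\<gamma> * \<beta>\<close> too.
\<close>

lemma gap_le_laplacian: "\<delta> \<le> \<beta>"
proof -
  have "\<exists>v. (mat 1 - W) *v v \<noteq> 0"
  proof (rule ccontr)
    assume "\<not> ?thesis"
    then have "(\<lambda>v. (mat 1 - W) *v v) = (\<lambda>v. 0)" by auto
    then have "\<beta> = 0" by (simp add: laplacian_norm_def matrix_norm2_def onorm_zero)
    with laplacian show False by simp
  qed
  then obtain v where v: "(mat 1 - W) *v v \<noteq> 0" by blast
  define z where "z = v - H *v v"
  have Hz: "H *v z = 0"
    by (simp add: z_def matrix_vector_mult_diff_distrib matrix_vector_mul_assoc averaging_absorbs)
  have "(mat 1 - W) ** H = 0"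
    by (simp add: matrix_mult_linear averaging_absorbs)
  then have "(mat 1 - W) *v z = (mat 1 - W) *v v"
    by (simp add: z_def matrix_vector_mult_diff_distrib matrix_vector_mul_assoc)
  with v have z: "z \<noteq> 0" by auto
  have "z = (mat 1 - W) *v z + (W - H) *v z"
    by (simp add: matrix_vector_mult_diff_rdistrib Hz)
  then have "norm z \<le> norm ((mat 1 - W) *v z) + norm ((W - H) *v z)"
    by (metis norm_triangle_ineq)
  also have "\<dots> \<le> \<beta> * norm z + (1 - \<delta>) * norm z"
    using matrix_norm2_bound[of "mat 1 - W" z] matrix_norm2_bound[of "W - H" z]
    by (simp add: laplacian_norm_def spectral_gap_def)
  finally have "\<delta> * norm z \<le> \<beta> * norm z" by (simp add: algebra_simps)
  then show ?thesis using z by simp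
qed

end

section \<open>One step of the algorithm along a sample path\<close>

text \<open>
  Matrices have one row per agent.  \<open>X\<close> and \<open>X'\<close> are the iterates before and after a round, \<open>Xh'\<close> the
  public estimates of \<open>X\<close> after transmission, and \<open>G\<close> an arbitrary direction; in the algorithm the
  auxiliary variables \<open>b\<close> equal \<open>(I - W) Xh'\<close>.  The iterates are assumed to lie in the projection set,
  which holds from the first projection onwards.
\<close>

locale gossip_step = gossip N W
  for N :: "'n::finite \<Rightarrow> 'n set" and W :: "real^'n^'n" +
  fixes S :: "(real^'d) set" and \<gamma> \<eta> :: real and X X' Xh' G :: "real^'d^'n"
  assumes \<gamma>: "0 < \<gamma>" "\<gamma> \<le> 1" and \<eta>: "0 \<le> \<eta>"
    and S: "closed S" "convex S"
    and X'_def: "\<And>i. X' $ i = closest_point S ((X - \<gamma> *\<^sub>R ((mat 1 - W) ** Xh') - \<eta> *\<^sub>R G) $ i)"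
    and X: "\<And>i. X $ i \<in> S"
begin

abbreviation "E \<equiv> X - Xh'"

lemma pre_projection:
  "X - \<gamma> *\<^sub>R ((mat 1 - W) ** Xh') - \<eta> *\<^sub>R G = mixing \<gamma> W ** X + \<gamma> *\<^sub>R ((mat 1 - W) ** E) - \<eta> *\<^sub>R G"
  by (simp add: mixing_mult matrix_mult_linear algebra_simps)

text \<open>
  Projecting moves nothing away from points of \<open>S\<close>.  It is used twice: for \<open>Z\<close> the result of a gossip
  step, whose rows are convex combinations of rows in \<open>S\<close>, and for \<open>Z\<close> the comparison point.
\<close>

lemma projected_dist_le:
  assumes "\<And>i. Z $ i \<in> S"
  shows "norm (X' - Z) \<le> norm (mixing \<gamma> W ** X + \<gamma> *\<^sub>R ((mat 1 - W) ** E) - \<eta> *\<^sub>R G - Z)"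
proof (rule norm_le_componentwise_cart)
  fix i
  let ?p = "(X - \<gamma> *\<^sub>R ((mat 1 - W) ** Xh') - \<eta> *\<^sub>R G) $ i"
  have "norm (X' $ i - Z $ i) = dist (closest_point S ?p) (closest_point S (Z $ i))"
    using assms by (simp add: X'_def closest_point_self dist_norm)
  also have "\<dots> \<le> dist ?p (Z $ i)"
    using S X by (intro closest_point_lipschitz) auto
  finally show "norm ((X' - Z) $ i)
      \<le> norm ((mixing \<gamma> W ** X + \<gamma> *\<^sub>R ((mat 1 - W) ** E) - \<eta> *\<^sub>R G - Z) $ i)"
    unfolding pre_projection by (simp add: dist_norm)
qed

lemma move_from_mixing:
  "norm (X' - mixing \<gamma> W ** X) \<le> \<gamma> * \<beta> * norm E + \<eta> * norm G"
proof -
  have "norm (X' - mixing \<gamma> W ** X) \<le> norm (\<gamma> *\<^sub>R ((mat 1 - W) ** E) - \<eta> *\<^sub>R G)"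
    using projected_dist_le[of "mixing \<gamma> W ** X"] mixing_row_mem[OF _ \<gamma>(2) S(2) X] \<gamma> by simp
  also have "\<dots> \<le> norm (\<gamma> *\<^sub>R ((mat 1 - W) ** E)) + norm (\<eta> *\<^sub>R G)"
    by (rule norm_triangle_ineq4)
  also have "\<dots> \<le> \<gamma> * \<beta> * norm E + \<eta> * norm G"
    using mult_left_mono[OF laplacian_bound[of E], of \<gamma>] \<gamma> \<eta> by (simp add: mult.assoc)
  finally show ?thesis .
qed

lemma disagreement_step:
  "norm (X' - H ** X') \<le> (1 - \<gamma> * \<delta>) * norm (X - H ** X) + \<gamma> * \<beta> * norm E + \<eta> * norm G"
proof -
  define Z where "Z = X' - mixing \<gamma> W ** X"
  have "X' - H ** X' = (Z - H ** Z) + (mixing \<gamma> W ** X - H ** X)"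
    by (simp add: Z_def mixing_mult matrix_mult_linear)
  also have "norm \<dots> \<le> norm Z + (1 - \<gamma> * \<delta>) * norm (X - H ** X)"
    using norm_disagreement_le[of Z] mixing_disagreement[of \<gamma> X] \<gamma>
    by (intro norm_triangle_le) auto
  finally show ?thesis using move_from_mixing by (simp add: Z_def)
qed

lemma tracking_step:
  "norm (X' - Xh') \<le> (1 + \<gamma> * \<beta>) * norm E + \<gamma> * \<beta> * norm (X - H ** X) + \<eta> * norm G"
proof -
  have "X' - Xh' = E + (X' - mixing \<gamma> W ** X) - \<gamma> *\<^sub>R ((mat 1 - W) ** X)"
    by (simp add: mixing_mult)
  also have "norm \<dots> \<le> norm E + norm (X' - mixing \<gamma> W ** X) + norm (\<gamma> *\<^sub>R ((mat 1 - W) ** X))"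
    by (meson norm_triangle_ineq norm_triangle_ineq4 add_mono order_trans order_refl)
  also have "norm (\<gamma> *\<^sub>R ((mat 1 - W) ** X)) \<le> \<gamma> * \<beta> * norm (X - H ** X)"
    using mult_left_mono[OF laplacian_bound_disagreement[of X], of \<gamma>] \<gamma> by (simp add: mult.assoc)
  finally show ?thesis using move_from_mixing by (simp add: algebra_simps)
qed

text \<open>
  The transmission error \<open>E\<close> enters through its inner product with \<open>mixing \<gamma> W ** X - Y\<close>, multiplied by the
  symmetric matrix \<open>I - W\<close>.  Moving \<open>I - W\<close> to the other factor annihilates the consensus part, including
  \<open>Y\<close>, and leaves the product of the disagreement and the transmission error: a quantity of second
  order, although each factor is only of first order.
\<close>

lemma distance_step:
  assumes y: "y \<in> S"
  defines "Y \<equiv> (\<chi> i. y) :: real^'d^'n"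
  shows "2 * \<eta> * ((X - Y) \<bullet> G) \<le> (norm (X - Y))\<^sup>2 - (norm (X' - Y))\<^sup>2
    + 2 * (\<gamma> * \<beta>) * (norm (X - H ** X) * norm E) + 2 * \<eta> * (\<gamma> * \<beta>) * (norm (X - H ** X) * norm G)
    + 2 * (\<gamma> * \<beta> * norm E)\<^sup>2 + 2 * (\<eta> * norm G)\<^sup>2"
proof -
  let ?C = "norm (X - H ** X)" and ?L = "mat 1 - W"
  define Pm where "Pm = mixing \<gamma> W ** X - Y"
  define A where "A = \<gamma> *\<^sub>R (?L ** E)"
  have HY: "H ** Y = Y" by (simp add: Y_def averaging_const)
  have WY: "W ** Y = Y" using averaging_mult(2)[of Y] by (simp add: HY)
  have A: "norm A \<le> \<gamma> * \<beta> * norm E"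
    using mult_left_mono[OF laplacian_bound[of E], of \<gamma>] \<gamma> by (simp add: A_def mult.assoc)
  have "(norm (X' - Y))\<^sup>2 \<le> (norm (Pm + A - \<eta> *\<^sub>R G))\<^sup>2"
    using projected_dist_le[of Y] y
    by (intro power_mono) (auto simp: Y_def Pm_def A_def algebra_simps)
  also have "\<dots> = (norm Pm)\<^sup>2 + 2 * (Pm \<bullet> A) - 2 * \<eta> * (Pm \<bullet> G) + (norm (A - \<eta> *\<^sub>R G))\<^sup>2"
    unfolding power2_norm_eq_inner by (simp add: inner_simps inner_commute algebra_simps)
  also have "(norm Pm)\<^sup>2 \<le> (norm (X - Y))\<^sup>2"
  proof -
    have "Pm = mixing \<gamma> W ** (X - Y)"
      by (simp add: Pm_def mixing_mult matrix_mult_linear WY algebra_simps)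
    then show ?thesis using mixing_nonexpansive[of \<gamma> "X - Y"] \<gamma> by (simp add: power_mono)
  qed
  also have "Pm \<bullet> A \<le> \<gamma> * \<beta> * (?C * norm E)"
  proof -
    have "transpose ?L = ?L"
      using symmetric by (simp add: transpose_def vec_eq_iff mat_def)
    then have "Pm \<bullet> A = \<gamma> * ((?L ** Pm) \<bullet> E)"
      by (simp add: A_def inner_symmetric_matrix_mult)
    also have "?L ** Pm = ?L ** (mixing \<gamma> W ** X)"
      by (simp add: Pm_def matrix_mult_linear WY)
    also have "\<gamma> * ((?L ** (mixing \<gamma> W ** X)) \<bullet> E) \<le> \<gamma> * (norm (?L ** (mixing \<gamma> W ** X)) * norm E)"
      using \<gamma> by (intro mult_left_mono norm_cauchy_schwarz) auto
    also have "\<dots> \<le> \<gamma> * ((\<beta> * ?C) * norm E)"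
    proof (intro mult_left_mono mult_right_mono)
      have "H ** (mixing \<gamma> W ** X) = H ** X"
        by (simp add: mixing_mult matrix_mult_linear)
      then have "norm (?L ** (mixing \<gamma> W ** X)) \<le> \<beta> * norm (mixing \<gamma> W ** X - H ** X)"
        using laplacian_bound_disagreement[of "mixing \<gamma> W ** X"] by simp
      also have "\<dots> \<le> \<beta> * (1 * ?C)"
      proof (intro mult_left_mono)
        have "(1 - \<gamma> * \<delta>) * ?C \<le> 1 * ?C"
          using \<gamma> gap by (intro mult_right_mono) auto
        then show "norm (mixing \<gamma> W ** X - H ** X) \<le> 1 * ?C"
          using mixing_disagreement[of \<gamma> X] \<gamma> by linarith
      qed (use laplacian in simp)
      finally show "norm (?L ** (mixing \<gamma> W ** X)) \<le> \<beta> * ?C" by simp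
    qed (use \<gamma> in auto)
    finally show ?thesis by (simp add: mult_ac)
  qed
  also have "(norm (A - \<eta> *\<^sub>R G))\<^sup>2 \<le> 2 * (\<gamma> * \<beta> * norm E)\<^sup>2 + 2 * (\<eta> * norm G)\<^sup>2"
  proof -
    have "norm (A - \<eta> *\<^sub>R G) \<le> \<gamma> * \<beta> * norm E + \<eta> * norm G"
      using norm_triangle_ineq4[of A "\<eta> *\<^sub>R G"] A \<eta> by simp
    then have "(norm (A - \<eta> *\<^sub>R G))\<^sup>2 \<le> (\<gamma> * \<beta> * norm E + \<eta> * norm G)\<^sup>2"
      by (intro power_mono) auto
    also have "\<dots> \<le> 2 * (\<gamma> * \<beta> * norm E)\<^sup>2 + 2 * (\<eta> * norm G)\<^sup>2"
      using sum_squares_bound[of "\<gamma> * \<beta> * norm E" "\<eta> * norm G"] by (simp add: power2_sum)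
    finally show ?thesis .
  qed
  finally have main: "(norm (X' - Y))\<^sup>2 \<le> (norm (X - Y))\<^sup>2 + 2 * (\<gamma> * \<beta> * (?C * norm E))
      - 2 * \<eta> * (Pm \<bullet> G) + (2 * (\<gamma> * \<beta> * norm E)\<^sup>2 + 2 * (\<eta> * norm G)\<^sup>2)"
    by simp
  have "(X - Y) \<bullet> G - Pm \<bullet> G = \<gamma> * ((?L ** X) \<bullet> G)"
    by (simp add: Pm_def mixing_mult inner_simps)
  also have "\<dots> \<le> \<gamma> * (norm (?L ** X) * norm G)"
    using \<gamma> by (intro mult_left_mono norm_cauchy_schwarz) auto
  also have "\<dots> \<le> \<gamma> * (\<beta> * ?C * norm G)"
    using \<gamma> laplacian_bound_disagreement[of X] by (intro mult_left_mono mult_right_mono) auto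
  finally have "2 * \<eta> * ((X - Y) \<bullet> G - Pm \<bullet> G) \<le> 2 * \<eta> * (\<gamma> * (\<beta> * ?C * norm G))"
    using \<eta> by (intro mult_left_mono) auto
  then show ?thesis using main by (simp add: algebra_simps)
qed

end

section \<open>Conditioning on the past\<close>

text \<open>
  Minkowski's inequality in the form needed for recursions on upper bounds of second moments.  It is
  the weighted Cauchy inequality with weights proportional to the three terms of the final bound.
\<close>

lemma (in prob_space) second_moment_combination:
  fixes Z U V :: "'a \<Rightarrow> real"
  assumes [measurable]: "Z \<in> borel_measurable M"
    and U: "integrable M (\<lambda>w. (U w)\<^sup>2)" "expectation (\<lambda>w. (U w)\<^sup>2) \<le> p\<^sup>2"
    and V: "integrable M (\<lambda>w. (V w)\<^sup>2)" "expectation (\<lambda>w. (V w)\<^sup>2) \<le> q\<^sup>2"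
    and pos: "0 < p" "0 < q" "0 \<le> a" "0 \<le> b" "0 \<le> g"
    and Z: "AE w in M. 0 \<le> Z w \<and> Z w \<le> a * U w + b * V w + g"
  shows "integrable M (\<lambda>w. (Z w)\<^sup>2)" "expectation (\<lambda>w. (Z w)\<^sup>2) \<le> (a * p + b * q + g)\<^sup>2"
proof -
  define s where "s = a * p + b * q + g"
  have s: "0 \<le> s" using pos by (simp add: s_def)
  let ?R = "\<lambda>w. s * (a / p * (U w)\<^sup>2 + b / q * (V w)\<^sup>2 + g)"
  have cauchy: "(a * c + b * d + g)\<^sup>2 \<le> s * (a / p * c\<^sup>2 + b / q * d\<^sup>2 + g)" for c d
  proof -
    define c' d' where "c' = c / p" and "d' = d / q"
    have cd: "c = p * c'" "d = q * d'" using pos by (auto simp: c'_def d'_def)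
    have "s * (a / p * c\<^sup>2 + b / q * d\<^sup>2 + g) - (a * c + b * d + g)\<^sup>2
       = (a * p) * (b * q) * (c' - d')\<^sup>2 + (a * p) * g * (c' - 1)\<^sup>2 + (b * q) * g * (d' - 1)\<^sup>2"
      using pos unfolding cd s_def by (simp add: power2_eq_square field_simps)
    moreover have "0 \<le> \<dots>" using pos by simp
    ultimately show ?thesis by linarith
  qed
  have le: "AE w in M. (Z w)\<^sup>2 \<le> ?R w"
    using Z
  proof eventually_elim
    case (elim w)
    then have "(Z w)\<^sup>2 \<le> (a * U w + b * V w + g)\<^sup>2" by (intro power_mono) auto
    also note cauchy
    finally show ?case .
  qed
  have intR: "integrable M ?R" using U(1) V(1) by auto
  show int: "integrable M (\<lambda>w. (Z w)\<^sup>2)"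
    by (rule Bochner_Integration.integrable_bound[OF intR])
       (use le in \<open>auto elim!: eventually_mono intro: order_trans[OF _ abs_ge_self]\<close>)
  have "expectation (\<lambda>w. (Z w)\<^sup>2) \<le> expectation ?R"
    by (rule integral_mono_AE[OF int intR le])
  also have "\<dots> = s * (a / p * expectation (\<lambda>w. (U w)\<^sup>2) + b / q * expectation (\<lambda>w. (V w)\<^sup>2) + g)"
    using U(1) V(1) by (simp add: prob_space)
  also have "\<dots> \<le> s * (a / p * p\<^sup>2 + b / q * q\<^sup>2 + g)"
    using U(2) V(2) pos s by (intro mult_left_mono add_mono) auto
  also have "\<dots> = s\<^sup>2" using pos by (simp add: s_def power2_eq_square)
  finally show "expectation (\<lambda>w. (Z w)\<^sup>2) \<le> (a * p + b * q + g)\<^sup>2" by (simp add: s_def)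
qed

lemma AE_sphere_pair:
  assumes "prob_space R"
  shows "AE t in sphere_uniform \<Otimes>\<^sub>M R. norm (fst t :: real^'d) = 1"
proof -
  interpret R: prob_space R by fact
  have "AE u in distr (sphere_uniform \<Otimes>\<^sub>M R) sphere_uniform fst. norm (u :: real^'d) = 1"
    unfolding R.distr_pair_fst by (rule AE_sphere_uniform_norm)
  then show ?thesis by (rule AE_distrD[rotated]) simp
qed

text \<open>
  One run of the algorithm, with the horizon fixed.  The bounds on \<open>\<mu>\<close> and \<open>\<epsilon>\<close> keep the queries inside
  the region where the samples are convex and Lipschitz, and the projection set inside \<open>\<Omega>\<close>.
\<close>

locale com_dszo_run = gossip N W + prob_space M
  for N :: "'n::finite \<Rightarrow> 'n set" and W :: "real^'n^'n" and M :: "'w measure" +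
  fixes \<Omega> :: "(real^'d::finite) set"
    and P :: "'n \<Rightarrow> 's measure" and F :: "'n \<Rightarrow> real^'d \<Rightarrow> 's \<Rightarrow> real"
    and Q :: "'z measure" and C :: "'z \<Rightarrow> real^'d \<Rightarrow> real^'d"
    and u :: "'n \<Rightarrow> nat \<Rightarrow> 'w \<Rightarrow> real^'d" and \<xi> :: "'n \<Rightarrow> nat \<Rightarrow> 'w \<Rightarrow> 's" and \<zeta> :: "'n \<Rightarrow> nat \<Rightarrow> 'w \<Rightarrow> 'z"
    and x0 :: "'n \<Rightarrow> real^'d" and x xh b q :: "'n \<Rightarrow> nat \<Rightarrow> 'w \<Rightarrow> real^'d"
    and Rin Rout L \<rho> r \<omega> \<psi> \<gamma> \<mu> \<epsilon> :: real and \<eta> :: "nat \<Rightarrow> real"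
  assumes feasible: "feasible_set \<Omega> Rin Rout"
    and sampling: "sampling_model P F \<Omega>"
    and convex_lipschitz: "convex_lipschitz_samples P F (\<Union>y\<in>\<Omega>. cball y \<rho>) L"
    and compressor: "compressor Q C r \<omega>"
    and \<psi>: "0 < \<psi>" "\<psi> \<le> 1 / r"
    and \<gamma>: "0 < \<gamma>" "\<gamma> \<le> 1"
    and \<eta>: "\<And>k. 0 < \<eta> k"
    and \<mu>: "0 < \<mu>" "\<mu> \<le> \<rho>"
    and \<epsilon>: "0 \<le> \<epsilon>" "\<epsilon> \<le> 1"
    and fresh: "fresh_randomness M P Q u \<xi> \<zeta>"
    and init: "\<And>i. x0 i \<in> \<Omega>"
    and run: "\<And>w. w \<in> space M \<Longrightarrow>
        com_dszo \<Omega> N W F C \<eta> \<mu> \<epsilon> \<psi> \<gamma> x0 (\<lambda>i k. u i k w) (\<lambda>i k. \<xi> i k w) (\<lambda>i k. \<zeta> i k w)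
          (\<lambda>i k. x i k w) (\<lambda>i k. xh i k w) (\<lambda>i k. b i k w) (\<lambda>i k. q i k w)"
begin

abbreviation "D \<equiv> \<Union>y\<in>\<Omega>. cball y \<rho>"
abbreviation "S \<equiv> shrunk_set \<epsilon> \<Omega>"
abbreviation "f \<equiv> local_objective P F"
abbreviation "c0 \<equiv> c0_const \<psi> r \<omega>"

definition law :: "'n \<times> nat \<Rightarrow> ((real^'d) \<times> 's \<times> 'z) measure" where
  "law = (\<lambda>(i, k). sphere_uniform \<Otimes>\<^sub>M (P i \<Otimes>\<^sub>M Q))"

definition triple :: "'n \<times> nat \<Rightarrow> 'w \<Rightarrow> (real^'d) \<times> 's \<times> 'z" where
  "triple = (\<lambda>(i, k) w. (u i k w, \<xi> i k w, \<zeta> i k w))"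

text \<open>
  The events determined by the random inputs of the rounds before \<open>k\<close>.
\<close>

definition past :: "nat \<Rightarrow> 'w measure" where
  "past k = vimage_algebra (space M) (\<lambda>w. restrict (\<lambda>p. triple p w) (UNIV \<times> {..<k}))
     (Pi\<^sub>M (UNIV \<times> {..<k}) law)"

lemma prob_P: "prob_space (P i)" and prob_Q: "prob_space Q"
  using sampling compressor by (auto simp: sampling_model_def compressor_def)

lemma prob_law: "prob_space (law p)"
proof -
  obtain i k where p: "p = (i, k)" by (cases p)
  interpret Pi: prob_space "P i" by (rule prob_P)
  interpret Q: prob_space Q by (rule prob_Q)
  interpret sph: prob_space "sphere_uniform :: (real^'d) measure" by (rule prob_space_sphere_uniform)
  interpret PQ: pair_prob_space "P i" Q ..
  interpret sPQ: pair_prob_space "sphere_uniform :: (real^'d) measure" "P i \<Otimes>\<^sub>M Q" ..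
  show ?thesis by (simp add: p law_def) unfold_locales
qed

lemma indep_triples: "indep_vars law triple UNIV"
  using fresh by (simp add: fresh_randomness_def law_def triple_def)

lemma distr_triple: "distr M (law p) (triple p) = law p"
  using fresh by (cases p) (simp add: fresh_randomness_def law_def triple_def)

lemma measurable_triple [measurable]: "triple p \<in> M \<rightarrow>\<^sub>M law p"
  using indep_triples by (cases p) (auto simp: indep_vars_def)

lemma restrict_triple_measurable [measurable]:
  "(\<lambda>w. restrict (\<lambda>p. triple p w) I) \<in> M \<rightarrow>\<^sub>M Pi\<^sub>M I law"
  by (rule measurable_restrict) simp

lemma restrict_triple_space:
  "(\<lambda>w. restrict (\<lambda>p. triple p w) I) \<in> space M \<rightarrow> space (Pi\<^sub>M I law)"
  using measurable_space[OF restrict_triple_measurable] by blast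

lemma space_past [simp]: "space (past k) = space M"
  by (simp add: past_def)

lemma triple_past_measurable:
  assumes "l < k"
  shows "triple (i, l) \<in> past k \<rightarrow>\<^sub>M law (i, l)"
proof -
  have "(\<lambda>w. restrict (\<lambda>p. triple p w) (UNIV \<times> {..<k})) \<in> past k \<rightarrow>\<^sub>M Pi\<^sub>M (UNIV \<times> {..<k}) law"
    unfolding past_def
    by (rule measurable_vimage_algebra1) (rule restrict_triple_space)
  from measurable_compose[OF this measurable_component_singleton[of "(i, l)"]] assms
  show ?thesis by simp
qed

lemma components_measurable:
  assumes "triple (i, l) \<in> A \<rightarrow>\<^sub>M law (i, l)"
  shows "u i l \<in> borel_measurable A" "\<xi> i l \<in> A \<rightarrow>\<^sub>M P i" "\<zeta> i l \<in> A \<rightarrow>\<^sub>M Q"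
proof -
  have t [measurable]: "triple (i, l) \<in> A \<rightarrow>\<^sub>M sphere_uniform \<Otimes>\<^sub>M (P i \<Otimes>\<^sub>M Q)"
    using assms by (simp add: law_def)
  have "(\<lambda>w. fst (triple (i, l) w)) \<in> A \<rightarrow>\<^sub>M sphere_uniform" by measurable
  then show "u i l \<in> borel_measurable A"
    by (simp add: triple_def measurable_cong_sets[OF refl sets_sphere_uniform])
  have "(\<lambda>w. fst (snd (triple (i, l) w))) \<in> A \<rightarrow>\<^sub>M P i" by measurable
  then show "\<xi> i l \<in> A \<rightarrow>\<^sub>M P i" by (simp add: triple_def)
  have "(\<lambda>w. snd (snd (triple (i, l) w))) \<in> A \<rightarrow>\<^sub>M Q" by measurable
  then show "\<zeta> i l \<in> A \<rightarrow>\<^sub>M Q" by (simp add: triple_def)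
qed

lemma measurable_F: "(\<lambda>(x, s). F i x s) \<in> borel_measurable (borel \<Otimes>\<^sub>M P i)"
  using sampling by (auto simp: sampling_model_def)

lemma measurable_F_compose [measurable (raw)]:
  assumes "a \<in> borel_measurable A" "s \<in> A \<rightarrow>\<^sub>M P i"
  shows "(\<lambda>w. F i (a w) (s w)) \<in> borel_measurable A"
  using measurable_compose[OF measurable_Pair[OF assms] measurable_F] by simp

lemma measurable_C_compose [measurable (raw)]:
  assumes "z \<in> A \<rightarrow>\<^sub>M Q" "a \<in> borel_measurable A"
  shows "(\<lambda>w. C (z w) (a w)) \<in> borel_measurable A"
proof -
  have "(\<lambda>(z, x). C z x) \<in> borel_measurable (Q \<Otimes>\<^sub>M borel)"
    using compressor by (simp add: compressor_def)
  from measurable_compose[OF measurable_Pair[OF assms] this] show ?thesis by simp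
qed

lemma \<Omega>: "closed \<Omega>" "convex \<Omega>" "0 \<in> \<Omega>" "0 < Rout" "\<And>y. y \<in> \<Omega> \<Longrightarrow> norm y \<le> Rout"
  using feasible by (auto simp: feasible_set_def subset_iff)

lemma L: "0 < L" using convex_lipschitz by (simp add: convex_lipschitz_samples_def)

lemma shrunk_mem: "y \<in> \<Omega> \<Longrightarrow> (1 - \<epsilon>) *\<^sub>R y \<in> S"
  unfolding shrunk_set_def by (rule imageI)

lemma S: "closed S" "convex S" "S \<noteq> {}" "S \<subseteq> \<Omega>"
proof -
  show "closed S" "convex S" using \<Omega> by (auto simp: shrunk_set_def closed_scaling convex_scaling)
  show "S \<noteq> {}" using \<Omega> by (auto simp: shrunk_set_def)
  show "S \<subseteq> \<Omega>"
    using convexD[OF \<Omega>(2) _ \<Omega>(3), of _ "1 - \<epsilon>" \<epsilon>] \<epsilon> by (auto simp: shrunk_set_def)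
qed

lemma step:
  assumes "w \<in> space M"
  shows "x i 0 w = x0 i" "xh i 0 w = 0" "b i 0 w = 0"
    "q i k w = C (\<zeta> i k w) (x i k w - xh i k w)"
    "xh i (Suc k) w = xh i k w + \<psi> *\<^sub>R q i k w"
    "b i (Suc k) w = b i k w + \<psi> *\<^sub>R (q i k w - (\<Sum>j\<in>N i. W $ i $ j *\<^sub>R q j k w))"
    "x i (Suc k) w = closest_point S
      (x i k w - \<gamma> *\<^sub>R b i (Suc k) w - \<eta> k *\<^sub>R zo_gradient (F i) \<mu> (x i k w) (u i k w) (\<xi> i k w))"
proof -
  note r = run[OF assms, unfolded com_dszo_def]
  show "q i k w = C (\<zeta> i k w) (x i k w - xh i k w)"
    using r by (cases k) auto
qed (use run[OF assms] in \<open>auto simp: com_dszo_def\<close>)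

text \<open>
  The iterates of round \<open>k\<close> do not depend on the random inputs of that round or of later ones.  Fixing \<open>k\<close>
  and stating the claim for all \<open>l \<le> k\<close> lets the induction run inside a single sigma algebra.
\<close>

lemma state_past_measurable:
  assumes "l \<le> k"
  shows "(\<forall>i. x i l \<in> borel_measurable (past k)) \<and> (\<forall>i. xh i l \<in> borel_measurable (past k))
    \<and> (\<forall>i. b i l \<in> borel_measurable (past k))"
  using assms
proof (induction l)
  case 0
  have "x i 0 \<in> borel_measurable (past k) \<longleftrightarrow> (\<lambda>w. x0 i) \<in> borel_measurable (past k)"
    "xh i 0 \<in> borel_measurable (past k) \<longleftrightarrow> (\<lambda>w. 0 :: real^'d) \<in> borel_measurable (past k)"
    "b i 0 \<in> borel_measurable (past k) \<longleftrightarrow> (\<lambda>w. 0 :: real^'d) \<in> borel_measurable (past k)" for i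
    by (rule measurable_cong, simp add: step)+
  then show ?case by auto
next
  case (Suc l)
  then have [measurable]: "x i l \<in> borel_measurable (past k)" "xh i l \<in> borel_measurable (past k)"
    "b i l \<in> borel_measurable (past k)" for i by auto
  have "triple (i, l) \<in> past k \<rightarrow>\<^sub>M law (i, l)" for i
    using Suc.prems by (intro triple_past_measurable) auto
  note [measurable] = components_measurable[OF this]
  have "q i l \<in> borel_measurable (past k) \<longleftrightarrow>
      (\<lambda>w. C (\<zeta> i l w) (x i l w - xh i l w)) \<in> borel_measurable (past k)" for i
    by (intro measurable_cong) (simp add: step(4))
  then have [measurable]: "q i l \<in> borel_measurable (past k)" for i by simp
  have "xh i (Suc l) \<in> borel_measurable (past k) \<longleftrightarrow>
      (\<lambda>w. xh i l w + \<psi> *\<^sub>R q i l w) \<in> borel_measurable (past k)" for i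
    by (intro measurable_cong) (simp add: step(5))
  then have 1: "xh i (Suc l) \<in> borel_measurable (past k)" for i by simp
  have "b i (Suc l) \<in> borel_measurable (past k) \<longleftrightarrow>
      (\<lambda>w. b i l w + \<psi> *\<^sub>R (q i l w - (\<Sum>j\<in>N i. W $ i $ j *\<^sub>R q j l w))) \<in> borel_measurable (past k)" for i
    by (intro measurable_cong) (simp add: step(6))
  then have 2 [measurable]: "b i (Suc l) \<in> borel_measurable (past k)" for i by simp
  have [measurable]: "closest_point S \<in> borel_measurable borel"
    using S by (intro borel_measurable_continuous_onI continuous_on_closest_point)
  have "x i (Suc l) \<in> borel_measurable (past k) \<longleftrightarrow>
      (\<lambda>w. closest_point S (x i l w - \<gamma> *\<^sub>R b i (Suc l) w
         - \<eta> l *\<^sub>R zo_gradient (F i) \<mu> (x i l w) (u i l w) (\<xi> i l w))) \<in> borel_measurable (past k)" for i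
    by (intro measurable_cong) (simp add: step(7))
  then have 3: "x i (Suc l) \<in> borel_measurable (past k)" for i
    by (simp add: zo_gradient_def)
  from 1 2 3 show ?case by blast
qed

lemma past_subset: "sets (past k) \<subseteq> events"
  unfolding past_def by (intro sets_image_in_sets measurable_restrict) auto

lemma past_measurable: "Z \<in> past k \<rightarrow>\<^sub>M A \<Longrightarrow> Z \<in> M \<rightarrow>\<^sub>M A"
  using past_subset[of k] by (auto simp: measurable_def)

lemma state_measurable [measurable]:
  "x i k \<in> borel_measurable M" "xh i k \<in> borel_measurable M"
  using state_past_measurable[of k k] past_measurable by blast+

lemma randomness_measurable [measurable]:
  "u i k \<in> borel_measurable M" "\<xi> i k \<in> M \<rightarrow>\<^sub>M P i" "\<zeta> i k \<in> M \<rightarrow>\<^sub>M Q"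
  by (rule components_measurable[OF measurable_triple])+

text \<open>
  A state \<open>Z\<close> known before round \<open>k\<close> is independent of the inputs of round \<open>k\<close>: each event about \<open>Z\<close> is
  an event about the earlier inputs, and those are independent of the current ones.
\<close>

lemma joint_law:
  assumes Z: "Z \<in> borel_measurable (past k)"
  shows "distr M (borel \<Otimes>\<^sub>M law (i, k)) (\<lambda>w. (Z w, triple (i, k) w)) = distr M borel Z \<Otimes>\<^sub>M law (i, k)"
proof -
  let ?hist = "\<lambda>w. restrict (\<lambda>p. triple p w) (UNIV \<times> {..<k})"
  let ?now = "\<lambda>w. restrict (\<lambda>p. triple p w) {(i, k)}"
  have ind: "indep_var (Pi\<^sub>M (UNIV \<times> {..<k}) law) ?hist (Pi\<^sub>M {(i, k)} law) ?now"
    by (rule indep_var_restrict[OF indep_triples]) auto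
  have ZM [measurable]: "Z \<in> borel_measurable M" by (rule past_measurable[OF Z])
  interpret law: prob_space "law (i, k)" by (rule prob_law)
  interpret dZ: prob_space "distr M borel Z" by (rule prob_space_distr) simp
  have "distr M borel Z \<Otimes>\<^sub>M law (i, k) = distr M (borel \<Otimes>\<^sub>M law (i, k)) (\<lambda>w. (Z w, triple (i, k) w))"
  proof (rule pair_measure_eqI)
    fix A B assume "A \<in> sets (distr M borel Z)" and B [measurable]: "B \<in> sets (law (i, k))"
    then have A [measurable]: "A \<in> sets borel" by simp
    have "Z -` A \<inter> space M \<in> sets (past k)"
      using measurable_sets[OF Z A] by simp
    then obtain A' where A': "A' \<in> sets (Pi\<^sub>M (UNIV \<times> {..<k}) law)" "Z -` A \<inter> space M = ?hist -` A' \<inter> space M"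
      unfolding past_def
      by (subst (asm) sets_vimage_algebra2[OF restrict_triple_space]) blast
    define B' where "B' = (\<lambda>h. h (i, k)) -` B \<inter> space (Pi\<^sub>M {(i, k)} law)"
    have B': "B' \<in> sets (Pi\<^sub>M {(i, k)} law)"
      unfolding B'_def by (rule measurable_sets[OF _ B]) (rule measurable_component_singleton, simp)
    have now: "?now -` B' \<inter> space M = triple (i, k) -` B \<inter> space M"
      unfolding B'_def using restrict_triple_space[of "{(i, k)}"] by auto
    have "prob ((Z -` A \<inter> space M) \<inter> (triple (i, k) -` B \<inter> space M))
        = prob ((\<lambda>w. (?hist w, ?now w)) -` (A' \<times> B') \<inter> space M)"
      unfolding A'(2) now[symmetric] by (rule arg_cong[where f=prob]) auto
    also have "\<dots> = prob (Z -` A \<inter> space M) * prob (triple (i, k) -` B \<inter> space M)"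
      unfolding indep_varD[OF ind A'(1) B'] A'(2) now ..
    finally have "prob ((Z -` A \<inter> space M) \<inter> (triple (i, k) -` B \<inter> space M))
        = prob (Z -` A \<inter> space M) * prob (triple (i, k) -` B \<inter> space M)" .
    moreover have "(\<lambda>w. (Z w, triple (i, k) w)) -` (A \<times> B) \<inter> space M
        = (Z -` A \<inter> space M) \<inter> (triple (i, k) -` B \<inter> space M)" by auto
    moreover have "emeasure (law (i, k)) B = emeasure M (triple (i, k) -` B \<inter> space M)"
      by (subst distr_triple[symmetric], rule emeasure_distr) auto
    ultimately show "emeasure (distr M borel Z) A * emeasure (law (i, k)) B =
        emeasure (distr M (borel \<Otimes>\<^sub>M law (i, k)) (\<lambda>w. (Z w, triple (i, k) w))) (A \<times> B)"
      by (simp add: emeasure_distr emeasure_eq_measure ennreal_mult)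
  next
    show "sigma_finite_measure (distr M borel Z)" "sigma_finite_measure (law (i, k))"
      by unfold_locales
    show "sets (distr M borel Z \<Otimes>\<^sub>M law (i, k)) = sets (distr M (borel \<Otimes>\<^sub>M law (i, k)) (\<lambda>w. (Z w, triple (i, k) w)))"
      by (simp cong: sets_pair_measure_cong)
  qed
  then show ?thesis by simp
qed

text \<open>
  Conditioning on the past: the inputs of the current round may be integrated out with the state held
  fixed.
\<close>

lemma expectation_fresh:
  fixes \<phi> :: "(real^'d) \<times> ((real^'d) \<times> 's \<times> 'z) \<Rightarrow> real"
  assumes Z: "Z \<in> borel_measurable (past k)" and \<phi>: "\<phi> \<in> borel_measurable (borel \<Otimes>\<^sub>M law (i, k))"
    and int: "integrable M (\<lambda>w. \<phi> (Z w, triple (i, k) w))"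
  shows "expectation (\<lambda>w. \<phi> (Z w, triple (i, k) w)) = expectation (\<lambda>w. \<integral>t. \<phi> (Z w, t) \<partial>law (i, k))"
    and "integrable M (\<lambda>w. \<integral>t. \<phi> (Z w, t) \<partial>law (i, k))"
proof -
  have ZM [measurable]: "Z \<in> borel_measurable M" by (rule past_measurable[OF Z])
  interpret law: prob_space "law (i, k)" by (rule prob_law)
  interpret dZ: prob_space "distr M borel Z" by (rule prob_space_distr) simp
  interpret pr: pair_prob_space "distr M borel Z" "law (i, k)" ..
  note \<phi>[measurable]
  have inner [measurable]: "(\<lambda>z. \<integral>t. \<phi> (z, t) \<partial>law (i, k)) \<in> borel_measurable borel"
    by measurable
  have int': "integrable (distr M borel Z \<Otimes>\<^sub>M law (i, k)) \<phi>"
    unfolding joint_law[OF Z, symmetric] by (subst integrable_distr_eq) (use int in auto)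
  have "expectation (\<lambda>w. \<phi> (Z w, triple (i, k) w)) = (\<integral>p. \<phi> p \<partial>(distr M borel Z \<Otimes>\<^sub>M law (i, k)))"
    unfolding joint_law[OF Z, symmetric] by (subst integral_distr) auto
  also have "\<dots> = (\<integral>z. (\<integral>t. \<phi> (z, t) \<partial>law (i, k)) \<partial>distr M borel Z)"
    by (rule pr.integral_fst'[OF int', symmetric])
  also have "\<dots> = expectation (\<lambda>w. \<integral>t. \<phi> (Z w, t) \<partial>law (i, k))"
    by (rule integral_distr) auto
  finally show "expectation (\<lambda>w. \<phi> (Z w, triple (i, k) w)) = expectation (\<lambda>w. \<integral>t. \<phi> (Z w, t) \<partial>law (i, k))" .
  show "integrable M (\<lambda>w. \<integral>t. \<phi> (Z w, t) \<partial>law (i, k))"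
    using pr.integrable_fst'[OF int'] by (subst (asm) integrable_distr_eq) auto
qed

lemma nn_expectation_fresh:
  fixes \<phi> :: "(real^'d) \<times> ((real^'d) \<times> 's \<times> 'z) \<Rightarrow> ennreal"
  assumes Z: "Z \<in> borel_measurable (past k)" and \<phi>: "\<phi> \<in> borel_measurable (borel \<Otimes>\<^sub>M law (i, k))"
  shows "(\<integral>\<^sup>+w. \<phi> (Z w, triple (i, k) w) \<partial>M) = (\<integral>\<^sup>+w. \<integral>\<^sup>+t. \<phi> (Z w, t) \<partial>law (i, k) \<partial>M)"
proof -
  have ZM [measurable]: "Z \<in> borel_measurable M" by (rule past_measurable[OF Z])
  interpret law: prob_space "law (i, k)" by (rule prob_law)
  note \<phi>[measurable]
  have "(\<integral>\<^sup>+w. \<phi> (Z w, triple (i, k) w) \<partial>M) = (\<integral>\<^sup>+p. \<phi> p \<partial>(distr M borel Z \<Otimes>\<^sub>M law (i, k)))"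
    unfolding joint_law[OF Z, symmetric] by (subst nn_integral_distr) auto
  also have "\<dots> = (\<integral>\<^sup>+z. (\<integral>\<^sup>+t. \<phi> (z, t) \<partial>law (i, k)) \<partial>distr M borel Z)"
    by (rule law.nn_integral_fst[symmetric]) measurable
  also have "\<dots> = (\<integral>\<^sup>+w. \<integral>\<^sup>+t. \<phi> (Z w, t) \<partial>law (i, k) \<partial>M)"
    by (rule nn_integral_distr) auto
  finally show ?thesis .
qed

lemma AE_unit_direction: "AE w in M. \<forall>i. norm (u i k w) = 1"
proof -
  have "AE w in M. norm (u i k w) = 1" for i
  proof -
    interpret PQ: pair_prob_space "P i" Q
      using prob_P prob_Q by (intro pair_prob_space.intro pair_sigma_finite.intro prob_space_imp_sigma_finite)
    have "AE t in law (i, k). norm (fst t) = 1"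
      unfolding law_def prod.case by (rule AE_sphere_pair) (rule PQ.prob_space_axioms)
    then have "AE t in distr M (law (i, k)) (triple (i, k)). norm (fst t) = 1"
      unfolding distr_triple .
    from AE_distrD[OF measurable_triple this] show ?thesis by (simp add: triple_def)
  qed
  then show ?thesis by (simp add: AE_finite_all[of UNIV, simplified])
qed

end

section \<open>Gradient estimates and compression in expectation\<close>

lemma norm_rows_le:
  fixes X :: "real^'d^'n"
  assumes "\<And>i. norm (X $ i) \<le> B"
  shows "norm X \<le> sqrt (real CARD('n)) * B"
proof -
  have B: "0 \<le> B" using assms[of undefined] norm_ge_zero order_trans by blast
  have "(\<Sum>i\<in>(UNIV::'n set). (norm (X $ i))\<^sup>2) \<le> (\<Sum>i\<in>(UNIV::'n set). B\<^sup>2)"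
    by (intro sum_mono power_mono) (auto simp: assms)
  then have "norm X \<le> sqrt (real CARD('n) * B\<^sup>2)"
    unfolding norm_vec_def L2_set_def by (simp add: real_sqrt_le_mono)
  also have "\<dots> = sqrt (real CARD('n)) * B" using B by (simp add: real_sqrt_mult)
  finally show ?thesis .
qed

context com_dszo_run
begin

abbreviation "grad i k w \<equiv> zo_gradient (F i) \<mu> (x i k w) (u i k w) (\<xi> i k w)"

lemma query_domain: "z \<in> \<Omega> \<Longrightarrow> cball z \<mu> \<subseteq> D"
  using \<mu> by (force simp: dist_norm)

lemma sample_regular:
  assumes "s \<in> space (P i)"
  shows "convex_on D (\<lambda>x. F i x s)" "L-lipschitz_on D (\<lambda>x. F i x s)"
  using convex_lipschitz assms by (auto simp: convex_lipschitz_samples_def)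

lemma iterate_mem_S: "w \<in> space M \<Longrightarrow> 1 \<le> k \<Longrightarrow> x i k w \<in> S"
  using S by (cases k) (auto simp: step(7) closest_point_in_set)

lemma iterate_mem: "w \<in> space M \<Longrightarrow> x i k w \<in> \<Omega>"
  using S iterate_mem_S[of w k i] init by (cases "k = 0") (auto simp: step(1))

lemma norm_zo_gradient_le:
  assumes z: "z \<in> \<Omega>" and v: "norm v = 1" and s: "s \<in> space (P i)"
  shows "norm (zo_gradient (F i) \<mu> z v s) \<le> real CARD('d) * L"
proof -
  have "z + \<mu> *\<^sub>R v \<in> D" "z \<in> D"
    using query_domain[OF z] v \<mu> by (auto simp: subset_iff dist_norm)
  from lipschitz_onD[OF sample_regular(2)[OF s] this]
  have "\<bar>F i (z + \<mu> *\<^sub>R v) s - F i z s\<bar> \<le> L * \<mu>"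
    using v \<mu> by (simp add: dist_norm)
  then have "real CARD('d) / \<mu> * \<bar>F i (z + \<mu> *\<^sub>R v) s - F i z s\<bar> \<le> real CARD('d) / \<mu> * (L * \<mu>)"
    using \<mu> by (intro mult_left_mono) auto
  then show ?thesis
    using v \<mu> by (simp add: zo_gradient_def abs_mult)
qed

lemma AE_gradient_bound: "AE w in M. \<forall>i. norm (grad i k w) \<le> real CARD('d) * L"
proof -
  have "AE w in M. w \<in> space M" by simp
  then show ?thesis using AE_unit_direction[of k]
  proof eventually_elim
    case (elim w)
    then show ?case
      using norm_zo_gradient_le[OF iterate_mem _ measurable_space[OF randomness_measurable(2)]] by blast
  qed
qed

lemma integrable_F: "z \<in> \<Omega> \<Longrightarrow> integrable (P i) (F i z)"
  using sampling by (auto simp: sampling_model_def)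

lemma local_objective_measurable [measurable]: "f i \<in> borel_measurable borel"
proof -
  interpret Pi: prob_space "P i" by (rule prob_P)
  show ?thesis unfolding local_objective_def[abs_def]
    by (rule Pi.borel_measurable_lebesgue_integral) (rule measurable_F)
qed

lemma local_objective_lipschitz:
  assumes "y \<in> \<Omega>" "z \<in> \<Omega>"
  shows "f i y \<le> f i z + L * norm (y - z)"
proof -
  interpret Pi: prob_space "P i" by (rule prob_P)
  have "y \<in> D" "z \<in> D"
    using query_domain assms \<mu>(1) by (meson centre_in_cball less_imp_le subsetD)+
  then have "F i y s \<le> F i z s + L * norm (y - z)" if "s \<in> space (P i)" for s
    using lipschitz_onD[OF sample_regular(2)[OF that], of y z] by (simp add: dist_norm)
  then have "f i y \<le> (\<integral>s. F i z s + L * norm (y - z) \<partial>P i)"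
    unfolding local_objective_def using integrable_F assms by (intro integral_mono) auto
  also have "\<dots> = f i z + L * norm (y - z)"
    using integrable_F[OF assms(2), of i] by (simp add: local_objective_def Pi.prob_space)
  finally show ?thesis .
qed

text \<open>
  The bound of \<open>two_point_estimate_subgradient\<close> holds for each sample and is then averaged over the
  samples.
\<close>

lemma gradient_integral:
  assumes z: "z \<in> \<Omega>" and y: "y \<in> \<Omega>"
  shows "f i z - f i y - 2 * (real CARD('d) + 1) * L * \<mu>
    \<le> (\<integral>t. (z - y) \<bullet> zo_gradient (F i) \<mu> z (fst t) (fst (snd t)) \<partial>law (i, k))"
proof -
  interpret Pi: prob_space "P i" by (rule prob_P)
  interpret Q: prob_space Q by (rule prob_Q)
  interpret sph: prob_space "sphere_uniform :: (real^'d) measure" by (rule prob_space_sphere_uniform)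
  interpret PQ: pair_prob_space "P i" Q ..
  interpret sPQ: pair_prob_space "sphere_uniform :: (real^'d) measure" "P i \<Otimes>\<^sub>M Q" ..
  let ?g = "\<lambda>v t. (z - y) \<bullet> zo_gradient (F i) \<mu> z v (fst t)"
  have [measurable]: "case_prod ?g \<in> borel_measurable (sphere_uniform \<Otimes>\<^sub>M (P i \<Otimes>\<^sub>M Q))"
    unfolding zo_gradient_def case_prod_beta
    by (intro borel_measurable_inner borel_measurable_const borel_measurable_scaleR borel_measurable_times
        borel_measurable_diff measurable_F_compose borel_measurable_add) measurable
  have int: "integrable (sphere_uniform \<Otimes>\<^sub>M (P i \<Otimes>\<^sub>M Q)) (case_prod ?g)"
  proof (rule sPQ.P.integrable_const_bound)
    have "AE t in sphere_uniform \<Otimes>\<^sub>M (P i \<Otimes>\<^sub>M Q). t \<in> space (sphere_uniform \<Otimes>\<^sub>M (P i \<Otimes>\<^sub>M Q)) \<and> norm (fst t :: real^'d) = 1"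
      using AE_sphere_pair[OF PQ.P.prob_space_axioms] by auto
    then show "AE t in sphere_uniform \<Otimes>\<^sub>M (P i \<Otimes>\<^sub>M Q). norm (case_prod ?g t) \<le> norm (z - y) * (real CARD('d) * L)"
    proof eventually_elim
      case (elim t)
      obtain v s e where t: "t = (v, s, e)" by (cases t)
      have s: "s \<in> space (P i)" using elim by (auto simp: t space_pair_measure)
      have "norm (?g v (s, e)) \<le> norm (z - y) * norm (zo_gradient (F i) \<mu> z v s)"
        using Cauchy_Schwarz_ineq2[of "z - y"] by simp
      also have "\<dots> \<le> norm (z - y) * (real CARD('d) * L)"
        using norm_zo_gradient_le[OF z _ s, of v] elim by (intro mult_left_mono) (auto simp: t)
      finally show ?case by (simp add: t)
    qed
  qed measurable
  have inner: "F i z (fst t) - F i y (fst t) - 2 * (real CARD('d) + 1) * L * \<mu> \<le> (\<integral>v. ?g v t \<partial>sphere_uniform)"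
    if "t \<in> space (P i \<Otimes>\<^sub>M Q)" for t
  proof -
    have s: "fst t \<in> space (P i)" using that by (auto simp: space_pair_measure)
    have [measurable]: "(\<lambda>x. F i x (fst t)) \<in> borel_measurable borel"
      by (rule measurable_F_compose) (use s in auto)
    have "?g v t = real CARD('d) / \<mu> * (F i (z + \<mu> *\<^sub>R v) (fst t) - F i z (fst t)) * (v \<bullet> (z - y))" for v
      by (simp add: zo_gradient_def inner_commute)
    then show ?thesis
      using two_point_estimate_subgradient[OF sample_regular[OF s] query_domain[OF z] query_domain[OF y] \<mu>(1)]
      by simp
  qed
  have intF: "integrable (P i \<Otimes>\<^sub>M Q) (\<lambda>t. F i a (fst t))"
    and intF_eq: "(\<integral>t. F i a (fst t) \<partial>(P i \<Otimes>\<^sub>M Q)) = f i a" if "a \<in> \<Omega>" for a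
  proof -
    have "integrable (distr (P i \<Otimes>\<^sub>M Q) (P i) fst) (F i a)"
      unfolding Q.distr_pair_fst by (rule integrable_F[OF that])
    then show "integrable (P i \<Otimes>\<^sub>M Q) (\<lambda>t. F i a (fst t))"
      by (subst (asm) integrable_distr_eq) (auto simp: integrable_F[OF that, THEN borel_measurable_integrable])
    have "f i a = integral\<^sup>L (distr (P i \<Otimes>\<^sub>M Q) (P i) fst) (F i a)"
      unfolding Q.distr_pair_fst local_objective_def ..
    also have "\<dots> = (\<integral>t. F i a (fst t) \<partial>(P i \<Otimes>\<^sub>M Q))"
      by (rule integral_distr) (auto simp: integrable_F[OF that, THEN borel_measurable_integrable])
    finally show "(\<integral>t. F i a (fst t) \<partial>(P i \<Otimes>\<^sub>M Q)) = f i a" ..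
  qed
  have "f i z - f i y - 2 * (real CARD('d) + 1) * L * \<mu> = (\<integral>t. F i z (fst t) - F i y (fst t) - 2 * (real CARD('d) + 1) * L * \<mu> \<partial>(P i \<Otimes>\<^sub>M Q))"
    using intF[OF z] intF[OF y] by (simp add: intF_eq z y PQ.P.prob_space)
  also have "\<dots> \<le> (\<integral>t. (\<integral>v. ?g v t \<partial>sphere_uniform) \<partial>(P i \<Otimes>\<^sub>M Q))"
    using intF[OF z] intF[OF y] inner by (intro integral_mono sPQ.integrable_snd[OF int]) auto
  also have "\<dots> = (\<integral>t. (z - y) \<bullet> zo_gradient (F i) \<mu> z (fst t) (fst (snd t)) \<partial>law (i, k))"
    by (subst sPQ.integral_snd[OF int]) (simp add: law_def case_prod_unfold)
  finally show ?thesis .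
qed

lemma integrable_bounded:
  fixes g :: "'w \<Rightarrow> real"
  assumes "g \<in> borel_measurable M" "\<And>w. w \<in> space M \<Longrightarrow> \<bar>g w\<bar> \<le> B"
  shows "integrable M g"
  by (rule integrable_const_bound[of _ B]) (use assms in auto)

lemma integrable_local_objective:
  assumes [measurable]: "z \<in> borel_measurable M" and z: "\<And>w. w \<in> space M \<Longrightarrow> z w \<in> \<Omega>"
  shows "integrable M (\<lambda>w. f i (z w))"
proof (rule integrable_bounded[where B = "\<bar>f i 0\<bar> + L * Rout"])
  fix w assume w: "w \<in> space M"
  have "L * norm (z w) \<le> L * Rout" using \<Omega>(5)[OF z[OF w]] L by simp
  then show "\<bar>f i (z w)\<bar> \<le> \<bar>f i 0\<bar> + L * Rout"
    using local_objective_lipschitz[OF z[OF w] \<Omega>(3), of i] local_objective_lipschitz[OF \<Omega>(3) z[OF w], of i]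
    by auto
qed measurable

lemma norm_diff_le: "y \<in> \<Omega> \<Longrightarrow> z \<in> \<Omega> \<Longrightarrow> norm (y - z) \<le> 2 * Rout"
  using norm_triangle_ineq4[of y z] \<Omega>(5)[of y] \<Omega>(5)[of z] by linarith

lemma grad_measurable [measurable]: "(\<lambda>w. grad i k w) \<in> borel_measurable M"
  unfolding zo_gradient_def by measurable

lemma expected_gradient:
  assumes y: "y \<in> \<Omega>"
  shows "integrable M (\<lambda>w. (x i k w - y) \<bullet> grad i k w)"
    and "expectation (\<lambda>w. f i (x i k w)) - f i y - 2 * (real CARD('d) + 1) * L * \<mu> \<le> expectation (\<lambda>w. (x i k w - y) \<bullet> grad i k w)"
proof -
  let ?\<phi> = "\<lambda>p. (fst p - y) \<bullet> zo_gradient (F i) \<mu> (fst p) (fst (snd p)) (fst (snd (snd p)))"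
  have \<phi>: "?\<phi> \<in> borel_measurable (borel \<Otimes>\<^sub>M law (i, k))"
    unfolding zo_gradient_def law_def prod.case by measurable
  have past: "x i k \<in> borel_measurable (past k)" using state_past_measurable[of k k] by auto
  show int: "integrable M (\<lambda>w. (x i k w - y) \<bullet> grad i k w)"
  proof (rule integrable_const_bound[of _ "2 * Rout * (real CARD('d) * L)"])
    have "AE w in M. w \<in> space M" by simp
    then show "AE w in M. norm ((x i k w - y) \<bullet> grad i k w) \<le> 2 * Rout * (real CARD('d) * L)"
      using AE_gradient_bound[of k]
    proof eventually_elim
      case (elim w)
      have "norm ((x i k w - y) \<bullet> grad i k w) \<le> norm (x i k w - y) * norm (grad i k w)"
        using Cauchy_Schwarz_ineq2 by simp
      also have "\<dots> \<le> 2 * Rout * (real CARD('d) * L)"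
        using elim norm_diff_le[OF iterate_mem y] \<Omega>(4) by (intro mult_mono) auto
      finally show ?case .
    qed
  qed measurable
  have int': "integrable M (\<lambda>w. ?\<phi> (x i k w, triple (i, k) w))"
    using int by (simp add: triple_def)
  note fr = expectation_fresh[OF past \<phi> int']
  have intf: "integrable M (\<lambda>w. f i (x i k w))"
    by (rule integrable_local_objective) (auto simp: iterate_mem)
  have "expectation (\<lambda>w. f i (x i k w)) - f i y - 2 * (real CARD('d) + 1) * L * \<mu> = expectation (\<lambda>w. f i (x i k w) - f i y - 2 * (real CARD('d) + 1) * L * \<mu>)"
    using intf by (simp add: prob_space)
  also have "\<dots> \<le> expectation (\<lambda>w. \<integral>t. ?\<phi> (x i k w, t) \<partial>law (i, k))"
    using intf gradient_integral[OF iterate_mem y] fr(2) by (intro integral_mono) auto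
  also have "\<dots> = expectation (\<lambda>w. (x i k w - y) \<bullet> grad i k w)"
    using fr(1) by (simp add: triple_def)
  finally show "expectation (\<lambda>w. f i (x i k w)) - f i y - 2 * (real CARD('d) + 1) * L * \<mu> \<le> expectation (\<lambda>w. (x i k w - y) \<bullet> grad i k w)" .
qed

lemma r: "1 \<le> r" "0 < \<omega>" "\<omega> \<le> 1" and \<psi>r: "0 < \<psi> * r" "\<psi> * r \<le> 1"
  using compressor \<psi> by (auto simp: compressor_def field_simps)

lemma c0: "0 < c0" "c0 \<le> 1 / 2" "2 * c0 = \<psi> * r * \<omega>"
proof -
  show "0 < c0" "2 * c0 = \<psi> * r * \<omega>" using r \<psi>r by (auto simp: c0_const_def)
  have "\<psi> * r * \<omega> \<le> 1 * 1" using r \<psi>r by (intro mult_mono) auto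
  then show "c0 \<le> 1 / 2" by (simp add: c0_const_def)
qed

text \<open>
  For a state \<open>z\<close>, the new estimation error is \<open>z - \<psi> C z = (1 - \<psi> r) z + \<psi> r (z - C z / r)\<close>, a convex
  combination of the old error and the compression error.
\<close>

lemma compression_integral:
  "(\<integral>\<^sup>+t. ennreal ((norm (z - \<psi> *\<^sub>R C (snd (snd t)) z))\<^sup>2) \<partial>law (i, k)) \<le> ennreal ((1 - 2 * c0) * (norm z)\<^sup>2)"
proof -
  interpret Pi: prob_space "P i" by (rule prob_P)
  interpret Q: prob_space Q by (rule prob_Q)
  interpret sph: prob_space "sphere_uniform :: (real^'d) measure" by (rule prob_space_sphere_uniform)
  interpret PQ: pair_prob_space "P i" Q ..
  let ?err = "\<lambda>e. (norm ((1 / r) *\<^sub>R C e z - z))\<^sup>2"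
  have err: "integrable Q ?err" "(\<integral>e. ?err e \<partial>Q) \<le> (1 - \<omega>) * (norm z)\<^sup>2"
    using compressor by (auto simp: compressor_def)
  let ?g = "\<lambda>e. (norm (z - \<psi> *\<^sub>R C e z))\<^sup>2"
  have pw: "?g e \<le> (1 - \<psi> * r) * (norm z)\<^sup>2 + \<psi> * r * ?err e" for e
  proof -
    define a where "a = z - (1 / r) *\<^sub>R C e z"
    have "z - \<psi> *\<^sub>R C e z = (1 - \<psi> * r) *\<^sub>R z + (\<psi> * r) *\<^sub>R a"
      using r by (simp add: a_def algebra_simps)
    moreover have "\<bar>1 - \<psi> * r\<bar> = 1 - \<psi> * r" "\<bar>\<psi> * r\<bar> = \<psi> * r" using \<psi>r by auto
    ultimately have "norm (z - \<psi> *\<^sub>R C e z) \<le> (1 - \<psi> * r) * norm z + \<psi> * r * norm a"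
      using norm_triangle_ineq[of "(1 - \<psi> * r) *\<^sub>R z" "(\<psi> * r) *\<^sub>R a"] by (simp only: norm_scaleR)
    then have "?g e \<le> ((1 - \<psi> * r) * norm z + \<psi> * r * norm a)\<^sup>2"
      by (intro power_mono) auto
    also have "\<dots> \<le> (1 - \<psi> * r) * (norm z)\<^sup>2 + \<psi> * r * (norm a)\<^sup>2"
    proof -
      have "(1 - \<psi> * r) * (norm z)\<^sup>2 + \<psi> * r * (norm a)\<^sup>2 - ((1 - \<psi> * r) * norm z + \<psi> * r * norm a)\<^sup>2
          = (1 - \<psi> * r) * (\<psi> * r) * (norm z - norm a)\<^sup>2"
        by (simp add: power2_eq_square algebra_simps)
      moreover have "0 \<le> (1 - \<psi> * r) * (\<psi> * r) * (norm z - norm a)\<^sup>2" using \<psi>r by simp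
      ultimately show ?thesis by linarith
    qed
    finally show ?thesis by (simp add: a_def norm_minus_commute)
  qed
  have [measurable]: "?g \<in> borel_measurable Q" by measurable
  have "(\<integral>\<^sup>+t. ennreal (?g (snd (snd t))) \<partial>law (i, k)) = (\<integral>\<^sup>+e. ennreal (?g e) \<partial>Q)"
  proof -
    have "(\<integral>\<^sup>+t. ennreal (?g (snd (snd t))) \<partial>law (i, k))
        = (\<integral>\<^sup>+v. (\<integral>\<^sup>+t. ennreal (?g (snd t)) \<partial>(P i \<Otimes>\<^sub>M Q)) \<partial>(sphere_uniform :: (real^'d) measure))"
      unfolding law_def prod.case by (subst PQ.P.nn_integral_fst[symmetric]) auto
    also have "\<dots> = (\<integral>\<^sup>+t. ennreal (?g (snd t)) \<partial>(P i \<Otimes>\<^sub>M Q))"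
      using sph.emeasure_space_1 by simp
    also have "\<dots> = (\<integral>\<^sup>+e. ennreal (?g e) \<partial>Q)"
      by (subst Q.nn_integral_fst[symmetric]) (auto simp: Pi.emeasure_space_1)
    finally show ?thesis .
  qed
  also have "\<dots> \<le> (\<integral>\<^sup>+e. ennreal ((1 - \<psi> * r) * (norm z)\<^sup>2 + \<psi> * r * ?err e) \<partial>Q)"
    by (intro nn_integral_mono ennreal_leI pw)
  also have "\<dots> = ennreal (\<integral>e. (1 - \<psi> * r) * (norm z)\<^sup>2 + \<psi> * r * ?err e \<partial>Q)"
    using err(1) \<psi>r by (intro nn_integral_eq_integral) auto
  also have "\<dots> \<le> ennreal ((1 - 2 * c0) * (norm z)\<^sup>2)"
  proof (rule ennreal_leI)
    have "(\<integral>e. (1 - \<psi> * r) * (norm z)\<^sup>2 + \<psi> * r * ?err e \<partial>Q)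
        = (1 - \<psi> * r) * (norm z)\<^sup>2 + \<psi> * r * (\<integral>e. ?err e \<partial>Q)"
      using err(1) by (simp add: Q.prob_space)
    also have "\<dots> \<le> (1 - \<psi> * r) * (norm z)\<^sup>2 + \<psi> * r * ((1 - \<omega>) * (norm z)\<^sup>2)"
      using err(2) \<psi>r by (intro add_left_mono mult_left_mono) auto
    also have "\<dots> = (1 - 2 * c0) * (norm z)\<^sup>2"
      unfolding c0 by (simp add: algebra_simps)
    finally show "(\<integral>e. (1 - \<psi> * r) * (norm z)\<^sup>2 + \<psi> * r * ?err e \<partial>Q) \<le> (1 - 2 * c0) * (norm z)\<^sup>2" .
  qed
  finally show ?thesis .
qed

lemma compression_contracts:
  assumes int: "integrable M (\<lambda>w. (norm (x i k w - xh i k w))\<^sup>2)"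
  shows "integrable M (\<lambda>w. (norm (x i k w - xh i (Suc k) w))\<^sup>2)"
    and "expectation (\<lambda>w. (norm (x i k w - xh i (Suc k) w))\<^sup>2)
      \<le> (1 - 2 * c0) * expectation (\<lambda>w. (norm (x i k w - xh i k w))\<^sup>2)"
proof -
  let ?z = "\<lambda>w. x i k w - xh i k w"
  let ?\<phi> = "\<lambda>p. ennreal ((norm (fst p - \<psi> *\<^sub>R C (snd (snd (snd p))) (fst p)))\<^sup>2)"
  have \<phi>: "?\<phi> \<in> borel_measurable (borel \<Otimes>\<^sub>M law (i, k))"
    unfolding law_def prod.case by measurable
  have "x i k \<in> borel_measurable (past k)" "xh i k \<in> borel_measurable (past k)"
    using state_past_measurable[of k k] by auto
  then have past: "?z \<in> borel_measurable (past k)" by measurable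
  have eq: "x i k w - xh i (Suc k) w = ?z w - \<psi> *\<^sub>R C (\<zeta> i k w) (?z w)" if "w \<in> space M" for w
    using that by (simp add: step(4,5))
  have "(\<integral>\<^sup>+w. ennreal ((norm (x i k w - xh i (Suc k) w))\<^sup>2) \<partial>M) = (\<integral>\<^sup>+w. ?\<phi> (?z w, triple (i, k) w) \<partial>M)"
    by (rule nn_integral_cong) (simp add: eq triple_def)
  also have "\<dots> = (\<integral>\<^sup>+w. \<integral>\<^sup>+t. ?\<phi> (?z w, t) \<partial>law (i, k) \<partial>M)"
    by (rule nn_expectation_fresh[OF past \<phi>])
  also have "\<dots> \<le> (\<integral>\<^sup>+w. ennreal ((1 - 2 * c0) * (norm (?z w))\<^sup>2) \<partial>M)"
    using compression_integral by (intro nn_integral_mono) simp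
  also have "\<dots> = ennreal (expectation (\<lambda>w. (1 - 2 * c0) * (norm (?z w))\<^sup>2))"
    using int c0 by (intro nn_integral_eq_integral) auto
  finally have le: "(\<integral>\<^sup>+w. ennreal ((norm (x i k w - xh i (Suc k) w))\<^sup>2) \<partial>M)
      \<le> ennreal ((1 - 2 * c0) * expectation (\<lambda>w. (norm (?z w))\<^sup>2))" by simp
  show int': "integrable M (\<lambda>w. (norm (x i k w - xh i (Suc k) w))\<^sup>2)"
    by (rule integrableI_bounded) (use le in \<open>auto simp: le_less_trans[OF _ ennreal_less_top]\<close>)
  have "ennreal (expectation (\<lambda>w. (norm (x i k w - xh i (Suc k) w))\<^sup>2))
      \<le> ennreal ((1 - 2 * c0) * expectation (\<lambda>w. (norm (?z w))\<^sup>2))"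
    using le int' by (subst nn_integral_eq_integral[symmetric]) auto
  then show "expectation (\<lambda>w. (norm (x i k w - xh i (Suc k) w))\<^sup>2)
      \<le> (1 - 2 * c0) * expectation (\<lambda>w. (norm (?z w))\<^sup>2)"
    using c0 by (subst (asm) ennreal_le_iff) auto
qed

end

section \<open>Consensus and tracking errors\<close>

text \<open>
  The error recursion \<open>(C, D) \<mapsto> ((1 - \<gamma> \<delta>) C + \<gamma> \<beta> (1 - c) D, \<gamma> \<beta> C + (1 + \<gamma> \<beta>) (1 - c) D)\<close> contracts
  the norm \<open>max C (D / s)\<close> with factor \<open>q\<close>.  For the first component \<open>s < \<delta> / \<beta>\<close> is enough and for the
  second \<open>s > 2 \<gamma> \<beta> / c\<close>, because \<open>2 \<gamma> \<beta> < c\<close> by \<open>gap_le_laplacian\<close>; the hypothesis \<open>small\<close> says precisely that such an \<open>s\<close> exists.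
\<close>

lemma (in gossip) contraction_weights:
  assumes \<gamma>: "0 < \<gamma>" "\<gamma> \<le> 1" and c: "0 < c" "c \<le> 1" and small: "2 * \<gamma> * \<beta>\<^sup>2 < c * \<delta>"
  obtains s q where "0 < s" "0 < q" "q < 1"
    "(1 - \<gamma> * \<delta>) + \<gamma> * \<beta> * ((1 - c) * s) \<le> q"
    "(1 + \<gamma> * \<beta>) * ((1 - c) * s) + \<gamma> * \<beta> \<le> q * s"
proof -
  have "2 * (\<gamma> * \<beta>) * \<beta> < c * \<delta>" using small by (simp add: power2_eq_square mult_ac)
  also have "\<dots> \<le> c * \<beta>" using c gap_le_laplacian by simp
  finally have gb: "2 * (\<gamma> * \<beta>) < c" using laplacian by (simp only: mult_less_cancel_right_pos)
  have "2 * (\<gamma> * \<beta>) / c < \<delta> / \<beta>"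
    using small c laplacian by (simp add: field_simps power2_eq_square)
  then obtain s where s: "2 * (\<gamma> * \<beta>) / c < s" "s < \<delta> / \<beta>" using dense by blast
  have gb0: "0 < \<gamma> * \<beta>" using \<gamma> laplacian by simp
  then have s0: "0 < s" using s(1) c by (meson divide_pos_pos less_trans mult_pos_pos zero_less_numeral)
  have s1: "\<gamma> * \<beta> < c * s / 2" using s(1) c by (simp add: field_simps)
  have s2: "\<gamma> * \<beta> * s < \<gamma> * \<delta>" using s(2) laplacian \<gamma> by (simp add: field_simps)
  define q1 where "q1 = (1 - \<gamma> * \<delta>) + \<gamma> * \<beta> * ((1 - c) * s)"
  define q2 where "q2 = (1 + \<gamma> * \<beta>) * (1 - c) + \<gamma> * \<beta> / s"
  have "\<gamma> * \<beta> * ((1 - c) * s) \<le> \<gamma> * \<beta> * s"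
    using gb0 s0 c by (intro mult_left_mono) auto
  then have "q1 < 1" using s2 by (simp add: q1_def)
  moreover have "q2 < 1"
  proof -
    have "\<gamma> * \<beta> / s < c / 2" using s1 s0 by (simp add: field_simps)
    moreover have "(1 + \<gamma> * \<beta>) * (1 - c) = 1 - c + \<gamma> * \<beta> * (1 - c)" by (simp add: algebra_simps)
    moreover have "\<gamma> * \<beta> * (1 - c) \<le> \<gamma> * \<beta> * 1" using gb0 c by (intro mult_left_mono) auto
    ultimately show ?thesis using gb unfolding q2_def by linarith
  qed
  moreover have "0 < q2" using gb0 s0 c by (auto simp: q2_def intro!: add_nonneg_pos)
  moreover have "(1 + \<gamma> * \<beta>) * ((1 - c) * s) + \<gamma> * \<beta> = q2 * s" using s0 by (simp add: q2_def field_simps)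
  moreover have "q2 * s \<le> max q1 q2 * s" using s0 by simp
  ultimately show ?thesis using s0 by (intro that[of s "max q1 q2"]) (auto simp: q1_def)
qed

context com_dszo_run
begin

definition X :: "nat \<Rightarrow> 'w \<Rightarrow> real^'d^'n" where "X k w = (\<chi> i. x i k w)"
definition XH :: "nat \<Rightarrow> 'w \<Rightarrow> real^'d^'n" where "XH k w = (\<chi> i. xh i k w)"
definition G :: "nat \<Rightarrow> 'w \<Rightarrow> real^'d^'n" where "G k w = (\<chi> i. grad i k w)"

text \<open>
  \<open>disagreement\<close> is the distance from consensus, \<open>tracking\<close> and \<open>transmission\<close> are the errors of the
  public estimates before and after the transmission of a round, and \<open>sqdist\<close> measures the distance to a
  common comparison point.
\<close>

definition disagreement :: "nat \<Rightarrow> 'w \<Rightarrow> real" where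
  "disagreement k w = norm (X k w - H ** X k w)"
definition tracking :: "nat \<Rightarrow> 'w \<Rightarrow> real" where
  "tracking k w = norm (X k w - XH k w)"
definition transmission :: "nat \<Rightarrow> 'w \<Rightarrow> real" where
  "transmission k w = norm (X k w - XH (Suc k) w)"
definition sqdist :: "real^'d \<Rightarrow> nat \<Rightarrow> 'w \<Rightarrow> real" where
  "sqdist y k w = (norm (X k w - (\<chi> i. y)))\<^sup>2"

lemma sum_sq:
  "(tracking k w)\<^sup>2 = (\<Sum>i\<in>UNIV. (norm (x i k w - xh i k w))\<^sup>2)"
  "(transmission k w)\<^sup>2 = (\<Sum>i\<in>UNIV. (norm (x i k w - xh i (Suc k) w))\<^sup>2)"
  "sqdist y k w = (\<Sum>i\<in>UNIV. (norm (x i k w - y))\<^sup>2)"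
  "disagreement k w = sqrt (\<Sum>i\<in>UNIV. (norm (x i k w - agent_average (\<lambda>j. x j k w)))\<^sup>2)"
  unfolding tracking_def transmission_def sqdist_def disagreement_def norm_vec_def[where 'a="real^'d"] L2_set_def
  by (auto simp: sum_nonneg X_def XH_def averaging_row)

lemma error_nonneg: "0 \<le> disagreement k w" "0 \<le> tracking k w" "0 \<le> transmission k w" "0 \<le> sqdist y k w"
  by (simp_all add: disagreement_def tracking_def transmission_def sqdist_def)

lemma errors_measurable [measurable]:
  "disagreement k \<in> borel_measurable M" "tracking k \<in> borel_measurable M"
  "transmission k \<in> borel_measurable M" "sqdist y k \<in> borel_measurable M"
proof -
  have t: "tracking k = (\<lambda>w. sqrt (\<Sum>i\<in>UNIV. (norm (x i k w - xh i k w))\<^sup>2))"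
    "transmission k = (\<lambda>w. sqrt (\<Sum>i\<in>UNIV. (norm (x i k w - xh i (Suc k) w))\<^sup>2))"
    unfolding sum_sq(1,2)[symmetric] by (simp_all add: error_nonneg)
  have d: "disagreement k = (\<lambda>w. sqrt (\<Sum>i\<in>UNIV. (norm (x i k w - agent_average (\<lambda>j. x j k w)))\<^sup>2))"
    by (rule ext) (rule sum_sq(4))
  have s: "sqdist y k = (\<lambda>w. \<Sum>i\<in>UNIV. (norm (x i k w - y))\<^sup>2)"
    by (rule ext) (rule sum_sq(3))
  show "tracking k \<in> borel_measurable M" "transmission k \<in> borel_measurable M"
    "disagreement k \<in> borel_measurable M" "sqdist y k \<in> borel_measurable M"
    unfolding t d s agent_average_def by measurable
qed

text \<open>
  Summing the increments, the auxiliary variables are the Laplacian of the public estimates, so they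
  introduce no error of their own.
\<close>

lemma auxiliary_eq:
  assumes "w \<in> space M"
  shows "b i k w = ((mat 1 - W) ** XH k w) $ i"
proof (induction k arbitrary: i)
  case 0
  then show ?case
    using assms by (simp add: step(2,3) XH_def matrix_mult_row)
next
  case (Suc k)
  define q' where "q' = (\<chi> i. q i k w)"
  have "(\<Sum>j\<in>N i. W $ i $ j *\<^sub>R q j k w) = (\<Sum>j\<in>UNIV. W $ i $ j *\<^sub>R q j k w)"
    using network by (intro sum.mono_neutral_left) (auto simp: network_def)
  also have "\<dots> = (W ** q') $ i" by (simp add: matrix_mult_row q'_def)
  finally have "q i k w - (\<Sum>j\<in>N i. W $ i $ j *\<^sub>R q j k w) = ((mat 1 - W) ** q') $ i"
    by (simp add: matrix_mult_linear q'_def)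
  then have "b i (Suc k) w = ((mat 1 - W) ** (XH k w + \<psi> *\<^sub>R q')) $ i"
    using assms by (simp add: step(6) Suc.IH matrix_mult_add_right matrix_mult_scaleR_right)
  also have "XH k w + \<psi> *\<^sub>R q' = XH (Suc k) w"
    using assms by (simp add: XH_def q'_def vec_eq_iff step(5))
  finally show ?case .
qed

lemma path_step:
  assumes "w \<in> space M" "1 \<le> k"
  shows "gossip_step N W S \<gamma> (\<eta> k) (X k w) (X (Suc k) w) (XH (Suc k) w) (G k w)"
proof unfold_locales
  fix i
  show "X (Suc k) w $ i = closest_point S ((X k w - \<gamma> *\<^sub>R ((mat 1 - W) ** XH (Suc k) w) - \<eta> k *\<^sub>R G k w) $ i)"
    using assms by (simp add: X_def[of "Suc k"] step(7)) (simp add: X_def G_def auxiliary_eq)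
  show "X k w $ i \<in> S" using assms iterate_mem_S by (simp add: X_def)
qed (use \<gamma> \<eta>[of k] S in auto)

lemma norm_X_le: "w \<in> space M \<Longrightarrow> norm (X k w) \<le> sqrt (real CARD('n)) * Rout"
  by (rule norm_rows_le) (simp add: X_def \<Omega>(5) iterate_mem)

lemma disagreement_le: "w \<in> space M \<Longrightarrow> disagreement k w \<le> sqrt (real CARD('n)) * Rout"
  using norm_disagreement_le[of "X k w"] norm_X_le[of w k] by (simp add: disagreement_def)

lemma integrable_disagreement:
  "integrable M (disagreement k)" "integrable M (\<lambda>w. (disagreement k w)\<^sup>2)"
proof -
  show "integrable M (disagreement k)"
    by (rule integrable_bounded[of _ "sqrt (real CARD('n)) * Rout"]) (auto simp: disagreement_le error_nonneg)
  show "integrable M (\<lambda>w. (disagreement k w)\<^sup>2)"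
    by (rule integrable_bounded[of _ "(sqrt (real CARD('n)) * Rout)\<^sup>2"])
       (auto intro!: power_mono simp: disagreement_le error_nonneg)
qed

lemma AE_norm_G: "AE w in M. norm (G k w) \<le> sqrt (real CARD('n)) * (real CARD('d) * L)"
  using AE_gradient_bound[of k] by eventually_elim (auto intro!: norm_rows_le simp: G_def)

text \<open>
  The factor is \<open>1 - 2 c0 = 1 - \<psi> r \<omega>\<close>; the slightly larger \<open>(1 - c0)\<^sup>2\<close> is a convenient square for the
  recursion on root mean squares.
\<close>

lemma transmission_contracts:
  assumes int: "integrable M (\<lambda>w. (tracking k w)\<^sup>2)"
  shows "integrable M (\<lambda>w. (transmission k w)\<^sup>2)"
    and "expectation (\<lambda>w. (transmission k w)\<^sup>2) \<le> (1 - c0)\<^sup>2 * expectation (\<lambda>w. (tracking k w)\<^sup>2)"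
proof -
  have row: "integrable M (\<lambda>w. (norm (x i k w - xh i k w))\<^sup>2)" for i
  proof (rule Bochner_Integration.integrable_bound[OF int])
    show "AE w in M. norm ((norm (x i k w - xh i k w))\<^sup>2) \<le> norm ((tracking k w)\<^sup>2)"
      unfolding sum_sq by (rule AE_I2) (auto intro!: member_le_sum abs_ge_self[THEN order_trans[rotated]])
  qed measurable
  note rows = compression_contracts[OF row]
  show "integrable M (\<lambda>w. (transmission k w)\<^sup>2)" unfolding sum_sq using rows(1) by auto
  have "expectation (\<lambda>w. (transmission k w)\<^sup>2)
      = (\<Sum>i\<in>UNIV. expectation (\<lambda>w. (norm (x i k w - xh i (Suc k) w))\<^sup>2))"
    unfolding sum_sq using rows(1) by simp
  also have "\<dots> \<le> (\<Sum>i\<in>UNIV. (1 - 2 * c0) * expectation (\<lambda>w. (norm (x i k w - xh i k w))\<^sup>2))"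
    by (intro sum_mono rows(2))
  also have "\<dots> = (1 - 2 * c0) * expectation (\<lambda>w. (tracking k w)\<^sup>2)"
    unfolding sum_sq using row by (simp add: sum_distrib_left)
  also have "\<dots> \<le> (1 - c0)\<^sup>2 * expectation (\<lambda>w. (tracking k w)\<^sup>2)"
    by (intro mult_right_mono) (auto simp: power2_diff)
  finally show "expectation (\<lambda>w. (transmission k w)\<^sup>2) \<le> (1 - c0)\<^sup>2 * expectation (\<lambda>w. (tracking k w)\<^sup>2)" .
qed

text \<open>
  The initial points lie in \<open>\<Omega>\<close> but possibly outside the projection set, so the one-step recursions
  start at round 1, where the errors are merely bounded.
\<close>

lemma first_tracking_error:
  "integrable M (\<lambda>w. (tracking 1 w)\<^sup>2)" "expectation (\<lambda>w. (tracking 1 w)\<^sup>2) \<le> (3 * (sqrt (real CARD('n)) * Rout))\<^sup>2"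
proof -
  let ?R = "sqrt (real CARD('n)) * Rout"
  have R: "0 < ?R" using \<Omega>(4) by simp
  have t0: "tracking 0 w \<le> ?R" if "w \<in> space M" for w
  proof -
    have "XH 0 w = 0" using that by (simp add: XH_def step(2) vec_eq_iff)
    then show ?thesis using norm_X_le[OF that] by (simp add: tracking_def)
  qed
  have int0: "integrable M (\<lambda>w. (tracking 0 w)\<^sup>2)"
    by (rule integrable_bounded[of _ "?R\<^sup>2"]) (auto intro!: power_mono simp: t0 error_nonneg)
  note tr = transmission_contracts[OF int0]
  have "expectation (\<lambda>w. (tracking 0 w)\<^sup>2) \<le> expectation (\<lambda>w. ?R\<^sup>2)"
    using int0 t0 by (intro integral_mono) (auto intro!: power_mono simp: error_nonneg)
  then have "expectation (\<lambda>w. (tracking 0 w)\<^sup>2) \<le> ?R\<^sup>2" by (simp add: prob_space)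
  then have "(1 - c0)\<^sup>2 * expectation (\<lambda>w. (tracking 0 w)\<^sup>2) \<le> 1 * ?R\<^sup>2"
    using c0 by (intro mult_mono) (auto simp: power_le_one)
  then have tr2: "expectation (\<lambda>w. (transmission 0 w)\<^sup>2) \<le> ?R\<^sup>2" using tr(2) by simp
  have bound: "AE w in M. 0 \<le> tracking 1 w \<and> tracking 1 w \<le> 1 * transmission 0 w + 0 * transmission 0 w + 2 * ?R"
  proof (rule AE_I2)
    fix w assume w: "w \<in> space M"
    have "X 1 w - XH 1 w = (X 0 w - XH 1 w) + (X 1 w - X 0 w)" by simp
    then have "tracking 1 w \<le> transmission 0 w + norm (X 1 w - X 0 w)"
      by (metis tracking_def transmission_def norm_triangle_ineq One_nat_def)
    moreover have "norm (X 1 w - X 0 w) \<le> 2 * ?R"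
      using norm_triangle_ineq4[of "X 1 w" "X 0 w"] norm_X_le[OF w, of 1] norm_X_le[OF w, of 0] by linarith
    ultimately show "0 \<le> tracking 1 w \<and> tracking 1 w \<le> 1 * transmission 0 w + 0 * transmission 0 w + 2 * ?R"
      by (simp add: error_nonneg)
  qed
  have three: "1 * ?R + 0 * ?R + 2 * ?R = 3 * ?R" by simp
  note c = second_moment_combination[OF errors_measurable(2) tr(1) tr2 tr(1) tr2 R R _ _ _ bound]
  show "integrable M (\<lambda>w. (tracking 1 w)\<^sup>2)" by (rule c(1)) (use R in auto)
  show "expectation (\<lambda>w. (tracking 1 w)\<^sup>2) \<le> (3 * ?R)\<^sup>2"
    using c(2) R unfolding three by auto
qed

text \<open>
  Both root mean square errors are dominated by one scalar sequence, \<open>v\<close> for the disagreement and \<open>s * v\<close>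
  for the tracking error, with \<open>s\<close> from \<open>contraction_weights\<close>.  The sequence contracts by \<open>\<theta>\<close> and is
  driven by the step size times the bound on the gradient estimates; \<open>g\<close> covers the driving term of both
  components.
\<close>

lemma error_recursion:
  fixes v :: "nat \<Rightarrow> real"
  assumes s: "0 < s" and \<theta>: "0 < \<theta>"
    "(1 - \<gamma> * \<delta>) + \<gamma> * \<beta> * ((1 - c0) * s) \<le> \<theta>"
    "(1 + \<gamma> * \<beta>) * ((1 - c0) * s) + \<gamma> * \<beta> \<le> \<theta> * s"
    and g: "sqrt (real CARD('n)) * (real CARD('d) * L) \<le> g" "sqrt (real CARD('n)) * (real CARD('d) * L) \<le> s * g"
    and v1: "3 * (sqrt (real CARD('n)) * Rout) \<le> v 1" "3 * (sqrt (real CARD('n)) * Rout) \<le> s * v 1"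
    and v: "\<And>k. 1 \<le> k \<Longrightarrow> v (Suc k) = \<theta> * v k + \<eta> k * g"
    and k: "1 \<le> k"
  shows "0 < v k \<and> expectation (\<lambda>w. (disagreement k w)\<^sup>2) \<le> (v k)\<^sup>2
    \<and> integrable M (\<lambda>w. (tracking k w)\<^sup>2) \<and> expectation (\<lambda>w. (tracking k w)\<^sup>2) \<le> (s * v k)\<^sup>2"
  using k
proof (induction k rule: nat_induct_at_least)
  case base
  let ?R = "sqrt (real CARD('n)) * Rout"
  have R: "0 < ?R" using \<Omega>(4) by simp
  have "expectation (\<lambda>w. (disagreement 1 w)\<^sup>2) \<le> expectation (\<lambda>w. ?R\<^sup>2)"
    using integrable_disagreement(2) disagreement_le
    by (intro integral_mono) (auto intro!: power_mono simp: error_nonneg)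
  also have "\<dots> = ?R\<^sup>2" by (simp add: prob_space)
  also have "\<dots> \<le> (v 1)\<^sup>2" using v1 R by (intro power_mono) auto
  finally have "expectation (\<lambda>w. (disagreement 1 w)\<^sup>2) \<le> (v 1)\<^sup>2" .
  moreover have "(3 * ?R)\<^sup>2 \<le> (s * v 1)\<^sup>2" using v1 R by (intro power_mono) auto
  ultimately show ?case using first_tracking_error v1 R by auto
next
  case (Suc k)
  let ?g = "sqrt (real CARD('n)) * (real CARD('d) * L)"
  have vk: "0 < v k" and dis: "expectation (\<lambda>w. (disagreement k w)\<^sup>2) \<le> (v k)\<^sup>2"
    and tri: "integrable M (\<lambda>w. (tracking k w)\<^sup>2)" and tr: "expectation (\<lambda>w. (tracking k w)\<^sup>2) \<le> (s * v k)\<^sup>2"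
    using Suc.IH by auto
  define p where "p = (1 - c0) * s * v k"
  have p: "0 < p" using c0 s vk by (simp add: p_def)
  have g0: "0 \<le> ?g" using L by simp
  have gb: "0 < \<gamma> * \<beta>" using \<gamma> laplacian by simp
  have gd: "0 \<le> 1 - \<gamma> * \<delta>" using mult_mono[of \<gamma> 1 \<delta> 1] \<gamma> gap by simp
  have "(1 - c0)\<^sup>2 * expectation (\<lambda>w. (tracking k w)\<^sup>2) \<le> (1 - c0)\<^sup>2 * (s * v k)\<^sup>2"
    using tr by (intro mult_left_mono) auto
  then have tm: "expectation (\<lambda>w. (transmission k w)\<^sup>2) \<le> p\<^sup>2"
    using transmission_contracts(2)[OF tri] by (simp add: p_def power_mult_distrib mult_ac)
  note tmi = transmission_contracts(1)[OF tri]
  have e: "0 \<le> \<eta> k * ?g" using g0 \<eta>[of k] by simp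
  have eg: "\<eta> k * ?g \<le> \<eta> k * g" "\<eta> k * ?g \<le> s * (\<eta> k * g)"
    using mult_left_mono[OF g(1), of "\<eta> k"] mult_left_mono[OF g(2), of "\<eta> k"] \<eta>[of k] by (auto simp: mult_ac)
  have "AE w in M. w \<in> space M" by simp
  then have bounds: "AE w in M. disagreement (Suc k) w \<le> (1 - \<gamma> * \<delta>) * disagreement k w + \<gamma> * \<beta> * transmission k w + \<eta> k * ?g
     \<and> tracking (Suc k) w \<le> \<gamma> * \<beta> * disagreement k w + (1 + \<gamma> * \<beta>) * transmission k w + \<eta> k * ?g"
    using AE_norm_G[of k]
  proof eventually_elim
    case (elim w)
    interpret st: gossip_step N W S \<gamma> "\<eta> k" "X k w" "X (Suc k) w" "XH (Suc k) w" "G k w"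
      by (rule path_step) (use elim Suc.hyps in auto)
    have "\<eta> k * norm (G k w) \<le> \<eta> k * ?g" using elim \<eta>[of k] by (intro mult_left_mono) auto
    then show ?case
      using st.disagreement_step st.tracking_step
      unfolding disagreement_def tracking_def transmission_def by linarith
  qed
  have b1: "AE w in M. 0 \<le> disagreement (Suc k) w \<and>
      disagreement (Suc k) w \<le> (1 - \<gamma> * \<delta>) * disagreement k w + \<gamma> * \<beta> * transmission k w + \<eta> k * ?g"
    using bounds by eventually_elim (simp add: error_nonneg)
  have b2: "AE w in M. 0 \<le> tracking (Suc k) w \<and>
      tracking (Suc k) w \<le> \<gamma> * \<beta> * disagreement k w + (1 + \<gamma> * \<beta>) * transmission k w + \<eta> k * ?g"
    using bounds by eventually_elim (simp add: error_nonneg)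
  note m1 = second_moment_combination[OF errors_measurable(1) integrable_disagreement(2) dis tmi tm vk p gd less_imp_le[OF gb] e b1]
  have gb1: "0 \<le> 1 + \<gamma> * \<beta>" using gb by simp
  note m2 = second_moment_combination[OF errors_measurable(2) integrable_disagreement(2) dis tmi tm vk p less_imp_le[OF gb] gb1 e b2]
  have vS: "v (Suc k) = \<theta> * v k + \<eta> k * g" using v Suc.hyps by simp
  have "(1 - \<gamma> * \<delta>) * v k + \<gamma> * \<beta> * p = ((1 - \<gamma> * \<delta>) + \<gamma> * \<beta> * ((1 - c0) * s)) * v k"
    by (simp add: p_def algebra_simps)
  also have "\<dots> \<le> \<theta> * v k" using \<theta> vk by (intro mult_right_mono) auto
  finally have "((1 - \<gamma> * \<delta>) * v k + \<gamma> * \<beta> * p + \<eta> k * ?g)\<^sup>2 \<le> (v (Suc k))\<^sup>2"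
    unfolding vS using eg(1) e gd gb vk p by (intro power_mono) auto
  moreover
  have "\<gamma> * \<beta> * v k + (1 + \<gamma> * \<beta>) * p = ((1 + \<gamma> * \<beta>) * ((1 - c0) * s) + \<gamma> * \<beta>) * v k"
    by (simp add: p_def algebra_simps)
  then have "\<gamma> * \<beta> * v k + (1 + \<gamma> * \<beta>) * p \<le> (\<theta> * s) * v k"
    using \<theta> vk mult_right_mono[OF \<theta>(3), of "v k"] by simp
  then have "\<gamma> * \<beta> * v k + (1 + \<gamma> * \<beta>) * p + \<eta> k * ?g \<le> s * v (Suc k)"
    unfolding vS using eg(2) by (simp add: algebra_simps)
  then have "(\<gamma> * \<beta> * v k + (1 + \<gamma> * \<beta>) * p + \<eta> k * ?g)\<^sup>2 \<le> (s * v (Suc k))\<^sup>2"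
    using mult_pos_pos[OF gb vk] mult_pos_pos[of "1 + \<gamma> * \<beta>" p] gb p e by (intro power_mono) linarith+
  moreover have "0 < v (Suc k)"
    unfolding vS using \<theta> vk e eg(1) by (intro add_pos_nonneg) auto
  ultimately show ?case using m1 m2 by linarith
qed

section \<open>Expected progress of one round\<close>

lemma average_mem: "w \<in> space M \<Longrightarrow> agent_average (\<lambda>i. x i k w) \<in> \<Omega>"
  using convex_sum[of UNIV \<Omega> "\<lambda>i. 1 / real CARD('n)" "\<lambda>i. x i k w"] \<Omega>(2) iterate_mem
  by (simp add: agent_average_def scaleR_sum_right)

lemma average_measurable [measurable]: "(\<lambda>w. agent_average (\<lambda>i. x i k w)) \<in> borel_measurable M"
  unfolding agent_average_def by measurable

lemma sqdist_le:
  assumes "y \<in> \<Omega>" "w \<in> space M"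
  shows "sqdist y k w \<le> 4 * real CARD('n) * Rout\<^sup>2"
proof -
  have "sqdist y k w \<le> (\<Sum>i\<in>(UNIV::'n set). (2 * Rout)\<^sup>2)"
    unfolding sum_sq using norm_diff_le iterate_mem assms by (intro sum_mono power_mono) auto
  then show ?thesis by (simp add: power_mult_distrib mult_ac)
qed

lemma integrable_sqdist: "y \<in> \<Omega> \<Longrightarrow> integrable M (sqdist y k)"
  by (rule integrable_bounded[of _ "4 * real CARD('n) * Rout\<^sup>2"]) (auto simp: sqdist_le error_nonneg)

lemma expected_sqdist:
  assumes "y \<in> \<Omega>"
  shows "0 \<le> expectation (sqdist y k)" "expectation (sqdist y k) \<le> 4 * real CARD('n) * Rout\<^sup>2"
proof -
  show "0 \<le> expectation (sqdist y k)" by (rule integral_nonneg_AE) (simp add: error_nonneg)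
  have "expectation (sqdist y k) \<le> expectation (\<lambda>w. 4 * real CARD('n) * Rout\<^sup>2)"
    using assms integrable_sqdist sqdist_le by (intro integral_mono) auto
  then show "expectation (sqdist y k) \<le> 4 * real CARD('n) * Rout\<^sup>2" by (simp add: prob_space)
qed

text \<open>
  The losses, per agent: \<open>L * v\<close> for evaluating \<open>f i\<close> at the agent's own iterate instead of the average,
  \<open>L * \<epsilon> * Rout\<close> for comparing with a point \<open>y\<close> of the shrunk set instead of \<open>xs\<close>, and the error of the
  two-point estimate.
\<close>

lemma gradient_correlation:
  assumes y: "y \<in> \<Omega>" and z: "xs \<in> \<Omega>" "norm (y - xs) \<le> \<epsilon> * Rout"
    and v: "expectation (disagreement k) \<le> v"
  shows "real CARD('n) * expectation (\<lambda>w. objective P F (agent_average (\<lambda>i. x i k w)) - objective P F xs)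
      - real CARD('n) * (L * v + L * (\<epsilon> * Rout) + 2 * (real CARD('d) + 1) * L * \<mu>)
    \<le> expectation (\<lambda>w. (X k w - (\<chi> i. y)) \<bullet> G k w)"
    and "integrable M (\<lambda>w. (X k w - (\<chi> i. y)) \<bullet> G k w)"
proof -
  let ?b = "2 * (real CARD('d) + 1) * L * \<mu>"
  let ?m = "\<lambda>w. agent_average (\<lambda>i. x i k w)"
  have inner: "(\<lambda>w. (X k w - (\<chi> i. y)) \<bullet> G k w) = (\<lambda>w. \<Sum>i\<in>UNIV. (x i k w - y) \<bullet> grad i k w)"
    by (simp add: inner_vec_def[where 'a="real^'d"] X_def G_def)
  note eg = expected_gradient[OF y]
  show "integrable M (\<lambda>w. (X k w - (\<chi> i. y)) \<bullet> G k w)"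
    unfolding inner using eg(1) by auto
  have intm: "integrable M (\<lambda>w. f i (?m w))" for i
    by (rule integrable_local_objective) (auto simp: average_mem)
  have intx: "integrable M (\<lambda>w. f i (x i k w))" for i
    by (rule integrable_local_objective) (auto simp: iterate_mem)
  have agent: "expectation (\<lambda>w. f i (?m w)) - f i xs - (L * v + L * (\<epsilon> * Rout) + ?b)
      \<le> expectation (\<lambda>w. (x i k w - y) \<bullet> grad i k w)" for i
  proof -
    have "expectation (\<lambda>w. f i (?m w)) \<le> expectation (\<lambda>w. f i (x i k w) + L * disagreement k w)"
    proof (rule integral_mono)
      fix w assume w: "w \<in> space M"
      have "norm (?m w - x i k w) = norm ((X k w - H ** X k w) $ i)"
        by (simp add: averaging_row X_def norm_minus_commute)
      also have "\<dots> \<le> disagreement k w" unfolding disagreement_def by (rule Finite_Cartesian_Product.norm_nth_le)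
      finally have "L * norm (?m w - x i k w) \<le> L * disagreement k w" using L by simp
      then show "f i (?m w) \<le> f i (x i k w) + L * disagreement k w"
        using local_objective_lipschitz[OF average_mem[OF w] iterate_mem[OF w], of i k i k] by linarith
    qed (use intm intx integrable_disagreement in auto)
    also have "\<dots> = expectation (\<lambda>w. f i (x i k w)) + L * expectation (disagreement k)"
      using intx integrable_disagreement by simp
    also have "\<dots> \<le> expectation (\<lambda>w. f i (x i k w)) + L * v"
      using v L by simp
    finally have 1: "expectation (\<lambda>w. f i (?m w)) \<le> expectation (\<lambda>w. f i (x i k w)) + L * v" .
    have "L * norm (y - xs) \<le> L * (\<epsilon> * Rout)" using z L by simp
    then have "f i y \<le> f i xs + L * (\<epsilon> * Rout)"
      using local_objective_lipschitz[OF y z(1), of i] by linarith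
    then show ?thesis using 1 eg(2)[of i k] by linarith
  qed
  have "real CARD('n) * expectation (\<lambda>w. objective P F (?m w) - objective P F xs)
      = (\<Sum>i\<in>UNIV. expectation (\<lambda>w. f i (?m w))) - (\<Sum>i\<in>UNIV. f i xs)"
    unfolding objective_def using intm by (simp add: prob_space field_simps)
  then have "real CARD('n) * expectation (\<lambda>w. objective P F (?m w) - objective P F xs) - real CARD('n) * (L * v + L * (\<epsilon> * Rout) + ?b)
      = (\<Sum>i\<in>UNIV. expectation (\<lambda>w. f i (?m w)) - f i xs - (L * v + L * (\<epsilon> * Rout) + ?b))"
    by (simp add: sum_subtractf)
  also have "\<dots> \<le> (\<Sum>i\<in>UNIV. expectation (\<lambda>w. (x i k w - y) \<bullet> grad i k w))"
    by (intro sum_mono agent)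
  also have "\<dots> = expectation (\<lambda>w. (X k w - (\<chi> i. y)) \<bullet> G k w)"
    unfolding inner using eg(1) by simp
  finally show "real CARD('n) * expectation (\<lambda>w. objective P F (?m w) - objective P F xs)
      - real CARD('n) * (L * v + L * (\<epsilon> * Rout) + ?b) \<le> expectation (\<lambda>w. (X k w - (\<chi> i. y)) \<bullet> G k w)" .
qed

text \<open>
  \<open>distance_step\<close> in expectation: when \<open>v\<close> is of order \<open>\<eta> k\<close>, all terms outside the telescoping difference
  are of order \<open>(\<eta> k)\<^sup>2\<close> or \<open>\<eta> k * (\<epsilon> + \<mu>)\<close>.
\<close>

lemma expected_progress:
  assumes k: "1 \<le> k" and xs: "xs \<in> \<Omega>" and s: "0 < s" and v: "0 < v"
    and dis: "expectation (\<lambda>w. (disagreement k w)\<^sup>2) \<le> v\<^sup>2"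
    and tri: "integrable M (\<lambda>w. (tracking k w)\<^sup>2)" and tr: "expectation (\<lambda>w. (tracking k w)\<^sup>2) \<le> (s * v)\<^sup>2"
  defines "y \<equiv> (1 - \<epsilon>) *\<^sub>R xs" and "g \<equiv> sqrt (real CARD('n)) * (real CARD('d) * L)"
  shows "2 * \<eta> k * (real CARD('n) * expectation (\<lambda>w. objective P F (agent_average (\<lambda>i. x i k w)) - objective P F xs))
    \<le> expectation (sqdist y k) - expectation (sqdist y (Suc k))
      + (2 * (\<gamma> * \<beta>) * s + 2 * (\<gamma> * \<beta> * s)\<^sup>2) * v\<^sup>2 + 2 * \<eta> k * (\<gamma> * \<beta>) * g * v + 2 * (\<eta> k * g)\<^sup>2
      + 2 * \<eta> k * (real CARD('n) * (L * v + L * (\<epsilon> * Rout) + 2 * (real CARD('d) + 1) * L * \<mu>))"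
proof -
  have yS: "y \<in> S" unfolding y_def by (rule shrunk_mem[OF xs])
  then have y: "y \<in> \<Omega>" using S by auto
  have "norm (y - xs) = \<epsilon> * norm xs"
    using \<epsilon> by (simp add: y_def scaleR_left_diff_distrib)
  then have ny: "norm (y - xs) \<le> \<epsilon> * Rout"
    using \<epsilon> \<Omega>(5)[OF xs] by (simp add: mult_left_mono)
  have \<eta>k: "0 < \<eta> k" by (rule \<eta>)
  have gb: "0 < \<gamma> * \<beta>" using \<gamma> laplacian by simp
  have g0: "0 \<le> g" using L by (simp add: g_def)
  \<comment> \<open>the mean is at most the root mean square; \<open>v\<close> serves as its upper bound\<close>
  have dis1: "expectation (disagreement k) \<le> v"
  proof -
    have "disagreement k w \<le> ((disagreement k w)\<^sup>2 / v + v) / 2" for w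
      using sum_squares_bound[of "disagreement k w" v] v by (simp add: field_simps power2_eq_square)
    then have "expectation (disagreement k) \<le> expectation (\<lambda>w. ((disagreement k w)\<^sup>2 / v + v) / 2)"
      using integrable_disagreement by (intro integral_mono) auto
    also have "\<dots> = (expectation (\<lambda>w. (disagreement k w)\<^sup>2) / v + v) / 2"
      using integrable_disagreement by (simp add: prob_space)
    also have "\<dots> \<le> (v\<^sup>2 / v + v) / 2"
      using dis v by (intro divide_right_mono add_right_mono) auto
    finally show ?thesis using v by (simp add: power2_eq_square)
  qed
  note gc = gradient_correlation[OF y xs ny dis1]
  note tmi = transmission_contracts(1)[OF tri]
  have tm: "expectation (\<lambda>w. (transmission k w)\<^sup>2) \<le> (s * v)\<^sup>2"
  proof -
    have "(1 - c0)\<^sup>2 * expectation (\<lambda>w. (tracking k w)\<^sup>2) \<le> 1 * (s * v)\<^sup>2"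
      using tr c0 by (intro mult_mono) (auto simp: power_le_one)
    then show ?thesis using transmission_contracts(2)[OF tri] by simp
  qed
  let ?U = "\<lambda>w. sqdist y k w - sqdist y (Suc k) w
      + \<gamma> * \<beta> * (s * (disagreement k w)\<^sup>2 + (transmission k w)\<^sup>2 / s)
      + 2 * \<eta> k * (\<gamma> * \<beta>) * (g * disagreement k w)
      + 2 * (\<gamma> * \<beta>)\<^sup>2 * (transmission k w)\<^sup>2 + 2 * (\<eta> k * g)\<^sup>2"
  have "AE w in M. w \<in> space M" by simp
  then have "AE w in M. 2 * \<eta> k * ((X k w - (\<chi> i. y)) \<bullet> G k w) \<le> ?U w"
    using AE_norm_G[of k]
  proof eventually_elim
    case (elim w)
    interpret st: gossip_step N W S \<gamma> "\<eta> k" "X k w" "X (Suc k) w" "XH (Suc k) w" "G k w"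
      by (rule path_step) (use elim k in auto)
    let ?d = "disagreement k w" and ?e = "transmission k w"
    have nG: "norm (G k w) \<le> g" using elim by (simp add: g_def)
    have "2 * \<eta> k * ((X k w - (\<chi> i. y)) \<bullet> G k w) \<le> sqdist y k w - sqdist y (Suc k) w
      + 2 * (\<gamma> * \<beta>) * (?d * ?e) + 2 * \<eta> k * (\<gamma> * \<beta>) * (?d * norm (G k w))
      + 2 * (\<gamma> * \<beta> * ?e)\<^sup>2 + 2 * (\<eta> k * norm (G k w))\<^sup>2"
      using st.distance_step[OF yS] unfolding sqdist_def disagreement_def transmission_def .
    moreover have "2 * (\<gamma> * \<beta>) * (?d * ?e) \<le> \<gamma> * \<beta> * (s * ?d\<^sup>2 + ?e\<^sup>2 / s)"
    proof -
      have "0 \<le> (s * ?d - ?e)\<^sup>2" by simp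
      then have "2 * (?d * ?e) \<le> s * ?d\<^sup>2 + ?e\<^sup>2 / s"
        using s by (simp add: power2_diff field_simps power2_eq_square)
      from mult_left_mono[OF this less_imp_le[OF gb]] show ?thesis by (simp add: mult_ac)
    qed
    moreover have "2 * \<eta> k * (\<gamma> * \<beta>) * (?d * norm (G k w)) \<le> 2 * \<eta> k * (\<gamma> * \<beta>) * (g * ?d)"
      using mult_left_mono[OF nG error_nonneg(1)[of k w]] \<eta>k gb by (intro mult_left_mono) (auto simp: mult.commute)
    moreover have "(\<eta> k * norm (G k w))\<^sup>2 \<le> (\<eta> k * g)\<^sup>2"
      using nG \<eta>k by (intro power_mono mult_left_mono) auto
    ultimately show ?case by (simp add: power_mult_distrib)
  qed
  then have "expectation (\<lambda>w. 2 * \<eta> k * ((X k w - (\<chi> i. y)) \<bullet> G k w)) \<le> expectation ?U"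
    using gc(2) integrable_sqdist[OF y] integrable_disagreement tmi by (intro integral_mono_AE) auto
  also have "\<dots> = expectation (sqdist y k) - expectation (sqdist y (Suc k))
      + \<gamma> * \<beta> * (s * expectation (\<lambda>w. (disagreement k w)\<^sup>2) + expectation (\<lambda>w. (transmission k w)\<^sup>2) / s)
      + 2 * \<eta> k * (\<gamma> * \<beta>) * (g * expectation (disagreement k))
      + 2 * (\<gamma> * \<beta>)\<^sup>2 * expectation (\<lambda>w. (transmission k w)\<^sup>2) + 2 * (\<eta> k * g)\<^sup>2"
    using integrable_sqdist[OF y] integrable_disagreement tmi by (simp add: prob_space)
  also have "\<dots> \<le> expectation (sqdist y k) - expectation (sqdist y (Suc k))
      + \<gamma> * \<beta> * (s * v\<^sup>2 + (s * v)\<^sup>2 / s)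
      + 2 * \<eta> k * (\<gamma> * \<beta>) * (g * v)
      + 2 * (\<gamma> * \<beta>)\<^sup>2 * (s * v)\<^sup>2 + 2 * (\<eta> k * g)\<^sup>2"
    using dis dis1 tm s gb \<eta>k g0 by (intro add_mono mult_left_mono divide_right_mono order_refl) auto
  also have "\<dots> = expectation (sqdist y k) - expectation (sqdist y (Suc k))
      + (2 * (\<gamma> * \<beta>) * s + 2 * (\<gamma> * \<beta> * s)\<^sup>2) * v\<^sup>2 + 2 * \<eta> k * (\<gamma> * \<beta>) * g * v + 2 * (\<eta> k * g)\<^sup>2"
    using s by (simp add: power_mult_distrib algebra_simps power2_eq_square)
  finally have up: "2 * \<eta> k * expectation (\<lambda>w. (X k w - (\<chi> i. y)) \<bullet> G k w) \<le> \<dots>" by simp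
  have "2 * \<eta> k * (real CARD('n) * expectation (\<lambda>w. objective P F (agent_average (\<lambda>i. x i k w)) - objective P F xs)
      - real CARD('n) * (L * v + L * (\<epsilon> * Rout) + 2 * (real CARD('d) + 1) * L * \<mu>))
    \<le> 2 * \<eta> k * expectation (\<lambda>w. (X k w - (\<chi> i. y)) \<bullet> G k w)"
    using gc(1) \<eta>k by (intro mult_left_mono) auto
  then show ?thesis using up unfolding right_diff_distrib by linarith
qed

end

section \<open>Scalar sums and recursions\<close>

lemma sum_inverse_sqrt_le:
  assumes "0 < c"
  shows "(\<Sum>k=1..T. 1 / sqrt (real k + c)) \<le> 2 * sqrt (real T + c)"
proof (induction T)
  case (Suc T)
  define a b where "a = sqrt (real T + c)" and "b = sqrt (real (Suc T) + c)"
  have ab: "0 < a" "a < b" using assms by (auto simp: a_def b_def)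
  have "b\<^sup>2 - a\<^sup>2 = 1" using assms by (simp add: a_def b_def)
  then have "1 = (b - a) * (b + a)" by (simp add: power2_eq_square algebra_simps)
  also have "\<dots> \<le> (b - a) * (2 * b)" using ab by (intro mult_left_mono) auto
  finally have "1 / b \<le> 2 * (b - a)" using ab by (simp add: field_simps)
  then show ?case using Suc.IH by (simp add: a_def b_def)
qed (use assms in simp)

text \<open>
  Summation by parts: the increments of \<open>w\<close> are nonnegative and meet factors \<open>a k \<le> B\<close>.
\<close>

lemma weighted_telescope_le:
  fixes a w :: "nat \<Rightarrow> real"
  assumes w: "\<And>k. 0 \<le> w k" "\<And>k. w k \<le> w (Suc k)" and a: "\<And>k. 0 \<le> a k" "\<And>k. a k \<le> B"
  shows "(\<Sum>k=1..T. (a k - a (Suc k)) * w k) \<le> B * w T"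
proof -
  have "(\<Sum>k=1..T. (a k - a (Suc k)) * w k) \<le> B * w T - a (Suc T) * w T"
  proof (induction T)
    case 0
    then show ?case using mult_right_mono[OF a(2)[of 1] w(1)[of 0]] by simp
  next
    case (Suc T)
    have "0 \<le> (B - a (Suc T)) * (w (Suc T) - w T)" using w a by (simp add: mult_nonneg_nonneg)
    then show ?case using Suc.IH by (simp add: algebra_simps)
  qed
  moreover have "0 \<le> a (Suc T) * w T" using w a by simp
  ultimately show ?thesis by linarith
qed

text \<open>
  A geometrically damped recursion driven by \<open>\<eta>\<close> follows the order of \<open>\<eta>\<close>, because \<open>\<eta>\<close> decays more
  slowly than any geometric sequence.
\<close>

lemma damped_recursion:
  fixes \<eta> :: "nat \<Rightarrow> real"
  assumes c: "0 < c" and \<eta>: "\<And>k. \<eta> k = 1 / sqrt (real k + c)"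
    and q: "0 < q" "q < 1" and g: "0 \<le> g" and v1: "0 \<le> v1"
  obtains v K where "v 1 = v1" "\<And>k. 1 \<le> k \<Longrightarrow> v (Suc k) = q * v k + \<eta> k * g"
    "\<And>k. 1 \<le> k \<Longrightarrow> v k \<le> K * \<eta> k"
proof -
  define v where "v = (\<lambda>k. rec_nat v1 (\<lambda>j a. q * a + \<eta> (Suc j) * g) (k - 1))"
  have v_1: "v 1 = v1" by (simp add: v_def)
  have v_Suc: "v (Suc k) = q * v k + \<eta> k * g" if "1 \<le> k" for k
    using that by (cases k) (auto simp: v_def)
  have \<eta>_pos: "0 < \<eta> k" for k using c by (simp add: \<eta>)
  have v_nonneg: "0 \<le> v k" if "1 \<le> k" for k
    using that
  proof (induction k rule: nat_induct_at_least)
    case (Suc k)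
    then show ?case using q g \<eta>_pos[of k] by (simp add: v_Suc)
  qed (use v1 v_1 in simp)
  define m where "m = (1 + q) / 2"
  have m: "q < m" "m < 1" "0 < m" using q by (auto simp: m_def)
  have mq: "0 < m\<^sup>2 - q\<^sup>2" using m q by (simp add: power_strict_mono)
  define k0 where "k0 = Suc (nat \<lceil>q\<^sup>2 / (m\<^sup>2 - q\<^sup>2)\<rceil>)"
  define z where "z = (\<lambda>k. v k * sqrt (real k + c))"
  \<comment> \<open>from \<open>k0\<close> on, \<open>q * \<eta> k \<le> m * \<eta> (Suc k)\<close>, so \<open>v / \<eta>\<close> still contracts, by \<open>m\<close> instead of \<open>q\<close>\<close>
  have z_Suc: "z (Suc k) \<le> m * z k + 2 * g" if "k0 \<le> k" for k
  proof -
    have k1: "1 \<le> k" using that by (simp add: k0_def)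
    have "q\<^sup>2 / (m\<^sup>2 - q\<^sup>2) \<le> real k" using that unfolding k0_def by linarith
    then have "q\<^sup>2 \<le> (m\<^sup>2 - q\<^sup>2) * (real k + c)"
      using mq c by (simp add: field_simps) (smt (verit) mult_pos_pos right_diff_distrib)
    then have "(q * sqrt (real (Suc k) + c))\<^sup>2 \<le> (m * sqrt (real k + c))\<^sup>2"
      using c by (simp add: power_mult_distrib algebra_simps)
    then have "q * sqrt (real (Suc k) + c) \<le> m * sqrt (real k + c)"
      by (rule power2_le_imp_le) (use m c in simp)
    from mult_left_mono[OF this v_nonneg[OF k1]]
    have 1: "q * v k * sqrt (real (Suc k) + c) \<le> m * z k" by (simp add: z_def mult_ac)
    have "sqrt (real (Suc k) + c) \<le> sqrt (4 * (real k + c))" using k1 c by simp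
    then have "sqrt (real (Suc k) + c) \<le> 2 * sqrt (real k + c)" by (simp only: real_sqrt_mult real_sqrt_four)
    then have "\<eta> k * sqrt (real (Suc k) + c) \<le> \<eta> k * (2 * sqrt (real k + c))"
      using \<eta>_pos[of k] by (intro mult_left_mono) auto
    also have "\<dots> = 2" using c by (simp add: \<eta>)
    finally have "g * (\<eta> k * sqrt (real (Suc k) + c)) \<le> g * 2" using g by (rule mult_left_mono)
    moreover have "z (Suc k) = q * v k * sqrt (real (Suc k) + c) + g * (\<eta> k * sqrt (real (Suc k) + c))"
      unfolding z_def v_Suc[OF k1] distrib_right by (simp only: mult_ac)
    ultimately show ?thesis using 1 by linarith
  qed
  define K where "K = Max (z ` {..k0}) + 2 * g / (1 - m)"
  have Kz: "z k \<le> K - 2 * g / (1 - m)" if "k \<le> k0" for k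
    using that by (auto simp: K_def intro!: Max_ge add_increasing2)
  have g_le: "0 \<le> 2 * g / (1 - m)" using g m by simp
  have zK: "z k \<le> K" for k
  proof (cases "k \<le> k0")
    case True
    then show ?thesis using Kz[of k] g_le by linarith
  next
    case False
    then have "k0 \<le> k" by simp
    then show ?thesis
    proof (induction k rule: nat_induct_at_least)
      case base
      then show ?case using Kz[of k0] g_le by linarith
    next
      case (Suc k)
      have "0 \<le> K - 2 * g / (1 - m)"
      proof -
        have "0 \<le> z 0" using v1 c by (simp add: z_def v_def)
        also have "\<dots> \<le> Max (z ` {..k0})" by (intro Max_ge) auto
        finally show ?thesis unfolding K_def by simp
      qed
      then have "0 \<le> (K - 2 * g / (1 - m)) * (1 - m)" using m by (intro mult_nonneg_nonneg) auto
      then have "2 * g \<le> K * (1 - m)" using m by (simp add: left_diff_distrib)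
      then have "m * K + 2 * g \<le> K" by (simp add: algebra_simps)
      moreover have "m * z k \<le> m * K" using Suc.IH m by simp
      ultimately show ?case using z_Suc[OF Suc.hyps] by linarith
    qed
  qed
  have "v k \<le> K * \<eta> k" for k
  proof -
    have "0 < sqrt (real k + c)" using c by simp
    then show ?thesis using zK[of k] by (simp add: z_def \<eta> field_simps)
  qed
  then show ?thesis using that v_1 v_Suc by blast
qed

section \<open>The regret bound\<close>

context com_dszo_run
begin

text \<open>
  Dividing \<open>expected_progress\<close> by \<open>2 * n * \<eta> k\<close> and summing, the squared distances contribute
  \<open>1 / \<eta> T\<close> by summation by parts and the second-order terms contribute the sum of the step sizes; both are
  of order \<open>sqrt (T + c)\<close>.
\<close>

lemma regret_bound:
  fixes v :: "nat \<Rightarrow> real" and T :: nat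
  assumes c: "0 < c" and step_size: "\<And>k. \<eta> k = 1 / sqrt (real k + c)"
    and s: "0 < s" and \<theta>: "0 < \<theta>"
    "(1 - \<gamma> * \<delta>) + \<gamma> * \<beta> * ((1 - c0) * s) \<le> \<theta>"
    "(1 + \<gamma> * \<beta>) * ((1 - c0) * s) + \<gamma> * \<beta> \<le> \<theta> * s"
    and g: "sqrt (real CARD('n)) * (real CARD('d) * L) \<le> g" "sqrt (real CARD('n)) * (real CARD('d) * L) \<le> s * g"
    and v1: "3 * (sqrt (real CARD('n)) * Rout) \<le> v 1" "3 * (sqrt (real CARD('n)) * Rout) \<le> s * v 1"
    and v: "\<And>k. 1 \<le> k \<Longrightarrow> v (Suc k) = \<theta> * v k + \<eta> k * g"
    and vK: "\<And>k. 1 \<le> k \<Longrightarrow> v k \<le> K * \<eta> k"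
    and xs: "xs \<in> \<Omega>"
  defines "G0 \<equiv> sqrt (real CARD('n)) * (real CARD('d) * L)"
  defines "J \<equiv> (2 * (\<gamma> * \<beta>) * s + 2 * (\<gamma> * \<beta> * s)\<^sup>2) * K\<^sup>2 + 2 * (\<gamma> * \<beta>) * G0 * K + 2 * G0\<^sup>2
      + 2 * (real CARD('n) * (L * K))"
  shows "(\<Sum>k=1..T. expectation (\<lambda>w. objective P F (agent_average (\<lambda>i. x i k w)) - objective P F xs))
    \<le> (2 * Rout\<^sup>2 + J / real CARD('n)) * sqrt (real T + c)
      + real T * (L * (\<epsilon> * Rout) + 2 * (real CARD('d) + 1) * L * \<mu>)"
proof -
  let ?n = "real CARD('n)"
  let ?e = "L * (\<epsilon> * Rout) + 2 * (real CARD('d) + 1) * L * \<mu>"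
  define y where "y = (1 - \<epsilon>) *\<^sub>R xs"
  have y: "y \<in> \<Omega>" unfolding y_def using shrunk_mem[OF xs] S by auto
  define a where "a = (\<lambda>k. expectation (sqdist y k))"
  define R where "R = (\<lambda>k. expectation (\<lambda>w. objective P F (agent_average (\<lambda>i. x i k w)) - objective P F xs))"
  have n: "0 < ?n" by simp
  have G0: "0 \<le> G0" using L by (simp add: G0_def)
  have gb: "0 < \<gamma> * \<beta>" using \<gamma> laplacian by simp
  have round: "R k \<le> (a k - a (Suc k)) * sqrt (real k + c) / (2 * ?n) + J / (2 * ?n) * (1 / sqrt (real k + c)) + ?e"
    if k: "1 \<le> k" for k
  proof -
    have h: "0 < \<eta> k" by (rule \<eta>)
    note er = error_recursion[OF s \<theta> g v1 v k]
    have vk: "0 < v k" "v k \<le> K * \<eta> k" using er vK[OF k] by auto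
    have p: "2 * \<eta> k * (?n * R k) \<le> a k - a (Suc k)
      + (2 * (\<gamma> * \<beta>) * s + 2 * (\<gamma> * \<beta> * s)\<^sup>2) * (v k)\<^sup>2 + 2 * \<eta> k * (\<gamma> * \<beta>) * G0 * v k + 2 * (\<eta> k * G0)\<^sup>2
      + 2 * \<eta> k * (?n * (L * v k + L * (\<epsilon> * Rout) + 2 * (real CARD('d) + 1) * L * \<mu>))"
      using expected_progress[OF k xs s vk(1)] er unfolding R_def a_def y_def G0_def by blast
    have "(2 * (\<gamma> * \<beta>) * s + 2 * (\<gamma> * \<beta> * s)\<^sup>2) * (v k)\<^sup>2
        \<le> (2 * (\<gamma> * \<beta>) * s + 2 * (\<gamma> * \<beta> * s)\<^sup>2) * (K * \<eta> k)\<^sup>2"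
      using vk gb s by (intro mult_left_mono power_mono) auto
    moreover have "2 * \<eta> k * (\<gamma> * \<beta>) * G0 * v k \<le> 2 * \<eta> k * (\<gamma> * \<beta>) * G0 * (K * \<eta> k)"
      using vk gb G0 h by (intro mult_left_mono) auto
    moreover have "2 * \<eta> k * (?n * (L * v k)) \<le> 2 * \<eta> k * (?n * (L * (K * \<eta> k)))"
      using vk L h by (intro mult_left_mono) auto
    ultimately have "2 * \<eta> k * (?n * R k) \<le> a k - a (Suc k) + J * (\<eta> k)\<^sup>2 + 2 * \<eta> k * (?n * ?e)"
      using p by (simp add: J_def power_mult_distrib algebra_simps power2_eq_square)
    then have "R k \<le> (a k - a (Suc k) + J * (\<eta> k)\<^sup>2 + 2 * \<eta> k * (?n * ?e)) / (2 * \<eta> k * ?n)"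
      using h by (simp add: pos_le_divide_eq mult_ac)
    also have "\<dots> = (a k - a (Suc k)) / (2 * \<eta> k * ?n) + J / (2 * ?n) * \<eta> k + ?e"
      using h n by (simp add: add_divide_distrib power2_eq_square)
    also have "(a k - a (Suc k)) / (2 * \<eta> k * ?n) = (a k - a (Suc k)) * sqrt (real k + c) / (2 * ?n)"
      by (simp add: step_size)
    finally show ?thesis by (simp add: step_size)
  qed
  have "(\<Sum>k=1..T. R k) \<le> (\<Sum>k=1..T. (a k - a (Suc k)) * sqrt (real k + c) / (2 * ?n)
      + J / (2 * ?n) * (1 / sqrt (real k + c)) + ?e)"
    by (intro sum_mono round) auto
  also have "\<dots> = (\<Sum>k=1..T. (a k - a (Suc k)) * sqrt (real k + c)) / (2 * ?n)
      + J / (2 * ?n) * (\<Sum>k=1..T. 1 / sqrt (real k + c)) + real T * ?e"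
    by (simp only: sum.distrib sum_divide_distrib sum_distrib_left) (simp add: algebra_simps)
  also have "\<dots> \<le> (4 * ?n * Rout\<^sup>2 * sqrt (real T + c)) / (2 * ?n) + J / (2 * ?n) * (2 * sqrt (real T + c)) + real T * ?e"
  proof (intro add_right_mono add_mono divide_right_mono mult_left_mono)
    show "(\<Sum>k=1..T. (a k - a (Suc k)) * sqrt (real k + c)) \<le> 4 * ?n * Rout\<^sup>2 * sqrt (real T + c)"
      by (rule weighted_telescope_le) (use expected_sqdist[OF y] c in \<open>auto simp: a_def\<close>)
    show "(\<Sum>k=1..T. 1 / sqrt (real k + c)) \<le> 2 * sqrt (real T + c)"
      by (rule sum_inverse_sqrt_le[OF c])
    have "0 \<le> K"
    proof -
      have "0 < v 1" using error_recursion[OF s \<theta> g v1 v, of 1] by simp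
      then have "0 < K * \<eta> 1" using vK[of 1] by simp
      then show ?thesis using \<eta>[of 1] by (simp add: zero_less_mult_iff)
    qed
    then have "0 \<le> J" using gb s G0 L by (simp add: J_def)
    then show "0 \<le> J / (2 * ?n)" by simp
  qed auto
  also have "\<dots> = (2 * Rout\<^sup>2 + J / ?n) * sqrt (real T + c) + real T * ?e"
    using n by (simp add: field_simps)
  finally show ?thesis by (simp add: R_def)
qed

end

theorem theorem2:
  fixes N :: "'n::finite \<Rightarrow> 'n set"
    and W :: "real ^ 'n ^ 'n"
    and \<Omega> :: "(real ^ 'd::finite) set"
    and P :: "'n \<Rightarrow> 's measure"
    and F :: "'n \<Rightarrow> real ^ 'd \<Rightarrow> 's \<Rightarrow> real"
    and dF :: "'n \<Rightarrow> real ^ 'd \<Rightarrow> 's \<Rightarrow> real ^ 'd"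
    and df :: "'n \<Rightarrow> real ^ 'd \<Rightarrow> real ^ 'd"
    and Q :: "'z measure"
    and C :: "'z \<Rightarrow> real ^ 'd \<Rightarrow> real ^ 'd"
    and M :: "'w measure"
    and u :: "nat \<Rightarrow> 'n \<Rightarrow> nat \<Rightarrow> 'w \<Rightarrow> real ^ 'd"
    and \<xi> :: "nat \<Rightarrow> 'n \<Rightarrow> nat \<Rightarrow> 'w \<Rightarrow> 's"
    and \<zeta> :: "nat \<Rightarrow> 'n \<Rightarrow> nat \<Rightarrow> 'w \<Rightarrow> 'z"
    and x0 :: "nat \<Rightarrow> 'n \<Rightarrow> real ^ 'd"
    and x xh b q :: "nat \<Rightarrow> 'n \<Rightarrow> nat \<Rightarrow> 'w \<Rightarrow> real ^ 'd"
    and xstar :: "real ^ 'd"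
    and Rin Rout L \<rho> \<sigma> r \<omega> \<psi> \<gamma> c :: real
    and \<mu> \<epsilon> :: "nat \<Rightarrow> real"
    and \<eta> :: "nat \<Rightarrow> real"
  defines "\<delta> \<equiv> spectral_gap W"
    and "\<beta> \<equiv> laplacian_norm W"
    and "c0 \<equiv> c0_const \<psi> r \<omega>"
  assumes network: "network N W"
    and feasible: "feasible_set \<Omega> Rin Rout"
    and sampling: "sampling_model P F \<Omega>"
    and convex_lipschitz: "convex_lipschitz_samples P F \<Omega> L"
    \<comment> \<open>The queries at distance \<open>\<mu>\<close> can leave \<open>\<Omega>\<close>, so these properties must persist slightly beyond it.\<close>
    and query_margin: "0 < \<rho>" "convex_lipschitz_samples P F (\<Union>y\<in>\<Omega>. cball y \<rho>) L"
    and variance: "bounded_gradient_variance P F \<Omega> dF df \<sigma>"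
    and compressor: "compressor Q C r \<omega>"
    and \<mu>: "\<And>T. 1 \<le> T \<Longrightarrow> \<mu> T = 1 / sqrt (real T)"
    and \<epsilon>: "\<And>T. 1 \<le> T \<Longrightarrow> \<epsilon> T = \<mu> T / (2 * Rin)"
    and \<psi>: "0 < \<psi>" "\<psi> \<le> 1 / r"
    and c: "0 < c"
    and \<eta>: "\<And>k. \<eta> k = 1 / sqrt (real k + c)"
    and \<gamma>: "0 < \<gamma>" "\<gamma> < min 1 (min (\<delta> / kappa1 \<delta> \<beta> c0 \<gamma>) (c0 / kappa2 \<delta> \<beta> c0 \<gamma>))"
    and prob: "prob_space M"
    and fresh: "\<And>T. 1 \<le> T \<Longrightarrow> fresh_randomness M P Q (u T) (\<xi> T) (\<zeta> T)"
    and init: "\<And>T i. 1 \<le> T \<Longrightarrow> x0 T i \<in> \<Omega>"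
    and run: "\<And>T w. 1 \<le> T \<Longrightarrow> w \<in> space M \<Longrightarrow>
        com_dszo \<Omega> N W F C \<eta> (\<mu> T) (\<epsilon> T) \<psi> \<gamma> (x0 T)
          (\<lambda>i k. u T i k w) (\<lambda>i k. \<xi> T i k w) (\<lambda>i k. \<zeta> T i k w)
          (\<lambda>i k. x T i k w) (\<lambda>i k. xh T i k w) (\<lambda>i k. b T i k w) (\<lambda>i k. q T i k w)"
    and optimal: "optimal_point P F \<Omega> xstar"
  shows "\<exists>A B :: nat \<Rightarrow> real.
      A \<in> O(\<lambda>T. (real CARD('d))\<^sup>2 * sqrt (real T + c)) \<and>
      B \<in> O(\<lambda>T. (real CARD('d))\<^sup>2 / (\<psi> * r * \<omega>)\<^sup>2 * (sqrt (real T + c) + ln (real T + c))) \<and>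
      (\<forall>T\<ge>1. (\<Sum>k=1..T. \<integral>w. (objective P F (agent_average (\<lambda>i. x T i k w)) - objective P F xstar) \<partial>M)
               \<le> A T + B T)"
proof -
  define LHS where "LHS = (\<lambda>T. \<Sum>k=1..T. \<integral>w. (objective P F (agent_average (\<lambda>i. x T i k w)) - objective P F xstar) \<partial>M)"
  interpret net: gossip N W by unfold_locales (rule network)
  have Rin: "0 < Rin" and Rout: "0 < Rout" using feasible by (auto simp: feasible_set_def)
  have L: "0 < L" using convex_lipschitz by (simp add: convex_lipschitz_samples_def)
  have r: "1 \<le> r" "0 < \<omega>" "\<omega> \<le> 1" using compressor by (auto simp: compressor_def)
  have pr: "0 < \<psi> * r" "\<psi> * r \<le> 1" using \<psi> r by (auto simp: field_simps)
  have c0: "0 < c0" "c0 \<le> 1"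
    using pr r mult_mono[of "\<psi> * r" 1 \<omega> 1] by (auto simp: c0_def c0_const_def)
  have gap: "0 < \<delta>" and lap: "0 < \<beta>" using net.gap net.laplacian by (auto simp: \<delta>_def \<beta>_def)
  have \<gamma>1: "\<gamma> \<le> 1" using \<gamma>(2) by simp
  \<comment> \<open>from \<open>\<gamma> * kappa2 < c0\<close>, keeping only the part \<open>2 / \<delta> * \<beta>\<^sup>2\<close> of \<open>kappa2\<close>\<close>
  have small: "2 * \<gamma> * \<beta>\<^sup>2 < c0 * \<delta>"
  proof -
    have "0 \<le> (1 + 1 / c0)\<^sup>2 * \<gamma> * \<beta>\<^sup>2" using \<gamma>(1) by simp
    then have "(2 / \<delta>) * \<beta>\<^sup>2 \<le> kappa2 \<delta> \<beta> c0 \<gamma>" by (simp add: kappa2_def distrib_right)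
    moreover have "0 < (2 / \<delta>) * \<beta>\<^sup>2" using gap lap by simp
    ultimately have k2: "0 < kappa2 \<delta> \<beta> c0 \<gamma>" "\<gamma> * ((2 / \<delta>) * \<beta>\<^sup>2) \<le> \<gamma> * kappa2 \<delta> \<beta> c0 \<gamma>"
      using \<gamma>(1) by (linarith, intro mult_left_mono) auto
    have "\<gamma> < c0 / kappa2 \<delta> \<beta> c0 \<gamma>" using \<gamma>(2) by simp
    then have "\<gamma> * kappa2 \<delta> \<beta> c0 \<gamma> < c0" using k2(1) by (simp add: pos_less_divide_eq)
    then have "\<gamma> * ((2 / \<delta>) * \<beta>\<^sup>2) < c0" using k2(2) by linarith
    then show ?thesis using gap by (simp add: field_simps)
  qed
  obtain s \<theta> where s: "0 < s" and \<theta>: "0 < \<theta>" "\<theta> < 1"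
    "(1 - \<gamma> * spectral_gap W) + \<gamma> * laplacian_norm W * ((1 - c0) * s) \<le> \<theta>"
    "(1 + \<gamma> * laplacian_norm W) * ((1 - c0) * s) + \<gamma> * laplacian_norm W \<le> \<theta> * s"
    using net.contraction_weights[OF \<gamma>(1) \<gamma>1 c0] small unfolding \<delta>_def \<beta>_def by metis
  define gb where "gb = sqrt (real CARD('n)) * (real CARD('d) * L)"
  define R where "R = 3 * (sqrt (real CARD('n)) * Rout)"
  have gb: "0 \<le> gb" and R: "0 \<le> R" using L Rout by (auto simp: gb_def R_def)
  have g: "gb \<le> gb + gb / s" "gb \<le> s * (gb + gb / s)" and v1: "R \<le> R + R / s" "R \<le> s * (R + R / s)"
    using s gb R by (auto simp: distrib_left)
  obtain v K where v: "v 1 = R + R / s" "\<And>k. 1 \<le> k \<Longrightarrow> v (Suc k) = \<theta> * v k + \<eta> k * (gb + gb / s)"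
    and vK: "\<And>k. 1 \<le> k \<Longrightarrow> v k \<le> K * \<eta> k"
    using damped_recursion[OF c \<eta> \<theta>(1,2), of "gb + gb / s" "R + R / s"] gb R s by auto
  define J where "J = (2 * (\<gamma> * \<beta>) * s + 2 * (\<gamma> * \<beta> * s)\<^sup>2) * K\<^sup>2 + 2 * (\<gamma> * \<beta>) * gb * K + 2 * gb\<^sup>2
      + 2 * (real CARD('n) * (L * K))"
  define e where "e = L * Rout / (2 * Rin) + 2 * (real CARD('d) + 1) * L"
  define K' where "K' = 2 * Rout\<^sup>2 + J / real CARD('n) + e"
  \<comment> \<open>from \<open>T0\<close> on, \<open>\<mu> T \<le> \<rho>\<close> and \<open>\<epsilon> T \<le> 1\<close>\<close>
  define T0 where "T0 = Suc (nat \<lceil>max (1 / \<rho>\<^sup>2) (1 / (2 * Rin)\<^sup>2)\<rceil>)"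
  have e: "0 \<le> e" using L Rout Rin by (simp add: e_def)
  have late: "LHS T \<le> K' * sqrt (real T + c)" if T: "T0 \<le> T" for T
  proof -
    have T1: "1 \<le> T" using T by (simp add: T0_def)
    have "max (1 / \<rho>\<^sup>2) (1 / (2 * Rin)\<^sup>2) \<le> real T" using T unfolding T0_def by linarith
    then have "sqrt (1 / \<rho>\<^sup>2) \<le> sqrt (real T)" "sqrt (1 / (2 * Rin)\<^sup>2) \<le> sqrt (real T)"
      by (auto intro: real_sqrt_le_mono)
    moreover have "sqrt (1 / a\<^sup>2) = 1 / a" if "0 < a" for a :: real
      using that by (simp add: real_sqrt_divide)
    ultimately have big: "1 / \<rho> \<le> sqrt (real T)" "1 / (2 * Rin) \<le> sqrt (real T)"
      using query_margin(1) Rin by (metis, metis mult_pos_pos zero_less_numeral)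
    have sT: "0 < sqrt (real T)" using T1 by simp
    have \<mu>T: "0 < \<mu> T" "\<mu> T \<le> \<rho>"
      using big(1) sT query_margin(1) by (auto simp: \<mu>[OF T1] field_simps)
    have \<epsilon>T: "0 \<le> \<epsilon> T" "\<epsilon> T \<le> 1"
      using big(2) sT Rin by (auto simp: \<epsilon>[OF T1] \<mu>[OF T1] field_simps)
    interpret run: com_dszo_run N W M \<Omega> P F Q C "u T" "\<xi> T" "\<zeta> T" "x0 T" "x T" "xh T" "b T" "q T"
      Rin Rout L \<rho> r \<omega> \<psi> \<gamma> "\<mu> T" "\<epsilon> T" \<eta>
    proof (intro com_dszo_run.intro com_dszo_run_axioms.intro net.gossip_axioms prob)
      show "0 < \<eta> k" for k using c by (simp add: \<eta>)
    qed (use feasible sampling query_margin compressor \<psi> \<gamma> \<gamma>1 \<mu>T \<epsilon>T fresh[OF T1] init[OF T1] run[OF T1] in auto)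
    have "LHS T \<le> (2 * Rout\<^sup>2 + J / real CARD('n)) * sqrt (real T + c)
      + real T * (L * (\<epsilon> T * Rout) + 2 * (real CARD('d) + 1) * L * \<mu> T)"
      unfolding LHS_def J_def \<beta>_def gb_def
      by (rule run.regret_bound[OF c \<eta> s \<theta>(1) \<theta>(3)[unfolded c0_def] \<theta>(4)[unfolded c0_def]
            g[unfolded gb_def] _ _ v(2)[unfolded gb_def] vK])
         (use v(1) v1 optimal in \<open>auto simp: R_def optimal_point_def\<close>)
    also have "real T * (L * (\<epsilon> T * Rout) + 2 * (real CARD('d) + 1) * L * \<mu> T) = e * (real T * \<mu> T)"
      by (simp add: \<epsilon>[OF T1] e_def algebra_simps)
    also have "real T * \<mu> T = sqrt (real T)" by (simp add: \<mu>[OF T1] real_div_sqrt)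
    also have "e * sqrt (real T) \<le> e * sqrt (real T + c)"
      using e c by (intro mult_left_mono) auto
    finally show ?thesis by (simp add: K'_def algebra_simps)
  qed
  \<comment> \<open>The first summand carries the whole bound; its finitely many values before \<open>T0\<close> do not matter
      for the order of growth.\<close>
  define A where "A = (\<lambda>T. if T0 \<le> T then K' * sqrt (real T + c) else LHS T)"
  have "A \<in> O(\<lambda>T. (real CARD('d))\<^sup>2 * sqrt (real T + c))"
  proof (rule bigoI[of _ "\<bar>K'\<bar> / (real CARD('d))\<^sup>2"])
    show "\<forall>\<^sub>F T in sequentially. norm (A T) \<le> \<bar>K'\<bar> / (real CARD('d))\<^sup>2 * norm ((real CARD('d))\<^sup>2 * sqrt (real T + c))"
      using eventually_ge_at_top[of T0] by eventually_elim (use c in \<open>simp add: A_def abs_mult\<close>)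
  qed
  moreover have "\<forall>T\<ge>1. LHS T \<le> A T + 0" using late by (simp add: A_def)
  ultimately show ?thesis unfolding LHS_def by (intro exI[of _ A] exI[of _ "\<lambda>_. 0"]) auto
qed

end
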